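(* The formal series $\tilde\lambda(z):=e^{\tilde\mu(z)}$ is $1$-summable in the directions of $(-\frac\pi2,\frac\pi2)$ and its Borel sum is the function $\lambda(z)=\frac{1}{\sqrt{2\pi}}z^{\frac12-z}e^z\Gamma(z)$. Moreover, writing $\tilde\lambda(z)=1+\sum_{n\ge0}g_nz^{-n-1}$, one has $$\lambda(z)\sim_1\tilde\lambda(z)=1+\sum_{n\ge0}g_nz^{-n-1}\quad\text{uniformly for }|z|>c\text{ and }\arg z\in(-\beta,\beta)$$ for any $c>0$ and $\beta\in(0,\pi)$, with rational numbers $g_0,g_1,g_2,\dots$ computable in terms of the Bernoulli numbers: $$g_0=\tfrac12B_2,\quad g_1=\tfrac18B_2^2,\quad g_2=\tfrac1{48}B_2^3+\tfrac1{12}B_4,\quad g_3=\tfrac1{384}B_2^4+\tfrac1{24}B_2B_4,\quad g_4=\tfrac1{3840}B_2^5+\tfrac1{96}B_2^2B_4+\tfrac1{30}B_6,\ \dots$$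
   Context: $\Gamma$ is Euler's gamma function; $z^{\frac12-z}=e^{(\frac12-z)\mathrm{Log}\,z}$ with the principal branch of the logarithm on $\mathbb C\setminus\mathbb R^-$. The Bernoulli numbers are defined by $\frac{\zeta}{e^\zeta-1}=1-\frac12\zeta+\sum_{k\ge1}\frac{B_{2k}}{(2k)!}\zeta^{2k}$. $\tilde\mu(z)=\sum_{k\ge1}\frac{B_{2k}}{2k(2k-1)}z^{-2k+1}$ is the Stirling series, i.e. the formal series without constant term whose formal Borel transform is $\hat\mu(\zeta)=\zeta^{-2}(\frac\zeta2\coth\frac\zeta2-1)$. The formal Borel transform is $\mathcal B(a+\sum_{n\ge0}a_nz^{-n-1})=a\delta+\sum a_n\frac{\zeta^n}{n!}$ ($\delta$ a symbol). A formal series is $1$-summable in the directions of an open interval $I$ if its Borel transform is $a\delta+\hat\varphi$ with $\hat\varphi\in\mathbb C\{\zeta\}$ extending analytically to $\{\xi e^{\mathrm i\theta}\mid\xi>0,\theta\in I\}$ with $|\hat\varphi(\xi e^{\mathrm i\theta})|\le\alpha(\theta)e^{\gamma(\theta)\xi}$ for some locally bounded $\alpha:I\to\mathbb R^+$, $\gamma:I\to\mathbb R$; for $|I|\le\pi$ its Borel sum is the function, holomorphic on $\bigcup_{\theta\in I}\{\mathrm{Re}(ze^{\mathrm i\theta})>\gamma(\theta)\}$, given by $z\mapsto a+\int_0^{+\infty}e^{-z\xi e^{\mathrm i\theta}}\hat\varphi(\xi e^{\mathrm i\theta})e^{\mathrm i\theta}d\xi$ for any $\theta\in I$ with $\mathrm{Re}(ze^{\mathrm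 i\theta})>\gamma(\theta)$. For a function $\phi$ on an unbounded set $\mathscr D\subset\mathbb C^*$ and $\tilde\phi=\sum c_nz^{-n}$, the notation "$\phi(z)\sim_1\tilde\phi(z)$ uniformly for $z\in\mathscr D$" means that there are $L,M>0$ with $|\phi(z)-\sum_{n=0}^{N-1}c_nz^{-n}|\le LM^NN!|z|^{-N}$ for all $z\in\mathscr D$, $N\in\mathbb N$. *)

theory Defs
  imports "HOL-Complex_Analysis.Complex_Analysis"
begin

text \<open>
  A formal series \<open>\<Sum>n. c\<^sub>n z\<^sup>-\<^sup>n\<close> is represented by the formal power series with coefficients
  \<open>c\<^sub>n\<close>, i.e. \<open>fps_X\<close> stands for \<open>z\<^sup>-\<^sup>1\<close>.
\<close>

text \<open>The normalisation is the one with \<open>bernoulli 1 = - 1 / 2\<close>.\<close>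

definition bernoulli :: "nat \<Rightarrow> complex" where
  "bernoulli n = fact n * fps_nth (fps_X / (fps_exp 1 - 1)) n"

text \<open>With \<open>n = 2 * k - 1\<close> the coefficient below is \<open>B\<^sub>2\<^sub>k / (2 k (2 k - 1))\<close>.\<close>

definition stirling_series :: "complex fps" where
  "stirling_series =
     Abs_fps (\<lambda>n. if odd n then bernoulli (n + 1) / (of_nat (n + 1) * of_nat n) else 0)"

definition lambda_series :: "complex fps" where
  "lambda_series = fps_compose (fps_exp 1) stirling_series"

definition lambda_fun :: "complex \<Rightarrow> complex" where
  "lambda_fun z = 1 / of_real (sqrt (2 * pi)) * z powr (1 / 2 - z) * exp z * Gamma z"

text \<open>
  The formal Borel transform of \<open>\<phi>\<close> is \<open>a \<delta> + borel_minor \<phi>\<close>, where \<open>a = fps_nth \<phi> 0\<close>.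
\<close>

definition borel_minor :: "complex fps \<Rightarrow> complex fps" where
  "borel_minor \<phi> = Abs_fps (\<lambda>n. fps_nth \<phi> (n + 1) / fact n)"

definition open_sector :: "real set \<Rightarrow> complex set" where
  "open_sector I = {of_real \<xi> * cis \<theta> | \<xi> \<theta>. \<xi> > 0 \<and> \<theta> \<in> I}"

definition locally_bounded_on :: "real set \<Rightarrow> (real \<Rightarrow> real) \<Rightarrow> bool" where
  "locally_bounded_on I f \<longleftrightarrow> (\<forall>\<theta>\<in>I. \<exists>e>0. bounded (f ` (I \<inter> ball \<theta> e)))"

text \<open>
  \<open>F\<close> is the sum of the minor near the origin together with its analytic continuation to the
  sector, and \<open>\<gamma>\<close> is an admissible exponential type; \<open>I\<close> is meant to be an open interval.
\<close>

definition one_summable_with ::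
    "real set \<Rightarrow> complex fps \<Rightarrow> (complex \<Rightarrow> complex) \<Rightarrow> (real \<Rightarrow> real) \<Rightarrow> bool" where
  "one_summable_with I \<phi> F \<gamma> \<longleftrightarrow>
     F has_fps_expansion borel_minor \<phi> \<and> F analytic_on open_sector I \<and>
     locally_bounded_on I \<gamma> \<and>
     (\<exists>\<alpha>. locally_bounded_on I \<alpha> \<and> (\<forall>\<theta>\<in>I. \<alpha> \<theta> \<ge> 0) \<and>
        (\<forall>\<theta>\<in>I. \<forall>\<xi>>0. norm (F (of_real \<xi> * cis \<theta>)) \<le> \<alpha> \<theta> * exp (\<gamma> \<theta> * \<xi>)))"

definition one_summable :: "real set \<Rightarrow> complex fps \<Rightarrow> bool" where
  "one_summable I \<phi> \<longleftrightarrow> (\<exists>F \<gamma>. one_summable_with I \<phi> F \<gamma>)"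

definition laplace_integrand ::
    "real \<Rightarrow> (complex \<Rightarrow> complex) \<Rightarrow> complex \<Rightarrow> real \<Rightarrow> complex" where
  "laplace_integrand \<theta> F z \<xi> = exp (- z * of_real \<xi> * cis \<theta>) * F (of_real \<xi> * cis \<theta>) * cis \<theta>"

text \<open>
  The domain of the Borel sum depends on the choice of \<open>\<gamma>\<close>. Here \<open>f\<close> is required to be given by
  the Laplace integrals on the domain belonging to every admissible \<open>\<gamma>\<close>; this is appropriate for
  intervals of length at most \<open>\<pi>\<close>.
\<close>

definition has_borel_sum :: "real set \<Rightarrow> complex fps \<Rightarrow> (complex \<Rightarrow> complex) \<Rightarrow> bool" where
  "has_borel_sum I \<phi> f \<longleftrightarrow>
     one_summable I \<phi> \<and>
     (\<forall>F \<gamma>. one_summable_with I \<phi> F \<gamma> \<longrightarrow>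
        (\<forall>\<theta>\<in>I. \<forall>z. Re (z * cis \<theta>) > \<gamma> \<theta> \<longrightarrow>
           set_integrable lborel {0<..} (laplace_integrand \<theta> F z) \<and>
           f z = fps_nth \<phi> 0 + (LBINT \<xi>:{0<..}. laplace_integrand \<theta> F z \<xi>)))"

definition gevrey1_asymp :: "(complex \<Rightarrow> complex) \<Rightarrow> complex fps \<Rightarrow> complex set \<Rightarrow> bool" where
  "gevrey1_asymp f \<phi> D \<longleftrightarrow>
     (\<exists>L>0. \<exists>M>0. \<forall>z\<in>D. \<forall>N.
        norm (f z - (\<Sum>n<N. fps_nth \<phi> n / z ^ n)) \<le> L * M ^ N * fact N / norm z ^ N)"

end

theory Submission
  imports Defs "HOL-Probability.Sinc_Integral" "HOL-Real_Asymp.Real_Asymp"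
begin

text \<open>
  By Binet's formula \<open>lambda_fun z = exp (L z)\<close>, where \<open>L\<close> is the Laplace transform of the minor
  \<open>\<zeta>\<^sup>-\<^sup>2 (\<zeta> / (e\<^sup>\<zeta> - 1) - 1 + \<zeta> / 2)\<close> of the Stirling series, a function that is bounded by a constant
  \<open>A\<close> on each sector around the positive axis that is narrower than the right half-plane. The Laplace
  transform turns convolution into multiplication, so \<open>exp L\<close> is \<open>1\<close> plus the Laplace transform of the
  convolution exponential of that minor; its \<open>k\<close>-th term is at most \<open>A\<^sup>k |\<zeta>|\<^sup>k\<^sup>-\<^sup>1 / (k - 1)! / k!\<close>, so it is
  analytic and of exponential type \<open>A\<close> on each of these sectors. Laplace integrals in different
  directions agree by Cauchy's theorem, and rotating the direction by \<open>- arg z / 2\<close> gives the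
  \<open>1\<close>-Gevrey estimates on all of \<open>|arg z| < \<beta>\<close> with \<open>\<beta> < \<pi>\<close>.
\<close>

subsection \<open>Bernoulli numbers and the formal series\<close>

text \<open>The Borel sum is defined by a condition on every continuation and every admissible
  \<open>\<gamma>\<close>. The continuation is unique, but a value
  \<open>\<gamma> \<theta> < 0\<close> would give a half-plane that contains \<open>0\<close>, where
  the function is singular. The behaviour near \<open>0\<close> must exclude such values before the
  Laplace formula can be claimed on each half-plane. The exponential type supplied by the
  convolution exponential grows like \<open>1 / cos \<theta>\<close> towards the ends of the
  interval. Laplace identities are therefore obtained far out first and spread by analytic
  continuation. Likewise the Gevrey estimates first hold for large \<open>norm z\<close>; what
  remains of \<open>norm z > c\<close> is a bounded annular sector away from the cut, settled by
  compactness at the price of larger constants. Binet's formula is derived rather than presupposed: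
  two differentiations multiply the minor by \<open>x ^ 2\<close> and leave
  \<open>x / (exp x - 1) - 1 + x / 2\<close>, whose geometric expansion produces the trigamma
  series.\<close>

lemma bernoulli_gf_mult: "(fps_X / (fps_exp 1 - 1)) * (fps_exp 1 - 1) = (fps_X :: complex fps)"
proof -
  have nz: "fps_exp 1 - 1 \<noteq> (0 :: complex fps)"
  proof
    assume "fps_exp 1 - 1 = (0 :: complex fps)"
    hence "fps_nth (fps_exp 1 - 1 :: complex fps) 1 = 0" by simp
    thus False by simp
  qed
  \<comment> \<open>Division of power series is exact only under divisibility, which for a nonzero
    divisor is a comparison of subdegrees.\<close>
  have "subdegree (fps_exp 1 - 1 :: complex fps) \<le> 1"
    by (rule subdegree_leI) simp
  hence "(fps_exp 1 - 1) dvd (fps_X :: complex fps)"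
    using nz by (simp add: fps_dvd_iff)
  thus ?thesis by simp
qed

lemma bernoulli_gf_nth: "fps_nth (fps_X / (fps_exp 1 - 1)) n = bernoulli n / fact n"
  by (simp add: bernoulli_def)

text \<open>Coefficient \<open>n + 1\<close> of the generating identity. The index
  \<open>i = n + 1\<close> drops out because \<open>fps_exp 1 - 1\<close> has no constant
  term.\<close>

lemma bernoulli_rec: "(\<Sum>i\<le>n. bernoulli i / (fact i * fact (Suc n - i))) = (if n = 0 then 1 else 0)"
proof -
  have "fps_nth ((fps_X / (fps_exp 1 - 1)) * (fps_exp 1 - 1)) (Suc n) = fps_nth (fps_X :: complex fps) (Suc n)"
    by (simp only: bernoulli_gf_mult)
  also have "fps_nth ((fps_X / (fps_exp 1 - 1)) * (fps_exp 1 - 1)) (Suc n) =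
     (\<Sum>i\<le>Suc n. bernoulli i / fact i * (if i = Suc n then 0 else 1 / fact (Suc n - i)))"
    unfolding fps_mult_nth atLeast0AtMost bernoulli_gf_nth
    by (intro sum.cong refl) auto
  also have "\<dots> = (\<Sum>i\<le>n. bernoulli i / (fact i * fact (Suc n - i)))"
    by (simp add: mult.commute)
  finally show ?thesis by simp
qed

lemma bernoulli_0: "bernoulli 0 = 1"
  using bernoulli_rec[of 0] by simp

lemma bernoulli_1: "bernoulli 1 = -1/2"
  using bernoulli_rec[of 1] by (simp add: bernoulli_0 eval_nat_numeral field_simps eq_neg_iff_add_eq_0)

lemma Rats_fact [simp]: "(fact n :: complex) \<in> \<rat>"
  by (metis Rats_of_nat of_nat_fact)

lemma bernoulli_Rats: "bernoulli n \<in> \<rat>"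
proof (induction n rule: less_induct)
  case (less n)
  have "(\<Sum>i<n. bernoulli i / (fact i * fact (Suc n - i))) + bernoulli n / fact n = (if n = 0 then 1 else 0)"
    using bernoulli_rec[of n] by (simp add: lessThan_Suc_atMost[symmetric])
  hence "bernoulli n = fact n * ((if n = 0 then 1 else 0) - (\<Sum>i<n. bernoulli i / (fact i * fact (Suc n - i))))"
    by (simp add: field_simps)
  also have "\<dots> \<in> \<rat>"
    using less.IH by (intro Rats_mult Rats_diff Rats_sum Rats_divide) auto
  finally show ?case .
qed

text \<open>Replacing \<open>X\<close> by \<open>-X\<close> turns \<open>X / (e\<^sup>X - 1)\<close> into \<open>X / (e\<^sup>X - 1) + X\<close>.\<close>

lemma bernoulli_odd_eq_0:
  assumes "odd n" "n \<noteq> 1"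
  shows   "bernoulli n = 0"
proof -
  let ?b = "fps_X / (fps_exp 1 - 1) :: complex fps"
  let ?E = "fps_exp 1 :: complex fps"
  have E0: "?E - 1 \<noteq> 0"
  proof
    assume "?E - 1 = 0"
    hence "fps_nth (?E - 1) 1 = 0" by simp
    thus False by simp
  qed
  have "(?b oo (-fps_X)) * ((?E - 1) oo (-fps_X)) = fps_X oo (-fps_X)"
    by (subst fps_compose_mult_distrib[symmetric]) (simp_all only: bernoulli_gf_mult, simp)
  moreover have "(?E - 1) oo (-fps_X) = fps_exp (-1) - 1"
    by (simp add: fps_compose_sub_distrib fps_exp_compose_linear[of 1 "-1", simplified] flip: fps_const_neg)
  moreover have "fps_X oo (-fps_X) = (-fps_X :: complex fps)"
    by simp
  \<comment> \<open>Multiplication by \<open>?E\<close> turns \<open>fps_exp (-1) - 1\<close> into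
    \<open>1 - ?E\<close>, so that the nonzero factor \<open>?E - 1\<close> can be cancelled against
    the original identity.\<close>
  ultimately have "(?b oo (-fps_X)) * (fps_exp (-1) - 1) * ?E = -fps_X * ?E"
    by simp
  moreover have "fps_exp (-1) * ?E = 1"
    by (simp add: fps_exp_add_mult[symmetric])
  moreover have "C * (E' - 1) * E = C * (E' * E) - C * E" for C E' E :: "complex fps"
    by (simp add: algebra_simps)
  ultimately have "(?b oo (-fps_X)) * (1 - ?E) = -fps_X * ?E"
    by (simp add: right_diff_distrib)
  hence "(?b oo (-fps_X)) * (?E - 1) = ?b * (?E - 1) + fps_X * (?E - 1)"
    unfolding bernoulli_gf_mult by (simp add: algebra_simps)
  hence "?b oo (-fps_X) = ?b + fps_X"
    using E0 by (metis distrib_right mult_right_cancel)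
  hence "fps_nth (?b oo (-fps_X)) n = fps_nth ?b n + fps_nth fps_X n"
    by simp
  moreover have "fps_nth (?b oo (-fps_X)) n = (-1) ^ n * fps_nth ?b n"
    by (simp add: fps_compose_uminus')
  ultimately show ?thesis
    using assms by (simp add: bernoulli_gf_nth)
qed

section \<open>The coefficients of the exponential of the Stirling series\<close>

lemma stirling_series_nth_0 [simp]: "fps_nth stirling_series 0 = 0"
  by (simp add: stirling_series_def)

lemma lambda_series_nth_0 [simp]: "fps_nth lambda_series 0 = 1"
  by (simp add: lambda_series_def)

text \<open>Coefficient form of the differential equation \<lambda>' = \<mu>' \<lambda>. It avoids
  expanding powers of the Stirling series and gives both rationality and the explicit
  coefficients.\<close>

lemma lambda_series_rec:
  "of_nat (Suc n) * fps_nth lambda_series (Suc n) =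
     (\<Sum>i\<le>n. of_nat (Suc i) * fps_nth stirling_series (Suc i) * fps_nth lambda_series (n - i))"
proof -
  have "fps_deriv lambda_series = fps_deriv stirling_series * lambda_series"
    unfolding lambda_series_def by (subst fps_compose_deriv) (auto simp: mult.commute)
  hence "fps_nth (fps_deriv lambda_series) n = fps_nth (fps_deriv stirling_series * lambda_series) n"
    by simp
  thus ?thesis
    by (simp add: fps_mult_nth atLeast0AtMost)
qed

lemma stirling_series_Rats: "fps_nth stirling_series n \<in> \<rat>"
  by (auto simp: stirling_series_def intro!: Rats_divide Rats_mult Rats_add bernoulli_Rats)

lemma lambda_series_Rats: "fps_nth lambda_series n \<in> \<rat>"
proof (induction n rule: less_induct)
  case (less n)
  show ?case
  proof (cases n)
    case (Suc m)
    have "fps_nth lambda_series (Suc m) = (\<Sum>i\<le>m. of_nat (Suc i) * fps_nth stirling_series (Suc i) * fps_nth lambda_series (m - i)) / of_nat (Suc m)"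
      using lambda_series_rec[of m] by (simp add: field_simps del: of_nat_Suc)
    also have "\<dots> \<in> \<rat>"
      using less.IH Suc by (intro Rats_divide Rats_sum Rats_mult stirling_series_Rats) auto
    finally show ?thesis using Suc by simp
  qed auto
qed

lemma lambda_series_coeffs:
  "fps_nth lambda_series 1 = 1/2 * bernoulli 2"
  "fps_nth lambda_series 2 = 1/8 * bernoulli 2 ^ 2"
  "fps_nth lambda_series 3 = 1/48 * bernoulli 2 ^ 3 + 1/12 * bernoulli 4"
  "fps_nth lambda_series 4 = 1/384 * bernoulli 2 ^ 4 + 1/24 * bernoulli 2 * bernoulli 4"
  "fps_nth lambda_series 5 = 1/3840 * bernoulli 2 ^ 5 + 1/96 * bernoulli 2 ^ 2 * bernoulli 4 + 1/30 * bernoulli 6"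
proof -
  have s: "fps_nth stirling_series 1 = bernoulli 2 / 2" "fps_nth stirling_series 2 = 0"
    "fps_nth stirling_series 3 = bernoulli 4 / 12" "fps_nth stirling_series 4 = 0"
    "fps_nth stirling_series 5 = bernoulli 6 / 30"
    by (simp_all add: stirling_series_def bernoulli_odd_eq_0 flip: numeral_2_eq_2)
  let ?s = "fps_nth stirling_series" and ?l = "fps_nth lambda_series"
  have r: "?l 1 = ?s 1" "2 * ?l 2 = ?s 1 * ?l 1 + 2 * ?s 2"
    "3 * ?l 3 = ?s 1 * ?l 2 + 2 * ?s 2 * ?l 1 + 3 * ?s 3"
    "4 * ?l 4 = ?s 1 * ?l 3 + 2 * ?s 2 * ?l 2 + 3 * ?s 3 * ?l 1 + 4 * ?s 4"
    "5 * ?l 5 = ?s 1 * ?l 4 + 2 * ?s 2 * ?l 3 + 3 * ?s 3 * ?l 2 + 4 * ?s 4 * ?l 1 + 5 * ?s 5"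
    using lambda_series_rec[of 0] lambda_series_rec[of 1] lambda_series_rec[of 2]
      lambda_series_rec[of 3] lambda_series_rec[of 4]
    by (simp_all add: eval_nat_numeral)
  show 1: "?l 1 = 1/2 * bernoulli 2"
    using r(1) s by simp
  show 2: "?l 2 = 1/8 * bernoulli 2 ^ 2"
    using r(2) unfolding s 1 by (simp add: field_simps power_numeral_reduce)
  show 3: "?l 3 = 1/48 * bernoulli 2 ^ 3 + 1/12 * bernoulli 4"
    using r(3) unfolding s 1 2 by (simp add: field_simps power_numeral_reduce)
  show 4: "?l 4 = 1/384 * bernoulli 2 ^ 4 + 1/24 * bernoulli 2 * bernoulli 4"
    using r(4) unfolding s 1 2 3 by (simp add: field_simps power_numeral_reduce)
  show "?l 5 = 1/3840 * bernoulli 2 ^ 5 + 1/96 * bernoulli 2 ^ 2 * bernoulli 4 + 1/30 * bernoulli 6"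
    using r(5) unfolding s 1 2 3 4 by (simp add: field_simps power_numeral_reduce)
qed

subsection \<open>Convolution\<close>

text \<open>This is \<open>\<integral>\<^sub>0\<^sup>z f(s) g(z - s) ds\<close> along the segment from \<open>0\<close> to \<open>z\<close>.\<close>

definition convol :: "(complex \<Rightarrow> complex) \<Rightarrow> (complex \<Rightarrow> complex) \<Rightarrow> complex \<Rightarrow> complex" where
  "convol f g z = z * integral {0..1} (\<lambda>t. f (of_real t * z) * g (of_real (1 - t) * z))"

text \<open>This is what keeps the segment of integration in \<open>convol\<close> inside the
  domain. Convexity would be too much to ask: \<open>sector_dom\<close> below, a disc joined to a
  cone, is in general not convex.\<close>

definition starlike0 :: "complex set \<Rightarrow> bool" where
  "starlike0 S \<longleftrightarrow> (\<forall>z\<in>S. \<forall>t\<in>{0..1}. of_real t * z \<in> S)"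

lemma starlike0D: "starlike0 S \<Longrightarrow> z \<in> S \<Longrightarrow> 0 \<le> t \<Longrightarrow> t \<le> 1 \<Longrightarrow> of_real t * z \<in> S"
  by (auto simp: starlike0_def)

lemma continuous_on_convol_integrand:
  fixes f g :: "complex \<Rightarrow> complex"
  assumes "continuous_on S f" "continuous_on S g" "starlike0 S" "z \<in> S"
  shows   "continuous_on {0..1} (\<lambda>t. f (of_real t * z) * g (of_real (1 - t) * z))"
proof (rule continuous_on_mult)
  show "continuous_on {0..1} (\<lambda>t. f (of_real t * z))"
    using starlike0D[OF assms(3,4)]
    by (intro continuous_on_compose2[OF assms(1)] continuous_intros) auto
  show "continuous_on {0..1} (\<lambda>t. g (of_real (1 - t) * z))"
    using starlike0D[OF assms(3,4)]
    by (intro continuous_on_compose2[OF assms(2)] continuous_intros) (auto simp del: of_real_diff)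
qed

text \<open>Differentiation under the integral sign. It is carried out on small discs because the
  Leibniz rule is stated for convex sets, while \<open>S\<close> is only starlike.\<close>

lemma holomorphic_on_convol:
  assumes f: "f holomorphic_on S" and g: "g holomorphic_on S" and S: "open S" "starlike0 S"
  shows   "convol f g holomorphic_on S"
proof -
  have *: "(\<lambda>z. integral {0..1} (\<lambda>t. f (of_real t * z) * g (of_real (1 - t) * z))) holomorphic_on ball w r"
    if wr: "ball w r \<subseteq> S" for w r
  proof -
    let ?D = "\<lambda>z t. f (of_real t * z) * (deriv g (of_real (1 - t) * z) * of_real (1 - t)) +
                   (deriv f (of_real t * z) * of_real t) * g (of_real (1 - t) * z)"
    have cont: "continuous_on S f" "continuous_on S g" "continuous_on S (deriv f)" "continuous_on S (deriv g)"
      using f g S by (auto intro!: holomorphic_on_imp_continuous_on holomorphic_deriv)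
    have mem: "of_real t * z \<in> S" "of_real (1 - t) * z \<in> S" if "z \<in> ball w r" "t \<in> {0..1}" for z t
      using that wr starlike0D[OF S(2)] by (auto simp del: of_real_diff)
    have "(\<lambda>z. integral (cbox 0 1) (\<lambda>t. f (of_real t * z) * g (of_real (1 - t) * z))) holomorphic_on ball w r"
    proof (rule leibniz_rule_holomorphic[where fx = ?D])
      fix z t assume zt: "z \<in> ball w r" "t \<in> cbox (0::real) 1"
      have m: "of_real t * z \<in> S" "of_real (1 - t) * z \<in> S"
        using mem zt by (auto simp del: of_real_diff)
      let ?u = "\<lambda>z. of_real t * z" and ?v = "\<lambda>z. of_real (1 - t) * z"
      have df: "(f has_field_derivative deriv f (of_real t * z)) (at (of_real t * z))"
        using f S m by (simp add: holomorphic_derivI)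
      have dg: "(g has_field_derivative deriv g (of_real (1 - t) * z)) (at (of_real (1 - t) * z))"
        using g S m by (simp add: holomorphic_derivI del: of_real_diff)
      show "((\<lambda>z. f (of_real t * z) * g (of_real (1 - t) * z)) has_field_derivative ?D z t) (at z within ball w r)"
      proof (rule DERIV_mult')
        show "((\<lambda>z. f (of_real t * z)) has_field_derivative deriv f (of_real t * z) * of_real t) (at z within ball w r)"
          by (rule DERIV_chain2[where f = f and g = ?u, OF df]) (auto intro!: derivative_eq_intros)
        show "((\<lambda>z. g (of_real (1 - t) * z)) has_field_derivative deriv g (of_real (1 - t) * z) * of_real (1 - t)) (at z within ball w r)"
          by (rule DERIV_chain2[where f = g and g = ?v, OF dg]) (auto intro!: derivative_eq_intros)
      qed
    next
      fix z assume "z \<in> ball w r"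
      hence "z \<in> S" using wr by blast
      thus "(\<lambda>t. f (of_real t * z) * g (of_real (1 - t) * z)) integrable_on cbox 0 1"
        using continuous_on_convol_integrand[OF cont(1,2) S(2), of z]
        by (auto intro: integrable_continuous_interval simp del: of_real_diff)
    next
      show "continuous_on (ball w r \<times> cbox 0 1) (\<lambda>(z, t). ?D z t)"
        unfolding split_beta
        by (intro continuous_intros continuous_on_compose2[OF cont(1)] continuous_on_compose2[OF cont(2)]
              continuous_on_compose2[OF cont(3)] continuous_on_compose2[OF cont(4)])
           (auto simp del: of_real_diff intro: mem simp flip: mem_ball)
    qed auto
    thus ?thesis by simp
  qed
  have "convol f g analytic_on S"
    unfolding analytic_on_def
  proof
    fix w assume "w \<in> S"
    then obtain r where r: "r > 0" "ball w r \<subseteq> S"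
      using S openE by blast
    thus "\<exists>e>0. convol f g holomorphic_on ball w e"
      unfolding convol_def by (intro exI[of _ r] conjI holomorphic_intros *) auto
  qed
  thus ?thesis by (rule analytic_imp_holomorphic)
qed

lemma has_integral_one_minus_power: "((\<lambda>t::real. (1 - t) ^ n) has_integral (1 / real (Suc n))) {0..1}"
proof -
  have "((\<lambda>t::real. (1 - t) ^ n) has_integral ((- ((1 - 1) ^ Suc n) / real (Suc n)) - (- ((1 - 0) ^ Suc n) / real (Suc n)))) {0..1}"
    by (rule fundamental_theorem_of_calculus)
       (auto simp del: power_Suc of_nat_Suc simp flip: has_real_derivative_iff_has_vector_derivative
             intro!: derivative_eq_intros)
  thus ?thesis by simp
qed

text \<open>The bound on \<open>g\<close> contributes a factor \<open>(1 - t) ^ n\<close>, whose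
  integral \<open>1 / (n + 1)\<close> turns \<open>fact n\<close> into \<open>fact (Suc n)\<close>;
  the factor \<open>z\<close> in front raises the power. Iteration yields the factorial decay of the
  convolution powers.\<close>

lemma norm_convol_le:
  assumes f: "continuous_on S f" "\<And>z. z \<in> S \<Longrightarrow> norm (f z) \<le> A"
  assumes g: "continuous_on S g" "\<And>z. z \<in> S \<Longrightarrow> norm (g z) \<le> B * norm z ^ n / fact n"
  assumes S: "starlike0 S" "z \<in> S"
  shows   "norm (convol f g z) \<le> A * B * norm z ^ Suc n / fact (Suc n)"
proof -
  have A: "A \<ge> 0" using f(2)[OF S(2)] norm_ge_zero order_trans by blast
  have mem: "of_real t * z \<in> S" "of_real (1 - t) * z \<in> S" if "t \<in> {0..1}" for t
    using that starlike0D[OF S] by (auto simp del: of_real_diff)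
  have "norm (integral {0..1} (\<lambda>t. f (of_real t * z) * g (of_real (1 - t) * z))) \<le>
        integral {0..1} (\<lambda>t. A * (B * norm z ^ n / fact n) * (1 - t) ^ n)"
  proof (rule integral_norm_bound_integral)
    show "(\<lambda>t. f (of_real t * z) * g (of_real (1 - t) * z)) integrable_on {0..1}"
      using continuous_on_convol_integrand[OF f(1) g(1) S] by (rule integrable_continuous_interval)
    show "(\<lambda>t. A * (B * norm z ^ n / fact n) * (1 - t) ^ n) integrable_on {0..1}"
      by (intro integrable_continuous_interval continuous_intros)
    fix t :: real assume t: "t \<in> {0..1}"
    have "norm (f (of_real t * z) * g (of_real (1 - t) * z)) \<le> A * (B * norm (of_real (1 - t) * z) ^ n / fact n)"
      unfolding norm_mult[of "f _"] using f(2)[OF mem(1)[OF t]] g(2)[OF mem(2)[OF t]] A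
      by (intro mult_mono) auto
    also have "norm (of_real (1 - t) * z) = (1 - t) * norm z"
      using t by (simp add: norm_mult del: of_real_diff)
    finally show "norm (f (of_real t * z) * g (of_real (1 - t) * z)) \<le> A * (B * norm z ^ n / fact n) * (1 - t) ^ n"
      by (simp add: power_mult_distrib mult_ac)
  qed
  also have "\<dots> = A * (B * norm z ^ n / fact n) * (1 / real (Suc n))"
    using has_integral_mult_right[OF has_integral_one_minus_power] by (rule integral_unique)
  finally have "norm z * norm (integral {0..1} (\<lambda>t. f (of_real t * z) * g (of_real (1 - t) * z)))
      \<le> norm z * (A * (B * norm z ^ n / fact n) * (1 / real (Suc n)))"
    by (rule mult_left_mono) auto
  thus ?thesis by (simp add: convol_def norm_mult field_simps)
qed

lemma integral_beta: "integral {0..1} (\<lambda>t. of_real (t ^ i * (1 - t) ^ j)) = (fact i * fact j / fact (Suc (i + j)) :: complex)"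
proof -
  have "((\<lambda>t::real. t powr (real (Suc i) - 1) * (1 - t) powr (real (Suc j) - 1)) has_integral Beta (real (Suc i)) (real (Suc j))) {0..1}"
    by (rule has_integral_Beta_real) auto
  \<comment> \<open>At the end points \<open>powr\<close> and \<open>^\<close> can disagree, since
    \<open>0 powr 0 = 0\<close> but \<open>0 ^ 0 = 1\<close>; a finite set does not affect the
    integral.\<close>
  also have "?this \<longleftrightarrow> ((\<lambda>t::real. t ^ i * (1 - t) ^ j) has_integral Beta (real (Suc i)) (real (Suc j))) {0..1}"
    by (rule has_integral_spike_finite_eq[of "{0, 1}"]) (auto simp: powr_realpow)
  also have "Beta (real (Suc i)) (real (Suc j)) = fact i * fact j / fact (Suc (i + j))"
    using Gamma_fact[of i, where 'a = real] Gamma_fact[of j, where 'a = real] Gamma_fact[of "Suc (i + j)", where 'a = real]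
    by (simp add: Beta_def add_ac)
  finally have "((\<lambda>t. complex_of_real (t ^ i * (1 - t) ^ j)) has_integral of_real (fact i * fact j / fact (Suc (i + j)))) {0..1}"
    by (rule has_integral_of_real)
  thus ?thesis by (simp add: integral_unique)
qed

lemma borel_minor_nth: "fps_nth (borel_minor \<phi>) n = fps_nth \<phi> (Suc n) / fact n"
  by (simp add: borel_minor_def)

text \<open>Passes from a statement about germs to an actual disc of absolute convergence, as needed
  for Cauchy products and termwise integration.\<close>

lemma has_fps_expansion_imp_abs_sums:
  fixes f :: "complex \<Rightarrow> complex"
  assumes "f has_fps_expansion F"
  obtains r where "r > 0"
    "\<And>z. norm z < r \<Longrightarrow> (\<lambda>n. fps_nth F n * z ^ n) sums f z"
    "\<And>z. norm z < r \<Longrightarrow> summable (\<lambda>n. norm (fps_nth F n * z ^ n))"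
proof -
  from assms have R: "fps_conv_radius F > 0" and ev: "eventually (\<lambda>z. eval_fps F z = f z) (nhds 0)"
    by (auto simp: has_fps_expansion_def)
  from ev obtain e where e: "e > 0" "\<And>z. norm z < e \<Longrightarrow> eval_fps F z = f z"
    by (auto simp: eventually_nhds_metric dist_norm)
  obtain q :: ereal where q: "0 < q" "q < fps_conv_radius F"
    using R dense by blast
  then obtain d where d: "d > 0" "ereal d < fps_conv_radius F"
    by (cases q) auto
  have *: "norm z < fps_conv_radius F" if "norm z < min d e" for z :: complex
    using that d by (meson ereal_less_le less_ereal.simps(1) less_imp_le less_le_trans min_less_iff_conj order_less_trans)
  show ?thesis
  proof (rule that[of "min d e"])
    fix z :: complex assume z: "norm z < min d e"
    show "(\<lambda>n. fps_nth F n * z ^ n) sums f z"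
      using sums_eval_fps[OF *[OF z]] e(2) z by simp
    show "summable (\<lambda>n. norm (fps_nth F n * z ^ n))"
      using norm_summable_fps[OF *[OF z]] .
  qed (use d e in auto)
qed

text \<open>By the Beta integral, \<open>z ^ i / fact i\<close> and \<open>z ^ j / fact j\<close>
  convolve to \<open>z ^ (i + j + 1) / fact (i + j + 1)\<close>, which matches the product of two
  negative powers of the formal variable. Nonzero constant terms would contribute multiples of
  \<delta>, which \<open>convol\<close> does not see.\<close>

lemma has_fps_expansion_convol:
  assumes f: "f has_fps_expansion borel_minor \<phi>" and g: "g has_fps_expansion borel_minor \<psi>"
  assumes 0: "fps_nth \<phi> 0 = 0" "fps_nth \<psi> 0 = 0"
  shows   "convol f g has_fps_expansion borel_minor (\<phi> * \<psi>)"
proof -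
  let ?F = "\<lambda>n. fps_nth (borel_minor \<phi>) n" and ?G = "\<lambda>n. fps_nth (borel_minor \<psi>) n"
  obtain r1 where r1: "r1 > 0" "\<And>z. norm z < r1 \<Longrightarrow> (\<lambda>n. ?F n * z ^ n) sums f z"
    "\<And>z. norm z < r1 \<Longrightarrow> summable (\<lambda>n. norm (?F n * z ^ n))"
    using has_fps_expansion_imp_abs_sums[OF f] by metis
  obtain r2 where r2: "r2 > 0" "\<And>z. norm z < r2 \<Longrightarrow> (\<lambda>n. ?G n * z ^ n) sums g z"
    "\<And>z. norm z < r2 \<Longrightarrow> summable (\<lambda>n. norm (?G n * z ^ n))"
    using has_fps_expansion_imp_abs_sums[OF g] by metis
  have nth0: "fps_nth (borel_minor (\<phi> * \<psi>)) 0 = 0"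
    using 0 by (simp add: borel_minor_nth fps_mult_nth)
  have nthSuc: "fps_nth (borel_minor (\<phi> * \<psi>)) (Suc k) =
      (\<Sum>i\<le>k. ?F i * ?G (k - i) * (fact i * fact (k - i) / fact (Suc k)))" for k
  proof -
    have "fps_nth (\<phi> * \<psi>) (Suc (Suc k)) = (\<Sum>i\<le>Suc (Suc k). fps_nth \<phi> i * fps_nth \<psi> (Suc (Suc k) - i))"
      by (simp add: fps_mult_nth atLeast0AtMost)
    also have "\<dots> = (\<Sum>i\<le>Suc k. fps_nth \<phi> (Suc i) * fps_nth \<psi> (Suc k - i))"
      using 0 by (subst sum.atMost_Suc_shift) simp
    also have "\<dots> = (\<Sum>i\<le>k. fps_nth \<phi> (Suc i) * fps_nth \<psi> (Suc (k - i)))"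
      using 0 by (simp add: Suc_diff_le)
    finally show ?thesis
      by (simp add: borel_minor_nth sum_divide_distrib)
  qed
  have sums: "(\<lambda>n. fps_nth (borel_minor (\<phi> * \<psi>)) n * z ^ n) sums convol f g z"
    if z: "norm z < min r1 r2" for z
  proof -
    \<comment> \<open>\<open>u k t\<close> is the \<open>k\<close>-th term of the Cauchy product of
      the two Taylor series at the points of the segment; \<open>M k\<close> bounds it independently
      of \<open>t\<close>, so that integration may be done term by term.\<close>
    define u where "u = (\<lambda>k t. \<Sum>i\<le>k. (?F i * (of_real t * z) ^ i) * (?G (k - i) * (of_real (1 - t) * z) ^ (k - i)))"
    define M where "M = (\<lambda>k. \<Sum>i\<le>k. norm (?F i * z ^ i) * norm (?G (k - i) * z ^ (k - i)))"
    have n: "norm (of_real t * z) \<le> norm z" "norm (of_real (1 - t) * z) \<le> norm z" if "t \<in> {0..1}" for t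
      using that by (auto simp: norm_mult mult_left_le_one_le simp del: of_real_diff)
    have us: "(\<lambda>k. u k t) sums (f (of_real t * z) * g (of_real (1 - t) * z))" if t: "t \<in> {0..1}" for t
    proof -
      have nz: "norm (of_real t * z) < r1" "norm (of_real (1 - t) * z) < r2"
        using n[OF t] z by linarith+
      show ?thesis
        using Cauchy_product_sums[OF r1(3)[OF nz(1)] r2(3)[OF nz(2)]] r1(2)[OF nz(1)] r2(2)[OF nz(2)]
        by (simp add: u_def sums_iff)
    qed
    have un: "norm (u k t) \<le> M k" if t: "t \<in> {0..1}" for k t
      unfolding u_def M_def using n[OF t]
      by (intro sum_norm_le)
         (auto simp only: norm_mult norm_power intro!: mult_mono power_mono mult_nonneg_nonneg zero_le_power norm_ge_zero order.refl)
    have "summable M"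
      unfolding M_def using r1(3)[of z] r2(3)[of z] z
      by (intro summable_Cauchy_product) auto
    hence "uniform_limit {0..1} (\<lambda>n t. \<Sum>k<n. u k t) (\<lambda>t. \<Sum>k. u k t) sequentially"
      using un by (intro Weierstrass_m_test) auto
    also have "?this \<longleftrightarrow> uniform_limit {0..1} (\<lambda>n t. \<Sum>k<n. u k t)
        (\<lambda>t. f (of_real t * z) * g (of_real (1 - t) * z)) sequentially"
      using us by (intro uniform_limit_cong) (auto simp: sums_iff)
    finally have lim: "uniform_limit {0..1} (\<lambda>n t. \<Sum>k<n. u k t)
        (\<lambda>t. f (of_real t * z) * g (of_real (1 - t) * z)) sequentially" .
    have ucont: "continuous_on {0..1} (u k)" for k
      unfolding u_def by (intro continuous_intros)
    obtain I J where IJ: "\<And>n. ((\<lambda>t. \<Sum>k<n. u k t) has_integral I n) {0..1}"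
      "((\<lambda>t. f (of_real t * z) * g (of_real (1 - t) * z)) has_integral J) {0..1}" "I \<longlonglongrightarrow> J"
      by (rule uniform_limit_integral[OF lim]) (auto intro!: continuous_on_sum ucont)
    have uint: "integral {0..1} (u k) = (\<Sum>i\<le>k. ?F i * ?G (k - i) * (fact i * fact (k - i) / fact (Suc k))) * z ^ k" for k
    proof -
      have "u k t = (\<Sum>i\<le>k. (?F i * ?G (k - i) * z ^ k) * of_real (t ^ i * (1 - t) ^ (k - i)))" for t
        unfolding u_def
      proof (intro sum.cong refl)
        fix i assume "i \<in> {..k}"
        hence "z ^ k = z ^ i * z ^ (k - i)" by (simp flip: power_add)
        thus "(?F i * (of_real t * z) ^ i) * (?G (k - i) * (of_real (1 - t) * z) ^ (k - i)) =
          (?F i * ?G (k - i) * z ^ k) * of_real (t ^ i * (1 - t) ^ (k - i))"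
          by (simp add: power_mult_distrib mult_ac)
      qed
      hence "integral {0..1} (u k) = integral {0..1} (\<lambda>t. \<Sum>i\<le>k. (?F i * ?G (k - i) * z ^ k) * of_real (t ^ i * (1 - t) ^ (k - i)))"
        by (intro integral_cong)
      also have "\<dots> = (\<Sum>i\<le>k. integral {0..1} (\<lambda>t. (?F i * ?G (k - i) * z ^ k) * of_real (t ^ i * (1 - t) ^ (k - i))))"
        by (intro integral_sum integrable_continuous_interval continuous_intros) auto
      also have "\<dots> = (\<Sum>i\<le>k. (?F i * ?G (k - i) * z ^ k) * (fact i * fact (k - i) / fact (Suc k)))"
        by (intro sum.cong refl) (simp add: integral_beta del: of_real_mult)
      finally show ?thesis
        unfolding sum_distrib_right by (simp add: mult_ac)
    qed
    have "I n = (\<Sum>k<n. integral {0..1} (u k))" for n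
    proof (rule has_integral_unique[OF IJ(1)])
      show "((\<lambda>t. \<Sum>k<n. u k t) has_integral (\<Sum>k<n. integral {0..1} (u k))) {0..1}"
        by (intro has_integral_sum integrable_integral integrable_continuous_interval ucont) auto
    qed
    hence I: "I = (\<lambda>n. \<Sum>k<n. integral {0..1} (u k))" by (rule ext)
    have "(\<lambda>k. integral {0..1} (u k)) sums integral {0..1} (\<lambda>t. f (of_real t * z) * g (of_real (1 - t) * z))"
      using IJ(2,3) unfolding I by (simp add: sums_def integral_unique)
    hence "(\<lambda>k. z * integral {0..1} (u k)) sums convol f g z"
      unfolding convol_def by (rule sums_mult)
    hence "(\<lambda>k. fps_nth (borel_minor (\<phi> * \<psi>)) (Suc k) * z ^ Suc k) sums convol f g z"
      by (simp add: uint nthSuc mult_ac)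
    thus ?thesis using nth0 by (subst (asm) sums_Suc_iff) simp
  qed
  show ?thesis
    by (rule has_fps_expansionI)
       (use sums r1(1) r2(1) in \<open>auto simp: eventually_nhds_metric intro!: exI[of _ "min r1 r2"]\<close>)
qed

text \<open>Indices are shifted by one: \<open>conv_power f k\<close> is the \<open>(k + 1)\<close>-fold power, since \<open>\<delta>\<close> is not a function.\<close>

primrec conv_power :: "(complex \<Rightarrow> complex) \<Rightarrow> nat \<Rightarrow> complex \<Rightarrow> complex" where
  "conv_power f 0 = f"
| "conv_power f (Suc k) = convol f (conv_power f k)"

text \<open>The exponential for convolution without its unit \<delta>. The index shift of
  \<open>conv_power\<close> is the reason for \<open>fact (Suc k)\<close>.\<close>

definition conv_exp :: "(complex \<Rightarrow> complex) \<Rightarrow> complex \<Rightarrow> complex" where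
  "conv_exp f z = (\<Sum>k. conv_power f k z / fact (Suc k))"

section \<open>Convolution powers and the convolution exponential\<close>

lemma holomorphic_on_conv_power:
  assumes "f holomorphic_on S" "open S" "starlike0 S"
  shows   "conv_power f k holomorphic_on S"
  by (induction k) (use assms holomorphic_on_convol in auto)

lemma has_fps_expansion_conv_power:
  assumes "f has_fps_expansion borel_minor \<phi>" "fps_nth \<phi> 0 = 0"
  shows   "conv_power f k has_fps_expansion borel_minor (\<phi> ^ Suc k)"
proof (induction k)
  case (Suc k)
  have "fps_nth (\<phi> ^ Suc k) 0 = 0" using assms by (simp add: fps_power_zeroth)
  thus ?case
    using has_fps_expansion_convol[OF assms(1) Suc.IH assms(2)] by simp
qed (use assms in auto)

lemma norm_conv_power_le:
  assumes f: "f holomorphic_on S" "open S" "starlike0 S" "\<And>z. z \<in> S \<Longrightarrow> norm (f z) \<le> A"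
  shows   "z \<in> S \<Longrightarrow> norm (conv_power f k z) \<le> A ^ Suc k * norm z ^ k / fact k"
proof (induction k arbitrary: z)
  case (Suc k)
  have "norm (convol f (conv_power f k) z) \<le> A * A ^ Suc k * norm z ^ Suc k / fact (Suc k)"
    using f Suc by (intro norm_convol_le) (auto intro!: holomorphic_on_imp_continuous_on holomorphic_on_conv_power)
  thus ?case by (simp add: mult_ac)
qed (use f in auto)

context
  fixes f :: "complex \<Rightarrow> complex" and S :: "complex set" and A :: real
  assumes f: "f holomorphic_on S" "open S" "starlike0 S" "\<And>z. z \<in> S \<Longrightarrow> norm (f z) \<le> A"
begin

lemma norm_conv_exp_term_le:
  assumes "z \<in> S"
  shows   "norm (conv_power f k z / fact (Suc k)) \<le> A * ((A * norm z) ^ k / fact k)"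
proof -
  have A: "A \<ge> 0" using f(4)[OF assms] norm_ge_zero order_trans by blast
  have "norm (conv_power f k z / fact (Suc k)) \<le> A ^ Suc k * norm z ^ k / fact k / fact (Suc k)"
    using divide_right_mono[OF norm_conv_power_le[OF f assms, of k], of "fact (Suc k)"]
    by (simp add: norm_divide del: fact_Suc)
  \<comment> \<open>The factor \<open>1 / fact (Suc k)\<close> is given away: the factorial gained
    from convolution already produces an exponential series, hence the exponential type
    \<open>A\<close>.\<close>
  also have "\<dots> \<le> A ^ Suc k * norm z ^ k / fact k / 1"
    using A by (intro divide_left_mono) (auto simp del: fact_Suc simp: fact_ge_1)
  finally show ?thesis by (simp add: power_mult_distrib)
qed

lemma norm_conv_exp_le:
  assumes "z \<in> S"
  shows   "norm (conv_exp f z) \<le> A * exp (A * norm z)"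
proof -
  have s: "(\<lambda>k. A * ((A * norm z) ^ k / fact k)) sums (A * exp (A * norm z))"
    using exp_converges[of "A * norm z"] by (intro sums_mult) (simp add: field_simps)
  have "norm (conv_exp f z) \<le> (\<Sum>k. A * ((A * norm z) ^ k / fact k))"
    unfolding conv_exp_def
    by (rule norm_suminf_le) (use norm_conv_exp_term_le[OF assms] s in \<open>auto simp: sums_iff\<close>)
  thus ?thesis using s by (simp add: sums_iff)
qed

text \<open>The majorant depends on \<open>R\<close>, so uniform convergence is obtained only on
  bounded pieces of \<open>S\<close>; for holomorphy and for derivatives at \<open>0\<close> this
  suffices.\<close>

lemma uniform_limit_conv_exp:
  "uniform_limit (S \<inter> ball 0 R) (\<lambda>n z. \<Sum>k<n. conv_power f k z / fact (Suc k)) (conv_exp f) sequentially"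
  unfolding conv_exp_def
proof (rule Weierstrass_m_test)
  have "summable (\<lambda>k. (A * R) ^ k / fact k)"
    using summable_exp[of "A * R"] by (simp add: field_simps)
  thus "summable (\<lambda>k. A * ((A * R) ^ k / fact k))" by (rule summable_mult)
  fix k z assume z: "z \<in> S \<inter> ball 0 R"
  have A: "A \<ge> 0" using f(4)[of z] z norm_ge_zero order_trans by blast
  have "norm (conv_power f k z / fact (Suc k)) \<le> A * ((A * norm z) ^ k / fact k)"
    using z norm_conv_exp_term_le by blast
  also have "\<dots> \<le> A * ((A * R) ^ k / fact k)"
    using A z by (intro mult_left_mono divide_right_mono power_mono) auto
  finally show "norm (conv_power f k z / fact (Suc k)) \<le> A * ((A * R) ^ k / fact k)" .
qed

lemma holomorphic_on_conv_exp: "conv_exp f holomorphic_on S"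
proof -
  have *: "conv_exp f holomorphic_on (S \<inter> ball 0 R)" for R
  proof (rule holomorphic_uniform_sequence[OF _ _ ])
    show "open (S \<inter> ball 0 R)" using f by auto
    show "(\<lambda>z. \<Sum>k<n. conv_power f k z / fact (Suc k)) holomorphic_on S \<inter> ball 0 R" for n
      by (intro holomorphic_intros holomorphic_on_subset[OF holomorphic_on_conv_power[OF f(1-3)]]) auto
    fix x assume "x \<in> S \<inter> ball 0 R"
    then obtain d where "d > 0" "cball x d \<subseteq> S \<inter> ball 0 R"
      using f(2) open_contains_cball by (metis open_Int open_ball)
    thus "\<exists>d>0. cball x d \<subseteq> S \<inter> ball 0 R \<and>
        uniform_limit (cball x d) (\<lambda>n z. \<Sum>k<n. conv_power f k z / fact (Suc k)) (conv_exp f) sequentially"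
      using uniform_limit_on_subset[OF uniform_limit_conv_exp] by blast
  qed
  have "conv_exp f field_differentiable at z" if "z \<in> S" for z
    using *[of "norm z + 1"] that f(2)
    by (auto simp: holomorphic_on_open[OF open_Int[OF f(2) open_ball]] field_differentiable_def)
  thus ?thesis
    by (simp add: holomorphic_on_def field_differentiable_at_within)
qed

text \<open>Locally uniform convergence passes to all derivatives at \<open>0\<close>. Each Taylor
  coefficient of the partial sums is eventually constant, because \<open>\<phi> ^ Suc k\<close> has
  no coefficient at \<open>Suc n\<close> once \<open>k > n\<close>, and the stable value is the
  coefficient of the formal composition.\<close>

lemma has_fps_expansion_conv_exp:
  assumes "f has_fps_expansion borel_minor \<phi>" "fps_nth \<phi> 0 = 0" "0 \<in> S"
  shows   "conv_exp f has_fps_expansion borel_minor (fps_compose (fps_exp 1) \<phi>)"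
proof -
  let ?S = "S \<inter> ball 0 1"
  have S: "open ?S" "0 \<in> ?S" using f assms by auto
  have h: "conv_exp f holomorphic_on ?S" using holomorphic_on_conv_exp holomorphic_on_subset by blast
  have "fps_nth (fps_expansion (conv_exp f) 0) n = fps_nth (borel_minor (fps_compose (fps_exp 1) \<phi>)) n" for n
  proof -
    let ?P = "\<lambda>N z. \<Sum>k<N. conv_power f k z / fact (Suc k)"
    have "(\<lambda>N. (deriv ^^ n) (?P N) 0) \<longlonglongrightarrow> (deriv ^^ n) (conv_exp f) 0"
      using S by (intro higher_deriv_complex_uniform_limit[OF uniform_limit_conv_exp])
        (auto intro!: always_eventually holomorphic_intros holomorphic_on_subset[OF holomorphic_on_conv_power[OF f(1-3)]])
    hence 1: "(\<lambda>N. (deriv ^^ n) (?P N) 0 / fact n) \<longlonglongrightarrow> (deriv ^^ n) (conv_exp f) 0 / fact n"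
      by (intro tendsto_intros) auto
    have P: "?P N has_fps_expansion (\<Sum>k<N. borel_minor (\<phi> ^ Suc k) * fps_const (1 / fact (Suc k)))" for N
      using has_fps_expansion_cmult_right[OF has_fps_expansion_conv_power[OF assms(1,2)]]
      by (intro has_fps_expansion_sum) (auto simp: divide_inverse)
    have "(deriv ^^ n) (?P N) 0 / fact n = fps_nth (borel_minor (fps_compose (fps_exp 1) \<phi>)) n" if N: "N \<ge> Suc n" for N
    proof -
      have "(deriv ^^ n) (?P N) 0 / fact n = (\<Sum>k<N. fps_nth (\<phi> ^ Suc k) (Suc n) / fact n / fact (Suc k))"
        using fps_nth_fps_expansion[OF P[of N], of n] by (simp add: fps_sum_nth borel_minor_nth)
      also have "\<dots> = (\<Sum>k<Suc n. fps_nth (\<phi> ^ Suc k) (Suc n) / fact n / fact (Suc k))"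
      proof (rule sum.mono_neutral_right)
        show "\<forall>i\<in>{..<N} - {..<Suc n}. fps_nth (\<phi> ^ Suc i) (Suc n) / fact n / fact (Suc i) = 0"
          using startsby_zero_power_prefix[OF assms(2)] by (auto simp del: power_Suc)
      qed (use N in auto)
      \<comment> \<open>The added term \<open>k = 0\<close> vanishes, since
        \<open>\<phi> ^ 0 = 1\<close> has no coefficient at \<open>Suc n\<close>.\<close>
      also have "\<dots> = (\<Sum>k\<le>Suc n. fps_nth (\<phi> ^ k) (Suc n) / fact n / fact k)"
        by (subst sum.atMost_Suc_shift) (simp add: lessThan_Suc_atMost)
      also have "\<dots> = fps_nth (borel_minor (fps_compose (fps_exp 1) \<phi>)) n"
        by (simp add: borel_minor_nth fps_compose_nth atLeast0AtMost sum_divide_distrib field_simps del: power_Suc fact_Suc sum.atMost_Suc)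
      finally show ?thesis .
    qed
    hence "eventually (\<lambda>N. (deriv ^^ n) (?P N) 0 / fact n = fps_nth (borel_minor (fps_compose (fps_exp 1) \<phi>)) n) sequentially"
      by (auto simp: eventually_sequentially)
    from tendsto_eventually[OF this] 1 show ?thesis
      unfolding fps_expansion_def using LIMSEQ_unique by fastforce
  qed
  hence "fps_expansion (conv_exp f) 0 = borel_minor (fps_compose (fps_exp 1) \<phi>)"
    by (intro fps_ext) 
  with has_fps_expansion_fps_expansion[OF S h] show ?thesis by simp
qed

end

subsection \<open>Laplace transforms\<close>

definition exp_bounded :: "(real \<Rightarrow> complex) \<Rightarrow> real \<Rightarrow> real \<Rightarrow> bool" where
  "exp_bounded f A c \<longleftrightarrow> set_borel_measurable lborel {0<..} f \<and> (\<forall>x>0. norm (f x) \<le> A * exp (c * x))"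

definition laplace :: "(real \<Rightarrow> complex) \<Rightarrow> complex \<Rightarrow> complex" where
  "laplace f z = (LBINT x:{0<..}. exp (-z * of_real x) * f x)"

lemma exp_bounded_nonneg: "exp_bounded f A c \<Longrightarrow> A \<ge> 0"
  unfolding exp_bounded_def
  by (metis (no_types, lifting) exp_gt_zero norm_ge_zero order_trans zero_le_mult_iff zero_less_one not_le)

lemma exp_bounded_continuous:
  assumes "continuous_on {0<..} f" "\<And>x. x > 0 \<Longrightarrow> norm (f x) \<le> A * exp (c * x)"
  shows   "exp_bounded f A c"
  unfolding exp_bounded_def
proof
  show "set_borel_measurable lborel {0<..} f"
    unfolding set_borel_measurable_def
    using borel_measurable_continuous_on_indicator[OF _ assms(1)] by simp
qed (use assms in auto)

lemma integrable_exp_neg: "a > 0 \<Longrightarrow> set_integrable lborel {0<..} (\<lambda>x::real. exp (- (a * x)))"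
  using integrable_I0i_exp_mscale[of a] by (simp add: set_integrable_def mult.commute)

lemma integral_exp_neg: "a > 0 \<Longrightarrow> (LBINT x:{0<..}. exp (- (a * x))) = 1 / (a::real)"
  using LBINT_I0i_exp_mscale[of a] by (simp add: interval_lebesgue_integral_0_infty mult.commute)

lemma
  assumes f: "exp_bounded f A c" and z: "Re z > c"
  shows set_integrable_laplace: "set_integrable lborel {0<..} (\<lambda>x. exp (-z * of_real x) * f x)"
    and norm_laplace_le: "norm (laplace f z) \<le> A / (Re z - c)"
proof -
  have f': "set_borel_measurable lborel {0<..} f" "\<And>x. x > 0 \<Longrightarrow> norm (f x) \<le> A * exp (c * x)"
    using f by (auto simp: exp_bounded_def)
  have int: "set_integrable lborel {0<..} (\<lambda>x. A * exp (- ((Re z - c) * x)))"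
    using z by (intro set_integrable_mult_right integrable_exp_neg) auto
  have le: "norm (exp (-z * of_real x) * f x) \<le> A * exp (- ((Re z - c) * x))" if "x > 0" for x
  proof -
    have "norm (exp (-z * of_real x) * f x) \<le> exp (- Re z * x) * (A * exp (c * x))"
      using f'(2)[OF that] by (simp add: norm_mult)
    also have "\<dots> = A * exp (- ((Re z - c) * x))"
      by (simp add: algebra_simps flip: exp_add)
    finally show ?thesis .
  qed
  have meas: "set_borel_measurable lborel {0<..} (\<lambda>x. exp (-z * of_real x) * f x)"
  proof -
    have "(\<lambda>x. exp (-z * of_real x) * (indicator {0<..} x *\<^sub>R f x)) \<in> borel_measurable lborel"
      using f'(1) unfolding set_borel_measurable_def
      by (intro borel_measurable_times) (auto simp: measurable_lborel1)
    thus ?thesis unfolding set_borel_measurable_def by (simp add: mult_ac)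
  qed
  show int2: "set_integrable lborel {0<..} (\<lambda>x. exp (-z * of_real x) * f x)"
    by (rule set_integrable_bound[OF int meas]) (use order_trans[OF le abs_ge_self] in \<open>auto simp del: abs_mult\<close>)
  have "norm (laplace f z) \<le> (LBINT x:{0<..}. norm (exp (-z * of_real x) * f x))"
    unfolding laplace_def using int2 set_integral_norm_bound by blast
  also have "\<dots> \<le> (LBINT x:{0<..}. A * exp (- ((Re z - c) * x)))"
    by (rule set_integral_mono[OF set_integrable_norm[OF int2] int]) (use le in auto)
  also have "\<dots> = A / (Re z - c)"
    using z by (simp add: set_integral_mult_right integral_exp_neg)
  finally show "norm (laplace f z) \<le> A / (Re z - c)" .
qed

text \<open>An arbitrarily small loss \<open>d\<close> in the exponential type pays for the factor
  \<open>x\<close>, by \<open>x \<le> exp (d * x) / d\<close>. So derivatives of Laplace transforms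
  are Laplace transforms on the same open half-plane.\<close>

lemma exp_bounded_times:
  assumes f: "exp_bounded f A c" and d: "d > 0"
  shows   "exp_bounded (\<lambda>x. of_real x * f x) (A / d) (c + d)"
  unfolding exp_bounded_def
proof safe
  have "(\<lambda>x. of_real x * (indicator {0<..} x *\<^sub>R f x)) \<in> borel_measurable lborel"
    using f unfolding exp_bounded_def set_borel_measurable_def
    by (intro borel_measurable_times) (auto simp: measurable_lborel1)
  thus "set_borel_measurable lborel {0<..} (\<lambda>x. of_real x * f x)"
    unfolding set_borel_measurable_def by (simp add: mult_ac)
  fix x :: real assume x: "x > 0"
  have "1 + d * x \<le> exp (d * x)" by (rule exp_ge_add_one_self)
  hence "d * x \<le> exp (d * x)" by linarith
  hence "x \<le> exp (d * x) / d" using d by (simp add: field_simps)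
  hence "x * norm (f x) \<le> (exp (d * x) / d) * (A * exp (c * x))"
    using f x d by (intro mult_mono) (auto simp: exp_bounded_def)
  thus "norm (of_real x * f x) \<le> A / d * exp ((c + d) * x)"
    using x by (simp add: norm_mult algebra_simps exp_add)
qed

lemma exp_bounded_cmult:
  assumes "exp_bounded f A c"
  shows   "exp_bounded (\<lambda>x. f x * k) (A * norm k) c"
  unfolding exp_bounded_def
proof safe
  have "(\<lambda>x. (indicator {0<..} x *\<^sub>R f x) * k) \<in> borel_measurable lborel"
    using assms unfolding exp_bounded_def set_borel_measurable_def
    by (intro borel_measurable_times) (auto simp: measurable_lborel1)
  thus "set_borel_measurable lborel {0<..} (\<lambda>x. f x * k)"
    unfolding set_borel_measurable_def by simp
  fix x :: real assume "x > 0"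
  hence "norm (f x) * norm k \<le> (A * exp (c * x)) * norm k"
    using assms by (intro mult_right_mono) (auto simp: exp_bounded_def)
  thus "norm (f x * k) \<le> A * norm k * exp (c * x)"
    by (simp add: norm_mult mult_ac)
qed

lemma has_field_derivative_laplace:
  assumes f: "exp_bounded f A c" and z: "Re z > c"
  shows   "(laplace f has_field_derivative - laplace (\<lambda>x. of_real x * f x) z) (at z)"
proof -
  \<comment> \<open>The gap is split into three: one \<open>d\<close> absorbs
    \<open>exp (norm h * x)\<close> in the Taylor remainder of the kernel, one absorbs
    \<open>x ^ 2\<close>, and the last keeps the integral convergent.\<close>
  define d where "d = (Re z - c) / 3"
  have d: "d > 0" using z by (simp add: d_def)
  have fx: "exp_bounded (\<lambda>x. of_real x * f x) (A / d) (c + d)"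
    using exp_bounded_times[OF f d] .
  have A: "A \<ge> 0" using exp_bounded_nonneg[OF f] .
  have int0: "set_integrable lborel {0<..} (\<lambda>x. exp (-z * of_real x) * f x)"
    by (rule set_integrable_laplace[OF f z])
  have int1: "set_integrable lborel {0<..} (\<lambda>x. exp (-z * of_real x) * (of_real x * f x))"
    by (rule set_integrable_laplace[OF fx]) (use d in \<open>auto simp: d_def field_simps\<close>)
  have bd: "norm (laplace f (z + h) - laplace f z + h * laplace (\<lambda>x. of_real x * f x) z) \<le> norm h ^ 2 * (2 * A / d ^ 3)"
    if h: "norm h < d" for h
  proof -
    have "\<bar>Re h\<bar> < d" using h abs_Re_le_cmod[of h] by linarith
    hence zh: "Re (z + h) > c" using z d by (auto simp: d_def field_simps abs_less_iff)
    have inth: "set_integrable lborel {0<..} (\<lambda>x. exp (-(z + h) * of_real x) * f x)"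
      by (rule set_integrable_laplace[OF f zh])
    let ?g = "\<lambda>x. exp (-(z + h) * of_real x) * f x - exp (-z * of_real x) * f x + h * (exp (-z * of_real x) * (of_real x * f x))"
    have intg: "set_integrable lborel {0<..} ?g"
      by (intro set_integral_add set_integral_diff set_integrable_mult_right inth int0 int1)
    have eq: "laplace f (z + h) - laplace f z + h * laplace (\<lambda>x. of_real x * f x) z = (LBINT x:{0<..}. ?g x)"
      unfolding laplace_def
      using inth int0 int1 by (subst set_integral_add) (auto simp: set_integral_diff set_integral_mult_right)
    have le: "norm (?g x) \<le> norm h ^ 2 * (2 * A / d ^ 2) * exp (- (d * x))" if x: "x > 0" for x
    proof -
      let ?w = "- (h * of_real x)"
      have "?g x = exp (-z * of_real x) * f x * (exp ?w - (\<Sum>i\<le>1. ?w ^ i / fact i))"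
      proof -
        have "exp (-(z + h) * of_real x) = exp (-z * of_real x) * exp ?w"
          by (simp add: algebra_simps flip: exp_add)
        thus ?thesis by (simp add: algebra_simps)
      qed
      also have "norm \<dots> = exp (- Re z * x) * norm (f x) * norm (exp ?w - (\<Sum>i\<le>1. ?w ^ i / fact i))"
        by (simp add: norm_mult)
      also have "\<dots> \<le> exp (- Re z * x) * (A * exp (c * x)) * (exp (d * x) * (norm h ^ 2 * (2 / d ^ 2 * exp (d * x))))"
      proof (intro mult_mono mult_nonneg_nonneg)
        have "norm (exp ?w - (\<Sum>i\<le>1. ?w ^ i / fact i)) \<le> exp (norm ?w) * norm ?w ^ Suc 1 / fact 1"
          by (rule Taylor_exp_field)
        also have "\<dots> = exp (norm ?w) * (norm h ^ 2 * x ^ 2)"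
          using x by (simp add: norm_mult power_mult_distrib power2_eq_square)
        also have "\<dots> \<le> exp (d * x) * (norm h ^ 2 * (2 / d ^ 2 * exp (d * x)))"
        proof (intro mult_mono)
          show "exp (norm ?w) \<le> exp (d * x)"
            using x h by (simp add: norm_mult)
          have "d * x > 0" using d x by simp
          hence "(d * x) ^ 2 \<le> 2 * exp (d * x)"
            using exp_lower_Taylor_quadratic[of "d * x"] by linarith
          hence "d ^ 2 * x ^ 2 \<le> 2 * exp (d * x)"
            by (simp only: power_mult_distrib)
          thus "x ^ 2 \<le> 2 / d ^ 2 * exp (d * x)"
            using d by (simp add: field_simps)
        qed auto
        finally show "norm (exp ?w - (\<Sum>i\<le>1. ?w ^ i / fact i)) \<le> exp (d * x) * (norm h ^ 2 * (2 / d ^ 2 * exp (d * x)))" .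
      qed (use f x A in \<open>auto simp: exp_bounded_def\<close>)
      also have "\<dots> = norm h ^ 2 * (2 * A / d ^ 2) * (exp (- Re z * x) * exp (c * x) * exp (d * x) * exp (d * x))"
        by simp
      also have "exp (- Re z * x) * exp (c * x) * exp (d * x) * exp (d * x) = exp (- Re z * x + c * x + d * x + d * x)"
        by (simp only: exp_add)
      also have "- Re z * x + c * x + d * x + d * x = - (d * x)"
        by (simp add: d_def field_simps)
      finally show ?thesis .
    qed
    have int2: "set_integrable lborel {0<..} (\<lambda>x. norm h ^ 2 * (2 * A / d ^ 2) * exp (- (d * x)))"
      using d by (intro set_integrable_mult_right integrable_exp_neg) auto
    have "norm (LBINT x:{0<..}. ?g x) \<le> (LBINT x:{0<..}. norm (?g x))"
      using intg set_integral_norm_bound by blast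
    also have "\<dots> \<le> (LBINT x:{0<..}. norm h ^ 2 * (2 * A / d ^ 2) * exp (- (d * x)))"
      by (rule set_integral_mono[OF set_integrable_norm[OF intg] int2]) (use le in auto)
    also have "\<dots> = norm h ^ 2 * (2 * A / d ^ 2) * (1 / d)"
      using d by (simp only: set_integral_mult_right integral_exp_neg)
    finally show ?thesis unfolding eq by (simp add: power3_eq_cube power2_eq_square mult_ac)
  qed
  have "((\<lambda>h. (laplace f (z + h) - laplace f z) / h + laplace (\<lambda>x. of_real x * f x) z) \<longlongrightarrow> 0) (at 0)"
  proof (rule Lim_null_comparison)
    show "((\<lambda>h. norm h * (2 * A / d ^ 3)) \<longlongrightarrow> 0) (at (0::complex))"
      by (intro tendsto_mult_left_zero tendsto_norm_zero tendsto_ident_at)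
    have "eventually (\<lambda>h. h \<in> ball 0 d - {0}) (at (0::complex))"
      using d by (intro eventually_at_in_open) auto
    thus "eventually (\<lambda>h. norm ((laplace f (z + h) - laplace f z) / h + laplace (\<lambda>x. of_real x * f x) z) \<le> norm h * (2 * A / d ^ 3)) (at 0)"
    proof eventually_elim
      case (elim h)
      have "(laplace f (z + h) - laplace f z) / h + laplace (\<lambda>x. of_real x * f x) z =
          (laplace f (z + h) - laplace f z + h * laplace (\<lambda>x. of_real x * f x) z) / h"
        using elim by (simp add: add_divide_distrib)
      also have "norm \<dots> \<le> norm h ^ 2 * (2 * A / d ^ 3) / norm h"
        unfolding norm_divide using bd[of h] elim by (intro divide_right_mono) auto
      finally show ?case using elim by (simp add: power2_eq_square)
    qed
  qed
  from tendsto_diff[OF this tendsto_const[of "laplace (\<lambda>x. of_real x * f x) z"]] show ?thesis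
    unfolding DERIV_def by simp
qed

lemma holomorphic_on_laplace:
  assumes "exp_bounded f A c"
  shows   "laplace f holomorphic_on {z. Re z > c}"
  using has_field_derivative_laplace[OF assms]
  by (auto simp: holomorphic_on_def field_differentiable_def intro: has_field_derivative_at_within)

section \<open>Laplace transforms of powers\<close>

lemma exp_bounded_power: "d > 0 \<Longrightarrow> exp_bounded (\<lambda>x. of_real x ^ n) (1 / d ^ n) (real n * d)"
proof (induction n)
  case 0
  show ?case by (rule exp_bounded_continuous) auto
next
  case (Suc n)
  show ?case using exp_bounded_times[OF Suc.IH[OF Suc.prems] Suc.prems] by (simp add: algebra_simps)
qed

text \<open>For positive real arguments this is a real exponential integral; the identity theorem
  extends it to the half-plane.\<close>

lemma laplace_1: "Re z > 0 \<Longrightarrow> laplace (\<lambda>_. 1) z = 1 / z"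
proof -
  assume z: "Re z > 0"
  have 1: "exp_bounded (\<lambda>_. 1) 1 0" by (rule exp_bounded_continuous) auto
  have "laplace (\<lambda>_. 1) z - 1 / z = 0"
  proof (rule analytic_continuation[where f = "\<lambda>z. laplace (\<lambda>_. 1) z - 1 / z" and S = "{z. Re z > 0}" and U = "of_real ` {0<..}" and \<xi> = 1])
    show "(\<lambda>z. laplace (\<lambda>_. 1) z - 1 / z) holomorphic_on {z. Re z > 0}"
      by (intro holomorphic_intros holomorphic_on_laplace[OF 1]) auto
    show "connected {z. 0 < Re z}" by (intro convex_connected convex_halfspace_Re_gt)
    have "(1::real) islimpt {0<..}"
      by (rule interior_limit_point) (simp add: interior_open)
    thus "1 islimpt complex_of_real ` {0<..}"
      using islimpt_isCont_image[of "1::real" "{0<..}" complex_of_real] by (auto simp: eventually_at_filter)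
    fix w assume "w \<in> complex_of_real ` {0<..}"
    then obtain x where x: "x > 0" "w = of_real x" by auto
    have "laplace (\<lambda>_. 1) w = (LBINT y:{0<..}. complex_of_real (exp (- (x * y))))"
      unfolding laplace_def x by (simp flip: exp_of_real)
    also have "\<dots> = of_real (1 / x)"
      using integral_exp_neg[OF x(1)] by (subst set_integral_complex_of_real) simp
    finally show "laplace (\<lambda>_. 1) w - 1 / w = 0" using x by simp
  qed (use z in \<open>auto simp: open_halfspace_Re_gt\<close>)
  thus ?thesis by simp
qed

text \<open>Multiplying the integrand by \<open>x\<close> amounts to minus differentiation of the
  transform, so the formula follows by differentiating \<open>1 / z\<close> repeatedly.\<close>

lemma laplace_power: "Re z > 0 \<Longrightarrow> laplace (\<lambda>x. of_real x ^ n) z = fact n / z ^ Suc n"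
proof (induction n arbitrary: z)
  case 0
  thus ?case using laplace_1 by simp
next
  case (Suc n)
  \<comment> \<open>Small enough for the exponential type \<open>real n * d\<close> of
    \<open>x ^ n\<close> to stay below \<open>Re z\<close>.\<close>
  define d where "d = Re z / (2 * real (Suc n))"
  have d: "d > 0" using Suc.prems by (simp add: d_def)
  have "real n * d < Re z" using Suc.prems by (simp add: d_def field_simps add_nonneg_pos)
  from has_field_derivative_laplace[OF exp_bounded_power[OF d, of n] this]
  have der: "(laplace (\<lambda>x. of_real x ^ n) has_field_derivative - laplace (\<lambda>x. of_real x ^ Suc n) z) (at z)" by simp
  have z0: "z \<noteq> 0" using Suc.prems by auto
  have "((\<lambda>w. fact n / w ^ Suc n) has_field_derivative - (fact (Suc n) / z ^ Suc (Suc n))) (at z)"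
  proof (rule DERIV_cong)
    show "((\<lambda>w. fact n / w ^ Suc n) has_field_derivative
        (0 * z ^ Suc n - fact n * (of_nat (Suc n) * z ^ n)) / (z ^ Suc n * z ^ Suc n)) (at z)"
      using DERIV_power[OF DERIV_ident, where n = "Suc n" and x = z and s = UNIV] z0
      by (intro DERIV_divide DERIV_const) (simp_all del: of_nat_Suc power_Suc)
    show "(0 * z ^ Suc n - fact n * (of_nat (Suc n) * z ^ n)) / (z ^ Suc n * z ^ Suc n) = - (fact (Suc n) / z ^ Suc (Suc n))"
      using z0 by (simp add: divide_simps)
  qed
  moreover have "eventually (\<lambda>w. w \<in> {w. Re w > 0}) (nhds z)"
    using Suc.prems by (intro eventually_nhds_in_open) (auto simp: open_halfspace_Re_gt)
  hence ev: "eventually (\<lambda>w. laplace (\<lambda>x. of_real x ^ n) w = fact n / w ^ Suc n) (nhds z)"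
    by eventually_elim (use Suc.IH in auto)
  ultimately have "(laplace (\<lambda>x. of_real x ^ n) has_field_derivative - (fact (Suc n) / z ^ Suc (Suc n))) (at z)"
    using DERIV_cong_ev[OF refl ev refl] by simp
  from DERIV_unique[OF der this] show ?case
    by (simp only: neg_equal_iff_equal)
qed

text \<open>Fubini and translation invariance. Working on the whole line lets cut-off functions take
  care of the limits of integration later.\<close>

lemma integral_convolution:
  fixes a b :: "real \<Rightarrow> complex"
  assumes a: "integrable lborel a" and b: "integrable lborel b"
  shows   "(LINT x|lborel. LINT s|lborel. a s * b (x - s)) = (LINT x|lborel. a x) * (LINT x|lborel. b x)"
proof -
  have [measurable]: "a \<in> borel_measurable borel" "b \<in> borel_measurable borel"
    using a b by auto
  have shift: "(LINT x|lborel. g (x - s)) = (LINT x|lborel. g x)" for g :: "real \<Rightarrow> 'b::{banach, second_countable_topology}" and s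
    using lborel_integral_real_affine[of 1 g "-s"] by simp
  have bs: "integrable lborel (\<lambda>x. b (x - s))" for s
    using lborel_integrable_real_affine[OF b, of 1 "-s"] by simp
  have int: "integrable (lborel \<Otimes>\<^sub>M lborel) (\<lambda>(s, x). a s * b (x - s))"
  proof (rule lborel_pair.Fubini_integrable)
    show "(\<lambda>(s, x). a s * b (x - s)) \<in> borel_measurable (lborel \<Otimes>\<^sub>M lborel)"
      by measurable
    have "(LINT x|lborel. norm (a s * b (x - s))) = norm (a s) * (LINT x|lborel. norm (b x))" for s
      using shift[of "\<lambda>x. norm (b x)" s] by (simp add: norm_mult)
    thus "integrable lborel (\<lambda>s. LINT x|lborel. norm (case (s, x) of (s, x) \<Rightarrow> a s * b (x - s)))"
      using a by simp
    show "AE s in lborel. integrable lborel (\<lambda>x. case (s, x) of (s, x) \<Rightarrow> a s * b (x - s))"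
      using bs by simp
  qed
  have "(LINT x|lborel. LINT s|lborel. a s * b (x - s)) = (LINT s|lborel. LINT x|lborel. a s * b (x - s))"
    by (rule lborel_pair.Fubini_integral[OF int])
  also have "\<dots> = (LINT s|lborel. a s * (LINT x|lborel. b x))"
    using shift[of b] by simp
  finally show ?thesis by simp
qed

text \<open>The substitution \<open>s = x * t\<close>. It links the integral over the unit interval,
  suited to holomorphy in the end point, with the Lebesgue integral on which Fubini
  operates.\<close>

lemma convol_of_real:
  assumes "continuous_on S f" "continuous_on S g" "starlike0 S" "of_real x \<in> S" "x > 0"
  shows   "convol f g (of_real x) = (LBINT s:{0<..<x}. f (of_real s) * g (of_real (x - s)))"
proof -
  let ?h = "\<lambda>t. f (of_real t * of_real x) * g (of_real (1 - t) * of_real x)"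
  have c: "continuous_on {0..1} ?h"
    using continuous_on_convol_integrand[OF assms(1-4)] .
  have si: "set_integrable lborel {0..1} ?h"
    by (rule borel_integrable_atLeastAtMost') (rule c)
  have "integral {0..1} ?h = integral {0<..<1} ?h"
    using integral_open_interval_real[of 0 1 ?h] by simp
  also have "\<dots> = (LBINT t:{0<..<1}. ?h t)"
    by (rule set_borel_integral_eq_integral(2)[symmetric], rule set_integrable_subset[OF si]) auto
  finally have 1: "integral {0..1} ?h = (LBINT t:{0<..<1}. ?h t)" .
  have "(LBINT s:{0<..<x}. f (of_real s) * g (of_real (x - s))) =
      x *\<^sub>R (LINT t|lborel. indicator {0<..<x} (x * t) *\<^sub>R (f (of_real (x * t)) * g (of_real (x - x * t))))"
    unfolding set_lebesgue_integral_def
    using lborel_integral_real_affine[of x "\<lambda>s. indicator {0<..<x} s *\<^sub>R (f (of_real s) * g (of_real (x - s)))" 0] assms(5)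
    by simp
  also have "(LINT t|lborel. indicator {0<..<x} (x * t) *\<^sub>R (f (of_real (x * t)) * g (of_real (x - x * t)))) =
      (LBINT t:{0<..<1}. ?h t)"
    unfolding set_lebesgue_integral_def
  proof (rule Bochner_Integration.integral_cong[OF refl])
    fix t :: real
    have "indicator {0<..<x} (x * t) = (indicator {0<..<1} t :: real)"
      using assms(5) by (auto simp: indicator_def zero_less_mult_iff)
    thus "indicator {0<..<x} (x * t) *\<^sub>R (f (of_real (x * t)) * g (of_real (x - x * t))) = indicator {0<..<1} t *\<^sub>R ?h t"
      by (simp add: algebra_simps)
  qed
  finally show ?thesis
    unfolding convol_def using 1 by (simp add: scaleR_conv_of_real)
qed

text \<open>The kernel splits as \<open>E x = E s * E (x - s)\<close>. With both factors cut off to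
  the positive axis, \<open>a s * b (x - s)\<close> vanishes unless \<open>0 < s < x\<close>, so the
  full-line convolution is the one from \<open>0\<close> to \<open>x\<close>.\<close>

lemma laplace_convol:
  assumes f: "continuous_on S f" "exp_bounded (\<lambda>x. f (of_real x)) A c"
  assumes g: "continuous_on S g" "exp_bounded (\<lambda>x. g (of_real x)) B c"
  assumes S: "starlike0 S" "\<And>x. x > 0 \<Longrightarrow> of_real x \<in> S" and z: "Re z > c"
  shows "laplace (\<lambda>x. convol f g (of_real x)) z = laplace (\<lambda>x. f (of_real x)) z * laplace (\<lambda>x. g (of_real x)) z"
proof -
  define E where "E = (\<lambda>x::real. exp (-z * of_real x))"
  define a where "a = (\<lambda>x. indicator {0<..} x *\<^sub>R (E x * f (of_real x)))"
  define b where "b = (\<lambda>x. indicator {0<..} x *\<^sub>R (E x * g (of_real x)))"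
  have E: "E x = E s * E (x - s)" for x s
    unfolding E_def by (simp add: algebra_simps flip: exp_add)
  have int: "integrable lborel a" "integrable lborel b"
    using set_integrable_laplace[OF f(2) z] set_integrable_laplace[OF g(2) z]
    unfolding a_def b_def E_def set_integrable_def .
  have eq: "(LINT s|lborel. a s * b (x - s)) = indicator {0<..} x *\<^sub>R (E x * convol f g (of_real x))" for x
  proof (cases "x > 0")
    case True
    have ab: "a s * b (x - s) = E x * (indicator {0<..<x} s *\<^sub>R (f (of_real s) * g (of_real (x - s))))" for s
      unfolding a_def b_def E[of x s] by (auto simp: indicator_def)
    have "(LINT s|lborel. a s * b (x - s)) = E x * (LBINT s:{0<..<x}. f (of_real s) * g (of_real (x - s)))"
      unfolding ab set_lebesgue_integral_def by (rule integral_mult_right_zero)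
    thus ?thesis
      using True convol_of_real[OF f(1) g(1) S(1) S(2)] by simp
  next
    case False
    hence ab: "a s * b (x - s) = 0" for s
      unfolding a_def b_def by (auto simp: indicator_def)
    show ?thesis unfolding ab using False by simp
  qed
  show ?thesis
    using integral_convolution[OF int]
    unfolding eq unfolding laplace_def set_lebesgue_integral_def a_def b_def E_def .
qed

section \<open>The Laplace transform of the convolution exponential\<close>

lemma laplace_diff:
  assumes "exp_bounded f A c" "exp_bounded g B d" "Re z > c" "Re z > d"
  shows   "laplace (\<lambda>x. f x - g x) z = laplace f z - laplace g z"
  using set_integral_diff(2)[OF set_integrable_laplace[OF assms(1,3)] set_integrable_laplace[OF assms(2,4)]]
  by (simp add: laplace_def algebra_simps)

lemma laplace_sum:
  assumes "\<And>k. k \<in> K \<Longrightarrow> exp_bounded (f k) (A k) (c k)" "\<And>k. k \<in> K \<Longrightarrow> Re z > c k"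
  shows   "laplace (\<lambda>x. \<Sum>k\<in>K. f k x) z = (\<Sum>k\<in>K. laplace (f k) z)"
  unfolding laplace_def sum_distrib_left set_lebesgue_integral_def scaleR_sum_right
  using set_integrable_laplace[OF assms]
  by (intro Bochner_Integration.integral_sum) (auto simp: set_integrable_def)

lemma laplace_cmult: "laplace (\<lambda>x. f x * k) z = laplace f z * k"
  unfolding laplace_def by (simp add: mult.assoc[symmetric])

context
  fixes f :: "complex \<Rightarrow> complex" and S :: "complex set" and A :: real
  assumes f: "f holomorphic_on S" "open S" "starlike0 S" "\<And>z. z \<in> S \<Longrightarrow> norm (f z) \<le> A"
  assumes S: "\<And>x. x > 0 \<Longrightarrow> of_real x \<in> S"
begin

lemma continuous_on_pos_real: "h holomorphic_on S \<Longrightarrow> continuous_on {0<..} (\<lambda>x. h (complex_of_real x))"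
  by (rule continuous_on_compose2[OF holomorphic_on_imp_continuous_on, of h S])
     (use S in \<open>auto intro!: continuous_intros\<close>)

lemma exp_type_nonneg: "A \<ge> 0"
  using f(4)[OF S[of 1]] norm_ge_zero order_trans zero_less_one by blast

lemma exp_bounded_conv_power: "exp_bounded (\<lambda>x. conv_power f k (of_real x)) A A"
proof (rule exp_bounded_continuous)
  show "continuous_on {0<..} (\<lambda>x. conv_power f k (complex_of_real x))"
    by (intro continuous_on_pos_real holomorphic_on_conv_power f)
  fix x :: real assume x: "x > 0"
  have "norm (conv_power f k (of_real x)) \<le> A ^ Suc k * norm (complex_of_real x) ^ k / fact k"
    by (intro norm_conv_power_le[OF f] S x)
  also have "\<dots> = A * ((A * x) ^ k / fact k)"
    using x by (simp add: power_mult_distrib)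
  \<comment> \<open>Viewed as a partial sum over one index, the term is bounded by the whole
    exponential series; the resulting constants do not depend on \<open>k\<close>.\<close>
  also have "(A * x) ^ k / fact k = (\<Sum>i\<in>{k}. (A * x) ^ i / fact i)" by simp
  also have "\<dots> \<le> (\<Sum>i. (A * x) ^ i / fact i)"
    using x exp_type_nonneg summable_exp[of "A * x"]
    by (intro sum_le_suminf) (auto simp: field_simps)
  also have "\<dots> = exp (A * x)"
    by (simp add: exp_def field_simps)
  finally show "norm (conv_power f k (of_real x)) \<le> A * exp (A * x)" using exp_type_nonneg by (simp add: mult_left_mono)
qed

lemma laplace_conv_power:
  assumes z: "Re z > A"
  shows   "laplace (\<lambda>x. conv_power f k (of_real x)) z = laplace (\<lambda>x. f (of_real x)) z ^ Suc k"
proof (induction k)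
  case (Suc k)
  have "laplace (\<lambda>x. convol f (conv_power f k) (of_real x)) z =
      laplace (\<lambda>x. f (of_real x)) z * laplace (\<lambda>x. conv_power f k (of_real x)) z"
    using f S z exp_bounded_conv_power[of 0] exp_bounded_conv_power[of k]
    by (intro laplace_convol[where S = S and A = A and B = A and c = A]
          holomorphic_on_imp_continuous_on holomorphic_on_conv_power) auto
  thus ?case using Suc.IH by simp
qed auto

lemma exp_bounded_conv_exp: "exp_bounded (\<lambda>x. conv_exp f (of_real x)) A A"
proof (rule exp_bounded_continuous)
  show "continuous_on {0<..} (\<lambda>x. conv_exp f (complex_of_real x))"
    by (intro continuous_on_pos_real holomorphic_on_conv_exp[OF f])
  fix x :: real assume x: "x > 0"
  show "norm (conv_exp f (of_real x)) \<le> A * exp (A * x)"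
    using norm_conv_exp_le[OF f S[OF x]] x by simp
qed

text \<open>Here the factorials \<open>fact (Suc k)\<close> of the exponential are retained. They
  yield the factor \<open>1 / fact (Suc n)\<close>, which makes the Laplace transform of the tail
  tend to \<open>0\<close>.\<close>

lemma exp_bounded_conv_exp_tail:
  "exp_bounded (\<lambda>x. conv_exp f (of_real x) - (\<Sum>k<n. conv_power f k (of_real x) * (1 / fact (Suc k)))) (A / fact (Suc n)) A"
proof (rule exp_bounded_continuous)
  show "continuous_on {0<..} (\<lambda>x. conv_exp f (complex_of_real x) - (\<Sum>k<n. conv_power f k (complex_of_real x) * (1 / fact (Suc k))))"
    by (intro continuous_intros continuous_on_pos_real holomorphic_on_conv_exp[OF f] holomorphic_on_conv_power f)
  fix x :: real assume x: "x > 0"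
  let ?t = "\<lambda>k. conv_power f k (of_real x) / fact (Suc k)"
  let ?e = "\<lambda>k. (A * x) ^ k / fact k"
  have e: "summable ?e" using summable_exp[of "A * x"] by (simp add: field_simps)
  have t: "norm (?t k) \<le> A * ?e k" for k
    using norm_conv_exp_term_le[OF f S[OF x], of k] x by simp
  have st: "summable ?t"
    by (rule summable_comparison_test[OF _ summable_mult[OF e, of A]]) (use t in auto)
  have "conv_exp f (of_real x) - (\<Sum>k<n. ?t k) = (\<Sum>k. ?t (k + n))"
    unfolding conv_exp_def using suminf_split_initial_segment[OF st, of n] by simp
  also have "norm \<dots> \<le> (\<Sum>k. A / fact (Suc n) * ?e (k + n))"
  proof (rule norm_suminf_le)
    fix k
    have "norm (conv_power f (k + n) (of_real x)) \<le> A ^ Suc (k + n) * norm (complex_of_real x) ^ (k + n) / fact (k + n)"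
      by (intro norm_conv_power_le[OF f] S x)
    also have "\<dots> = A * ?e (k + n)"
      using x by (simp add: power_mult_distrib)
    finally have "norm (conv_power f (k + n) (of_real x)) / fact (Suc (k + n)) \<le> A * ?e (k + n) / fact (Suc (k + n))"
      by (rule divide_right_mono) simp
    hence "norm (?t (k + n)) \<le> A * ?e (k + n) / fact (Suc (k + n))"
      by (simp add: norm_divide del: fact_Suc)
    also have "\<dots> \<le> A * ?e (k + n) / fact (Suc n)"
      using x exp_type_nonneg by (intro divide_left_mono mult_nonneg_nonneg fact_mono) (auto simp del: fact_Suc)
    finally show "norm (?t (k + n)) \<le> A / fact (Suc n) * ?e (k + n)" by (simp del: fact_Suc add: mult_ac)
  next
    show "summable (\<lambda>k. A / fact (Suc n) * ?e (k + n))"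
      using e by (intro summable_mult) (subst summable_iff_shift)
  qed
  also have "\<dots> = A / fact (Suc n) * (\<Sum>k. ?e (k + n))"
    using e by (intro suminf_mult) (subst summable_iff_shift)
  also have "\<dots> \<le> A / fact (Suc n) * exp (A * x)"
  proof (rule mult_left_mono)
    have "(\<Sum>k. ?e (k + n)) \<le> (\<Sum>k<n. ?e k) + (\<Sum>k. ?e (k + n))"
      using x exp_type_nonneg by (simp add: sum_nonneg)
    also have "\<dots> = suminf ?e"
      using suminf_split_initial_segment[OF e, of n] by simp
    also have "\<dots> = exp (A * x)"
      by (simp add: exp_def field_simps)
    finally show "(\<Sum>k. ?e (k + n)) \<le> exp (A * x)" .
  qed (use exp_type_nonneg in \<open>auto simp del: fact_Suc\<close>)
  finally show "norm (conv_exp f (of_real x) - (\<Sum>k<n. conv_power f k (of_real x) * (1 / fact (Suc k)))) \<le> A / fact (Suc n) * exp (A * x)"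
    by (simp del: fact_Suc)
qed

text \<open>Finite partial sums transform to those of the exponential series, and the tail estimate
  controls the error. The \<open>1\<close> on the left stands for the unit \<delta> that
  \<open>conv_exp\<close> leaves out.\<close>

lemma laplace_conv_exp:
  assumes z: "Re z > A"
  shows   "1 + laplace (\<lambda>x. conv_exp f (of_real x)) z = exp (laplace (\<lambda>x. f (of_real x)) z)"
proof -
  define M where "M = laplace (\<lambda>x. f (of_real x)) z"
  define L where "L = laplace (\<lambda>x. conv_exp f (of_real x)) z"
  have bd: "norm (L - (\<Sum>k<n. M ^ Suc k / fact (Suc k))) \<le> A / fact (Suc n) / (Re z - A)" for n
  proof -
    have eb: "exp_bounded (\<lambda>x. conv_power f k (of_real x) * (1 / fact (Suc k))) (A * norm (1 / fact (Suc k) :: complex)) A" for k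
      by (rule exp_bounded_cmult[OF exp_bounded_conv_power])
    have "laplace (\<lambda>x. \<Sum>k<n. conv_power f k (of_real x) * (1 / fact (Suc k))) z =
        (\<Sum>k<n. laplace (\<lambda>x. conv_power f k (of_real x) * (1 / fact (Suc k))) z)"
      by (rule laplace_sum[OF eb z])
    also have "\<dots> = (\<Sum>k<n. M ^ Suc k * (1 / fact (Suc k)))"
      by (simp only: laplace_cmult laplace_conv_power[OF z] M_def)
    finally have "laplace (\<lambda>x. \<Sum>k<n. conv_power f k (of_real x) * (1 / fact (Suc k))) z = \<dots>" .
    moreover have "exp_bounded (\<lambda>x. \<Sum>k<n. conv_power f k (of_real x) * (1 / fact (Suc k)))
        (A + A / fact (Suc n)) A"
    proof -
      have "continuous_on {0<..} (\<lambda>x. \<Sum>k<n. conv_power f k (complex_of_real x) * (1 / fact (Suc k)))"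
        by (intro continuous_intros continuous_on_pos_real holomorphic_on_conv_power f)
      moreover have "norm (\<Sum>k<n. conv_power f k (complex_of_real x) * (1 / fact (Suc k))) \<le> (A + A / fact (Suc n)) * exp (A * x)"
        if "x > 0" for x
      proof -
        have "norm (\<Sum>k<n. conv_power f k (complex_of_real x) * (1 / fact (Suc k))) \<le>
           norm (conv_exp f (of_real x)) + norm (conv_exp f (of_real x) - (\<Sum>k<n. conv_power f k (complex_of_real x) * (1 / fact (Suc k))))"
          by (metis norm_minus_commute norm_triangle_sub)
        also have "\<dots> \<le> A * exp (A * x) + A / fact (Suc n) * exp (A * x)"
          using exp_bounded_conv_exp exp_bounded_conv_exp_tail[of n] that
          unfolding exp_bounded_def by (intro add_mono) auto
        finally show ?thesis by (simp add: algebra_simps del: fact_Suc)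
      qed
      ultimately show ?thesis by (rule exp_bounded_continuous)
    qed
    ultimately have "laplace (\<lambda>x. conv_exp f (of_real x) - (\<Sum>k<n. conv_power f k (of_real x) * (1 / fact (Suc k)))) z =
        L - (\<Sum>k<n. M ^ Suc k * (1 / fact (Suc k)))"
      unfolding L_def using laplace_diff[OF exp_bounded_conv_exp _ z z] by simp
    with norm_laplace_le[OF exp_bounded_conv_exp_tail z, of n] show ?thesis
      by (simp del: fact_Suc)
  qed
  have "(\<lambda>n. inverse (fact n) :: real) \<longlonglongrightarrow> 0"
    using summable_LIMSEQ_zero[OF summable_exp[of "1::real"]] by simp
  hence "(\<lambda>n. A * inverse (fact (Suc n)) / (Re z - A)) \<longlonglongrightarrow> A * 0 / (Re z - A)"
    using z by (intro tendsto_intros LIMSEQ_Suc) auto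
  hence "(\<lambda>n. A / fact (Suc n) / (Re z - A)) \<longlonglongrightarrow> 0"
    by (simp add: divide_inverse del: fact_Suc)
  hence "(\<lambda>n. L - (\<Sum>k<n. M ^ Suc k / fact (Suc k))) \<longlonglongrightarrow> 0"
    by (intro Lim_null_comparison[OF always_eventually[OF allI[OF bd]]]) simp
  hence "(\<lambda>n. L - (L - (\<Sum>k<n. M ^ Suc k / fact (Suc k)))) \<longlonglongrightarrow> L - 0"
    by (intro tendsto_intros)
  hence "(\<lambda>k. M ^ Suc k / fact (Suc k)) sums L"
    by (simp add: sums_def)
  hence "(\<lambda>k. M ^ k / fact k) sums (L + 1)"
    by (subst (asm) sums_Suc_iff) simp
  moreover have "(\<lambda>k. M ^ k / fact k) sums exp M"
    using exp_converges[of M] by (simp add: field_simps scaleR_conv_of_real)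
  ultimately show ?thesis
    unfolding M_def L_def using sums_unique2 by (metis add.commute)
qed

end

subsection \<open>The minor of the Stirling series\<close>

text \<open>\<open>bernoulli 2 / 2\<close> removes the singularity at \<open>0\<close>.\<close>

definition stirling_minor :: "complex \<Rightarrow> complex" where
  "stirling_minor z = (if z = 0 then bernoulli 2 / 2 else (z / (exp z - 1) - 1 + z / 2) / z ^ 2)"

text \<open>For even \<open>n\<close> the denominators combine as
  \<open>(n + 2) * (n + 1) * fact n = fact (n + 2)\<close>. For odd \<open>n\<close> the Stirling
  coefficient is \<open>0\<close> by definition and agrees because the Bernoulli numbers of odd
  index at least \<open>3\<close> vanish.\<close>

lemma has_fps_expansion_stirling_minor: "stirling_minor has_fps_expansion borel_minor stirling_series"
proof -
  let ?b = "fps_X / (fps_exp 1 - 1) :: complex fps"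
  have E0: "subdegree (fps_exp 1 - 1 :: complex fps) = 1"
    by (rule subdegreeI) auto
  have 1: "(\<lambda>z. if z = 0 then 1 else z / (exp z - 1)) has_fps_expansion ?b"
  proof (rule has_fps_expansion_divide)
    show "(\<lambda>z. exp z - 1 :: complex) has_fps_expansion fps_exp 1 - 1"
      by (intro fps_expansion_intros)
    show "subdegree (fps_exp 1 - 1 :: complex fps) \<le> subdegree (fps_X :: complex fps)"
      unfolding E0 by simp
    show "fps_exp 1 - 1 \<noteq> (0 :: complex fps)" using E0 by force
    show "1 = fps_nth fps_X (subdegree (fps_exp 1 - 1 :: complex fps)) / fps_nth (fps_exp 1 - 1 :: complex fps) (subdegree (fps_exp 1 - 1 :: complex fps))"
      unfolding E0 by simp
  qed (intro fps_expansion_intros)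
  have 2: "(\<lambda>z. (if z = 0 then 1 else z / (exp z - 1)) - 1 + z * (1 / 2)) has_fps_expansion
      ?b - 1 + fps_X * fps_const (1 / 2)"
    by (intro fps_expansion_intros 1)
  have nth: "fps_nth (?b - 1 + fps_X * fps_const (1 / 2)) n =
      (if n < 2 then 0 else bernoulli n / fact n)" for n
    using bernoulli_0 bernoulli_1
    by (cases n; cases "n - 1") (auto simp: bernoulli_gf_nth)
  have "(\<lambda>z. if z = 0 then bernoulli 2 / 2 else ((if z = 0 then 1 else z / (exp z - 1)) - 1 + z * (1 / 2)) / z ^ 2)
      has_fps_expansion fps_shift 2 (?b - 1 + fps_X * fps_const (1 / 2))"
  proof (rule has_fps_expansion_shift[OF 2])
    show "2 \<le> subdegree (?b - 1 + fps_X * fps_const (1 / 2))"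
    proof (rule subdegree_geI)
      \<comment> \<open>The zero series has \<open>subdegree 0\<close> by convention, so a nonzero
        coefficient must be exhibited first; \<open>bernoulli 2\<close> provides it.\<close>
      show "?b - 1 + fps_X * fps_const (1 / 2) \<noteq> 0"
      proof
        assume *: "?b - 1 + fps_X * fps_const (1 / 2) = 0"
        have "bernoulli 2 = 0" using nth[of 2] unfolding * by simp
        thus False
          using bernoulli_rec[of 2] bernoulli_0 bernoulli_1 by (simp add: numeral_2_eq_2)
      qed
    qed (use nth in auto)
    show "bernoulli 2 / 2 = fps_nth (?b - 1 + fps_X * fps_const (1 / 2)) 2"
      by (subst nth) simp
  qed
  also have "(\<lambda>z. if z = 0 then bernoulli 2 / 2 else ((if z = 0 then 1 else z / (exp z - 1)) - 1 + z * (1 / 2)) / z ^ 2) = stirling_minor"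
    by (auto simp: stirling_minor_def fun_eq_iff)
  also have "fps_shift 2 (?b - 1 + fps_X * fps_const (1 / 2)) = borel_minor stirling_series"
  proof (rule fps_ext)
    fix n
    have "fps_nth (fps_shift 2 (?b - 1 + fps_X * fps_const (1 / 2))) n = bernoulli (n + 2) / fact (n + 2)"
      by (simp only: fps_shift_nth nth) simp
    also have "\<dots> = fps_nth (borel_minor stirling_series) n"
    proof (cases "even n")
      case True
      thus ?thesis by (simp add: borel_minor_nth stirling_series_def field_simps)
    next
      case False
      hence "bernoulli (n + 2) = 0" by (intro bernoulli_odd_eq_0) auto
      thus ?thesis using False by (simp add: borel_minor_nth stirling_series_def)
    qed
    finally show "fps_nth (fps_shift 2 (?b - 1 + fps_X * fps_const (1 / 2))) n = fps_nth (borel_minor stirling_series) n" .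
  qed
  finally show ?thesis .
qed

text \<open>For \<open>K > 1\<close> a cone of half-angle \<open>arccos (1 / K)\<close> about the
  positive axis, enlarged by the unit disc so that \<open>0\<close> is an interior point. The
  inequality is phrased so as to give \<open>norm z / Re z < K\<close>, the quantity that controls
  \<open>z / (exp z - 1)\<close>.\<close>

definition sector_dom :: "real \<Rightarrow> complex set" where
  "sector_dom K = ball 0 1 \<union> {z. norm z < K * Re z}"

lemma exp_neq_1:
  assumes "norm z < 2 \<or> Re z > 0" "z \<noteq> 0"
  shows   "exp z \<noteq> 1"
proof
  assume "exp z = 1"
  then obtain n :: int where n: "Re z = 0" "Im z = of_int (2 * n) * pi"
    by (auto simp: exp_eq_1)
  have "n \<noteq> 0" using n assms(2) by (auto simp: complex_eq_iff)
  hence "\<bar>of_int n :: real\<bar> \<ge> 1" by linarith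
  hence "2 * pi * \<bar>of_int n\<bar> \<ge> 2 * pi * (1::real)" by (intro mult_left_mono) auto
  hence "\<bar>Im z\<bar> \<ge> 2 * pi" using n by (simp add: abs_mult mult_ac)
  moreover have "\<bar>Im z\<bar> < 2" using abs_Im_le_cmod[of z] assms n by linarith
  ultimately show False using pi_gt3 by linarith
qed

text \<open>The poles are the nonzero multiples of \<open>2 * pi * \<i>\<close>. A radius above
  \<open>1\<close> keeps the closed unit disc in the interior, as the compactness bound
  requires.\<close>

lemma holomorphic_on_stirling_minor: "stirling_minor holomorphic_on (ball 0 2 \<union> {z. Re z > 0})"
proof -
  have "stirling_minor analytic_on {z}" if z: "z \<in> ball 0 2 \<union> {z. Re z > 0}" for z
  proof (cases "z = 0")
    case True
    thus ?thesis using has_fps_expansion_imp_analytic_0[OF has_fps_expansion_stirling_minor] by simp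
  next
    case False
    have "(\<lambda>z. (z / (exp z - 1) - 1 + z / 2) / z ^ 2) analytic_on {z}"
      using exp_neq_1[of z] z False by (intro analytic_intros) auto
    moreover have "eventually (\<lambda>w. stirling_minor w = (w / (exp w - 1) - 1 + w / 2) / w ^ 2) (nhds z)"
      using t1_space_nhds[OF False] by eventually_elim (auto simp: stirling_minor_def)
    ultimately show ?thesis using analytic_at_cong by fast
  qed
  hence "stirling_minor analytic_on (ball 0 2 \<union> {z. Re z > 0})"
    using analytic_on_analytic_at by blast
  thus ?thesis by (rule analytic_imp_holomorphic)
qed

lemma open_sector_dom: "open (sector_dom K)"
  unfolding sector_dom_def by (intro open_Un open_ball open_Collect_less continuous_intros)

lemma starlike0_sector_dom: "starlike0 (sector_dom K)"
  unfolding starlike0_def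
proof safe
  fix z and t :: real assume z: "z \<in> sector_dom K" and t: "t \<in> {0..1}"
  show "of_real t * z \<in> sector_dom K"
  proof (cases "t = 0 \<or> norm z < 1")
    case True
    have "t * norm z < 1"
      using True t mult_left_le_one_le[of "norm z" t] by auto
    thus ?thesis using t by (simp add: sector_dom_def norm_mult)
  next
    case False
    hence "norm z < K * Re z" using z by (auto simp: sector_dom_def)
    hence "t * norm z < t * (K * Re z)" using t False by (intro mult_strict_left_mono) auto
    thus ?thesis using t by (simp add: sector_dom_def norm_mult mult_ac)
  qed
qed

lemma sector_dom_Re_pos:
  assumes "norm z < K * Re z" "K > 0"
  shows   "Re z > 0"
proof -
  have "0 < K * Re z" using assms norm_ge_zero le_less_trans by blast
  thus ?thesis using assms by (simp add: zero_less_mult_iff)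
qed

lemma sector_dom_subset: "K > 0 \<Longrightarrow> sector_dom K \<subseteq> ball 0 2 \<union> {z. Re z > 0}"
  using sector_dom_Re_pos by (auto simp: sector_dom_def)

lemma holomorphic_on_stirling_minor_sector: "K > 0 \<Longrightarrow> stirling_minor holomorphic_on sector_dom K"
  using holomorphic_on_stirling_minor sector_dom_subset holomorphic_on_subset by blast

text \<open>Compactness covers the closed unit disc. Outside it,
  \<open>norm (exp z - 1) \<ge> exp (Re z) - 1 \<ge> Re z\<close> bounds
  \<open>z / (exp z - 1)\<close> by \<open>K\<close>, and the other terms are dominated by
  \<open>z ^ 2\<close>. One \<open>C\<close> serves all \<open>K\<close>, so the exponential type
  will depend on the direction in an explicit continuous way.\<close>

lemma stirling_minor_bound_ex:
  "\<exists>C\<ge>0. \<forall>K>0. \<forall>z\<in>sector_dom K. norm (stirling_minor z) \<le> C + K"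
proof -
  have "compact (stirling_minor ` cball 0 1)"
    by (intro compact_continuous_image holomorphic_on_imp_continuous_on
          holomorphic_on_subset[OF holomorphic_on_stirling_minor]) auto
  then obtain C where C: "\<And>z. z \<in> cball 0 1 \<Longrightarrow> norm (stirling_minor z) \<le> C"
    using compact_imp_bounded bounded_iff by (metis (no_types, lifting) imageI)
  have C0: "C \<ge> 0" using order_trans[OF norm_ge_zero C[of 0]] by simp
  have "norm (stirling_minor z) \<le> (C + 2) + K" if K: "K > 0" and z: "z \<in> sector_dom K" for z K
  proof (cases "norm z \<le> 1")
    case True
    thus ?thesis using C[of z] K by simp
  next
    case False
    hence zK: "norm z < K * Re z" and n1: "norm z > 1" using z by (auto simp: sector_dom_def)
    have Re: "Re z > 0" using sector_dom_Re_pos[OF zK K] .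
    have "Re z \<le> exp (Re z) - 1" using exp_ge_add_one_self[of "Re z"] by linarith
    also have "\<dots> \<le> norm (exp z - 1)"
      using norm_triangle_ineq2[of "exp z" 1] by simp
    finally have e: "Re z \<le> norm (exp z - 1)" .
    have "norm (z / (exp z - 1)) \<le> norm z / Re z"
      unfolding norm_divide using e Re by (intro divide_left_mono mult_pos_pos) auto
    also have "\<dots> \<le> K" using zK Re by (simp add: divide_simps)
    finally have q: "norm (z / (exp z - 1)) \<le> K" .
    have "norm (z / (exp z - 1) - 1 + z / 2) \<le> K + 1 + norm z / 2"
      using norm_triangle_ineq[of "z / (exp z - 1) - 1" "z / 2"] norm_triangle_ineq4[of "z / (exp z - 1)" 1] q
      by (simp add: norm_divide)
    also have "\<dots> \<le> (K + 2) * norm z ^ 2"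
    proof -
      have "1 \<le> norm z ^ 2" using n1 by (simp add: one_le_power)
      moreover have "norm z \<le> norm z ^ 2" using n1 by (intro self_le_power) auto
      moreover have "K * 1 \<le> K * norm z ^ 2" using calculation K by (intro mult_left_mono) auto
      ultimately show ?thesis by (simp add: algebra_simps)
    qed
    finally have "norm (z / (exp z - 1) - 1 + z / 2) / norm z ^ 2 \<le> K + 2"
      using n1 by (subst pos_divide_le_eq) auto
    moreover have "z \<noteq> 0" using n1 by auto
    ultimately have "norm (stirling_minor z) \<le> K + 2"
      by (simp add: stirling_minor_def norm_divide norm_power)
    thus ?thesis using C0 by simp
  qed
  moreover have "C + 2 \<ge> 0" using C0 by simp
  ultimately show ?thesis by blast
qed

definition stirling_bound :: real where
  "stirling_bound = (SOME C. C \<ge> 0 \<and> (\<forall>K>0. \<forall>z\<in>sector_dom K. norm (stirling_minor z) \<le> C + K))"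

lemma stirling_bound_nonneg: "stirling_bound \<ge> 0"
  and norm_stirling_minor_le: "K > 0 \<Longrightarrow> z \<in> sector_dom K \<Longrightarrow> norm (stirling_minor z) \<le> stirling_bound + K"
  using someI_ex[OF stirling_minor_bound_ex[unfolded Bex_def]] unfolding stirling_bound_def by blast+

lemma of_real_in_sector_dom: "x > 0 \<Longrightarrow> K > 1 \<Longrightarrow> of_real x \<in> sector_dom K"
  by (simp add: sector_dom_def)

lemma exp_bounded_stirling_minor: "exp_bounded (\<lambda>x. stirling_minor (of_real x)) (stirling_bound + 2) 0"
proof (rule exp_bounded_continuous)
  show "continuous_on {0<..} (\<lambda>x. stirling_minor (complex_of_real x))"
    by (rule continuous_on_compose2[OF holomorphic_on_imp_continuous_on[OF holomorphic_on_stirling_minor]])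
       (auto intro!: continuous_intros)
  fix x :: real assume "x > 0"
  thus "norm (stirling_minor (of_real x)) \<le> (stirling_bound + 2) * exp (0 * x)"
    using norm_stirling_minor_le[of 2 "of_real x"] of_real_in_sector_dom[of x 2] by simp
qed

definition binet :: "complex \<Rightarrow> complex" where
  "binet = laplace (\<lambda>x. stirling_minor (of_real x))"

section \<open>The second derivative of the Binet integral\<close>

lemma laplace_shift: "laplace (\<lambda>x. exp (- a * of_real x) * f x) z = laplace f (z + a)"
  unfolding laplace_def by (simp add: algebra_simps exp_add exp_diff exp_minus field_simps)

lemma exp_bounded_bose: "exp_bounded (\<lambda>x. of_real x / (exp (of_real x) - 1)) 1 0"
proof (rule exp_bounded_continuous)
  show "continuous_on {0<..} (\<lambda>x. complex_of_real x / (exp (of_real x) - 1))"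
    using exp_neq_1[of "of_real _"] by (intro continuous_intros) auto
  fix x :: real assume x: "x > 0"
  have "exp (complex_of_real x) - 1 = of_real (exp x - 1)" by (simp add: exp_of_real)
  hence "norm (complex_of_real x / (exp (of_real x) - 1)) = x / (exp x - 1)"
    using x by (simp add: norm_divide del: of_real_diff)
  also have "\<dots> \<le> 1" 
  proof -
    have "x \<le> exp x - 1" using exp_ge_add_one_self[of x] by linarith
    thus ?thesis using x by (subst pos_divide_le_eq) auto
  qed
  finally show "norm (complex_of_real x / (exp (of_real x) - 1)) \<le> 1 * exp (0 * x)" by simp
qed

text \<open>Geometric expansion of \<open>1 / (exp x - 1)\<close> in powers of
  \<open>exp (- x)\<close>. The remainder after \<open>n\<close> terms is exactly
  \<open>exp (- n * x)\<close> times the original function, so its transform is at most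
  \<open>1 / (Re z + n)\<close>.\<close>

lemma laplace_bose:
  assumes z: "Re z > 0"
  shows   "(\<lambda>k. 1 / (z + of_nat (Suc k)) ^ 2) sums laplace (\<lambda>x. of_real x / (exp (of_real x) - 1)) z"
proof -
  let ?g = "\<lambda>x. complex_of_real x / (exp (of_real x) - 1)"
  let ?P = "\<lambda>n x. \<Sum>k<n. exp (- of_nat (Suc k) * complex_of_real x) * complex_of_real x"
  have E: "exp (complex_of_real x) - 1 \<noteq> 0" if "x > 0" for x
    using exp_neq_1[of "of_real x"] that by simp
  have g: "norm (?g x) \<le> 1" if "x > 0" for x
    using exp_bounded_bose that by (auto simp: exp_bounded_def)
  note ebg = exp_bounded_bose
  have tail: "?g x - ?P n x = exp (- of_nat n * of_real x) * ?g x" if "x > 0" for x n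
  proof (induction n)
    case (Suc n)
    have "?g x - ?P (Suc n) x = exp (- of_nat n * of_real x) * ?g x - exp (- of_nat (Suc n) * of_real x) * of_real x"
      unfolding sum.lessThan_Suc Suc.IH[symmetric] by (simp only: diff_diff_eq)
    also have "exp (- of_nat n * complex_of_real x) = exp (- of_nat (Suc n) * of_real x) * exp (of_real x)"
      by (simp add: algebra_simps flip: exp_add)
    also have "exp (- of_nat (Suc n) * of_real x) * exp (of_real x) * ?g x - exp (- of_nat (Suc n) * of_real x) * of_real x =
        exp (- of_nat (Suc n) * of_real x) * ?g x"
    proof -
      have "a * e * (y / (e - 1)) - a * y = a * (y / (e - 1))" if "e - 1 \<noteq> 0" for a e y :: complex
        using that by (simp add: field_simps)
      thus ?thesis using E[OF that] by blast
    qed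
    finally show ?case .
  qed auto
  have ebP: "exp_bounded (\<lambda>x. exp (- of_nat (Suc k) * complex_of_real x) * complex_of_real x) 1 0" for k
  proof (rule exp_bounded_continuous)
    fix x :: real assume x: "x > 0"
    have "exp (- of_nat (Suc k) * complex_of_real x) = of_real (exp (- real (Suc k) * x))"
      by (simp flip: exp_of_real)
    hence "norm (exp (- of_nat (Suc k) * complex_of_real x) * complex_of_real x) = exp (- real (Suc k) * x) * x"
      using x by (simp only: norm_mult norm_of_real abs_exp_cancel)
    also have "\<dots> \<le> exp (- x) * exp x"
    proof (intro mult_mono)
      show "x \<le> exp x" using exp_ge_add_one_self[of x] by linarith
    qed (use x in \<open>auto simp: algebra_simps\<close>)
    finally show "norm (exp (- of_nat (Suc k) * complex_of_real x) * complex_of_real x) \<le> 1 * exp (0 * x)"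
      by (simp add: exp_minus)
  qed (auto intro!: continuous_intros)
  have P: "laplace (?P n) z = (\<Sum>k<n. 1 / (z + of_nat (Suc k)) ^ 2)" for n
  proof -
    have "laplace (?P n) z = (\<Sum>k<n. laplace (\<lambda>x. exp (- of_nat (Suc k) * complex_of_real x) * complex_of_real x) z)"
      by (rule laplace_sum[OF ebP]) (use z in auto)
    also have "\<dots> = (\<Sum>k<n. laplace (\<lambda>x. of_real x ^ 1) (z + of_nat (Suc k)))"
      unfolding laplace_shift by simp
    also have "\<dots> = (\<Sum>k<n. 1 / (z + of_nat (Suc k)) ^ 2)"
      using z by (intro sum.cong refl, subst laplace_power) (auto simp: power2_eq_square)
    finally show ?thesis .
  qed
  have bd: "norm (laplace ?g z - (\<Sum>k<n. 1 / (z + of_nat (Suc k)) ^ 2)) \<le> 1 / (Re z + real n)" for n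
  proof -
    have en: "norm (exp (- of_nat n * complex_of_real x)) = exp (- real n * x)" for x
      by simp
    have ebt: "exp_bounded (\<lambda>x. ?g x - ?P n x) 1 (- real n)"
    proof (rule exp_bounded_continuous)
      show "continuous_on {0<..} (\<lambda>x. ?g x - ?P n x)"
        using E by (intro continuous_intros) auto
      fix x :: real assume x: "x > 0"
      show "norm (?g x - ?P n x) \<le> 1 * exp (- real n * x)"
        unfolding tail[OF x] norm_mult en using g[OF x] by simp
    qed
    have ebPn: "exp_bounded (?P n) (real n) 0"
    proof (rule exp_bounded_continuous)
      fix x :: real assume x: "x > 0"
      have "norm (?P n x) \<le> (\<Sum>k<n. 1)"
        using ebP x unfolding exp_bounded_def by (intro sum_norm_le) auto
      thus "norm (?P n x) \<le> real n * exp (0 * x)" by simp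
    qed (auto intro!: continuous_intros)
    have "laplace ?g z - (\<Sum>k<n. 1 / (z + of_nat (Suc k)) ^ 2) = laplace (\<lambda>x. ?g x - ?P n x) z"
      using laplace_diff[OF ebg ebPn z z] P by simp
    also have "norm \<dots> \<le> 1 / (Re z - (- real n))"
      by (rule norm_laplace_le[OF ebt]) (use z in linarith)
    finally show ?thesis by simp
  qed
  have "(\<lambda>n. 1 / (Re z + real n)) \<longlonglongrightarrow> 0" by real_asymp
  hence "(\<lambda>n. laplace ?g z - (\<Sum>k<n. 1 / (z + of_nat (Suc k)) ^ 2)) \<longlonglongrightarrow> 0"
    by (intro Lim_null_comparison[OF always_eventually[OF allI[OF bd]]])
  hence "(\<lambda>n. laplace ?g z - (laplace ?g z - (\<Sum>k<n. 1 / (z + of_nat (Suc k)) ^ 2))) \<longlonglongrightarrow> laplace ?g z - 0"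
    by (intro tendsto_intros)
  thus ?thesis by (simp add: sums_def)
qed

text \<open>The series for the transform of \<open>x / (exp x - 1)\<close> starts one step later
  than the trigamma series. The missing \<open>1 / z ^ 2\<close>, combined with the transform of
  \<open>x / 2\<close>, leaves \<open>- 1 / (2 * z ^ 2)\<close>.\<close>

lemma binet_second_deriv:
  assumes z: "Re z > 0"
  shows   "laplace (\<lambda>x. of_real x * (of_real x * stirling_minor (of_real x))) z = Polygamma 1 z - 1 / z - 1 / (2 * z ^ 2)"
proof -
  let ?g = "\<lambda>x. complex_of_real x / (exp (of_real x) - 1)"
  have z0: "z \<noteq> 0" using z by auto
  have "laplace (\<lambda>x. of_real x * (of_real x * stirling_minor (of_real x))) z = laplace (\<lambda>x. ?g x - (1 - of_real x * (1 / 2))) z"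
    unfolding laplace_def
  proof (rule set_lebesgue_integral_cong)
    show "\<forall>x. x \<in> {0<..} \<longrightarrow> exp (- z * complex_of_real x) * (of_real x * (of_real x * stirling_minor (of_real x))) =
        exp (- z * complex_of_real x) * (?g x - (1 - of_real x * (1 / 2)))"
      by (auto simp: stirling_minor_def field_simps power2_eq_square)
  qed auto
  also have "\<dots> = laplace ?g z - (laplace (\<lambda>x. 1) z - laplace (\<lambda>x. of_real x * (1 / 2)) z)"
  proof -
    have e1: "exp_bounded (\<lambda>x. 1) 1 0" by (rule exp_bounded_continuous) auto
    define d where "d = Re z / 2"
    have d: "d > 0" "d < Re z" using z by (auto simp: d_def)
    have ex: "exp_bounded (\<lambda>x. of_real x * (1 / 2)) (1 / d * norm (1 / 2 :: complex)) d"
      using exp_bounded_cmult[OF exp_bounded_power[OF d(1), of 1], of "1 / 2"] by simp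
    have e2: "exp_bounded (\<lambda>x. 1 - of_real x * (1 / 2)) (1 + 1 / d * norm (1 / 2 :: complex)) d"
    proof (rule exp_bounded_continuous)
      fix x :: real assume x: "x > 0"
      have "norm (1 - of_real x * (1 / 2) :: complex) \<le> 1 + norm (of_real x * (1 / 2) :: complex)"
        using norm_triangle_ineq4[of "1 :: complex" "of_real x * (1 / 2)"] by simp
      also have "\<dots> \<le> exp (d * x) + 1 / d * norm (1 / 2 :: complex) * exp (d * x)"
        using ex x d unfolding exp_bounded_def by (intro add_mono) auto
      finally show "norm (1 - of_real x * (1 / 2) :: complex) \<le> (1 + 1 / d * norm (1 / 2 :: complex)) * exp (d * x)"
        by (simp add: algebra_simps)
    qed (auto intro!: continuous_intros)
    show ?thesis
      using laplace_diff[OF exp_bounded_bose e2 z d(2)] laplace_diff[OF e1 ex z d(2)] by simp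
  qed
  also have "laplace (\<lambda>x. of_real x * (1 / 2)) z = 1 / (2 * z ^ 2)"
    unfolding laplace_cmult using laplace_power[OF z, of 1] by (simp add: power2_eq_square)
  also have "laplace (\<lambda>x. 1) z = 1 / z" by (rule laplace_1[OF z])
  also have "laplace ?g z = Polygamma 1 z - 1 / z ^ 2"
  proof -
    have "(\<lambda>k. 1 / (z + of_nat k) ^ 2) sums Polygamma 1 z"
      using Polygamma_LIMSEQ[OF z0, of 1] by (simp add: inverse_eq_divide numeral_2_eq_2)
    hence "(\<lambda>k. 1 / (z + of_nat (Suc k)) ^ 2) sums (Polygamma 1 z - 1 / z ^ 2)"
      by (subst sums_Suc_iff) simp
    with laplace_bose[OF z] show ?thesis using sums_unique2 by blast
  qed
  finally show ?thesis by simp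
qed

subsection \<open>Binet's formula\<close>

lemma has_field_derivative_binet:
  assumes z: "Re z > 0"
  shows   "(binet has_field_derivative - laplace (\<lambda>x. of_real x * stirling_minor (of_real x)) z) (at z)"
  unfolding binet_def by (rule has_field_derivative_laplace[OF exp_bounded_stirling_minor z])

lemma has_field_derivative_binet':
  assumes z: "Re z > 0"
  shows   "((\<lambda>z. laplace (\<lambda>x. of_real x * stirling_minor (of_real x)) z) has_field_derivative
              -(Polygamma 1 z - 1 / z - 1 / (2 * z ^ 2))) (at z)"
  unfolding binet_second_deriv[OF z, symmetric]
  by (rule has_field_derivative_laplace[OF exp_bounded_times[OF exp_bounded_stirling_minor, of "Re z / 2"]])
     (use z in auto)

lemma tendsto_binet: "((\<lambda>x. binet (of_real x)) \<longlongrightarrow> 0) at_top"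
proof (rule Lim_null_comparison)
  show "eventually (\<lambda>x. norm (binet (complex_of_real x)) \<le> (stirling_bound + 2) / x) at_top"
    using eventually_gt_at_top[of 0]
  proof eventually_elim
    case (elim x)
    thus ?case using norm_laplace_le[OF exp_bounded_stirling_minor, of "of_real x"] by (simp add: binet_def)
  qed
  show "((\<lambda>x. (stirling_bound + 2) / x) \<longlongrightarrow> 0) at_top"
    by (rule real_tendsto_divide_at_top[OF tendsto_const filterlim_ident])
qed

text \<open>A holomorphic logarithm, on the right half-plane, of \<open>lambda_fun\<close> times
  \<open>sqrt (2 * pi)\<close>; the normalising constant is to come out of the comparison with
  \<open>binet\<close>.\<close>

definition ln_lambda :: "complex \<Rightarrow> complex" where
  "ln_lambda z = ln_Gamma z + (1 / 2 - z) * Ln z + z"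

text \<open>Both functions have second derivative
  \<open>Polygamma 1 z - 1 / z - 1 / (2 * z ^ 2)\<close> on the half-plane. In the proof
  \<open>d\<close> is the derivative of the difference and \<open>q\<close> the difference with its
  slope removed.\<close>

lemma ln_lambda_minus_binet_affine:
  "\<exists>a b. \<forall>z. Re z > 0 \<longrightarrow> ln_lambda z - binet z = a * z + b"
proof -
  let ?H = "{z. Re z > 0}"
  have conv: "convex ?H" by (rule convex_halfspace_Re_gt)
  have nz: "z \<notin> \<real>\<^sub>\<le>\<^sub>0" "z \<notin> \<int>\<^sub>\<le>\<^sub>0" "z \<noteq> 0" if "z \<in> ?H" for z
    using that by (auto simp: complex_nonpos_Reals_iff elim!: nonpos_Ints_cases)
  define d where "d = (\<lambda>z. Digamma z - Ln z + 1 / (2 * z) + laplace (\<lambda>x. of_real x * stirling_minor (of_real x)) z)"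
  have "(d has_field_derivative 0) (at z within ?H)" if z: "z \<in> ?H" for z
  proof -
    have "(d has_field_derivative (Polygamma (Suc 0) z - 1 / z + (- (1 / (2 * z ^ 2))) +
            (-(Polygamma 1 z - 1 / z - 1 / (2 * z ^ 2))))) (at z)"
      unfolding d_def
      using nz[OF z] z
      by (intro DERIV_add DERIV_diff has_field_derivative_binet' has_field_derivative_Polygamma)
         (auto intro!: derivative_eq_intros simp: power2_eq_square divide_simps)
    thus ?thesis by (simp add: has_field_derivative_at_within)
  qed
  then obtain a where a: "\<And>z. z \<in> ?H \<Longrightarrow> d z = a"
    using has_field_derivative_zero_constant[OF conv, of d] by auto
  define q where "q = (\<lambda>z. ln_lambda z - binet z - a * z)"
  have "(q has_field_derivative 0) (at z within ?H)" if z: "z \<in> ?H" for z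
  proof -
    have "((\<lambda>z. (1 / 2 - z) * Ln z) has_field_derivative (- Ln z + (1 / 2 - z) / z)) (at z)"
      using nz[OF z] by (auto intro!: derivative_eq_intros simp: field_simps)
    hence "(q has_field_derivative (Digamma z + (- Ln z + (1 / 2 - z) / z) + 1
        - (- laplace (\<lambda>x. of_real x * stirling_minor (of_real x)) z) - a * 1)) (at z)"
      unfolding q_def ln_lambda_def using nz[OF z] z
      by (intro DERIV_add DERIV_diff has_field_derivative_binet has_field_derivative_ln_Gamma_complex
            DERIV_cmult DERIV_ident) auto
    also have "Digamma z + (- Ln z + (1 / 2 - z) / z) + 1
        - (- laplace (\<lambda>x. of_real x * stirling_minor (of_real x)) z) - a * 1 = d z - a"
      using nz[OF z] by (simp add: d_def field_simps)
    finally show ?thesis using a[OF z] by (simp add: has_field_derivative_at_within)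
  qed
  then obtain b where b: "\<And>z. z \<in> ?H \<Longrightarrow> q z = b"
    using has_field_derivative_zero_constant[OF conv, of q] by auto
  have "ln_lambda z - binet z = a * z + b" if "Re z > 0" for z
    using b[of z] that by (simp add: q_def algebra_simps)
  thus ?thesis by blast
qed

section \<open>Asymptotics of the Gamma function on the positive axis\<close>

definition ln_lambda_real :: "real \<Rightarrow> real" where
  "ln_lambda_real x = ln_Gamma x + (1 / 2 - x) * ln x + x"

lemma ln_lambda_of_real: "x > 0 \<Longrightarrow> ln_lambda (of_real x) = of_real (ln_lambda_real x)"
  by (simp add: ln_lambda_def ln_lambda_real_def ln_Gamma_complex_of_real Ln_of_real)

lemma tendsto_ln_lambda_real_diff: "((\<lambda>x. ln_lambda_real (x + 1) - ln_lambda_real x) \<longlongrightarrow> 0) at_top"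
proof (rule Lim_transform_eventually)
  show "((\<lambda>x::real. ln x + (1 / 2 - (x + 1)) * ln (x + 1) - (1 / 2 - x) * ln x + 1) \<longlongrightarrow> 0) at_top"
    by real_asymp
  show "eventually (\<lambda>x. ln x + (1 / 2 - (x + 1)) * ln (x + 1) - (1 / 2 - x) * ln x + 1 =
      ln_lambda_real (x + 1) - ln_lambda_real x) at_top"
    using eventually_gt_at_top[of 0]
  proof eventually_elim
    case (elim x)
    have "x \<notin> \<int>\<^sub>\<le>\<^sub>0" using elim by (auto elim!: nonpos_Ints_cases)
    moreover have "Gamma x \<noteq> 0" using Gamma_real_pos[OF elim] by linarith
    ultimately have "ln_Gamma (x + 1) = ln x + ln_Gamma x"
      using elim Gamma_plus1[of x] by (simp add: ln_Gamma_real_pos ln_mult)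
    thus ?case by (simp add: ln_lambda_real_def)
  qed
qed

lemma ln_Gamma_legendre_duplication:
  fixes x :: real
  assumes x: "x > 0"
  shows "ln_Gamma x + ln_Gamma (x + 1 / 2) = (1 - 2 * x) * ln 2 + ln pi / 2 + ln_Gamma (2 * x)"
proof -
  have "Gamma (complex_of_real x) * Gamma (of_real x + 1 / 2) =
      exp ((1 - 2 * of_real x) * of_real (ln 2)) * of_real (sqrt pi) * Gamma (2 * of_real x)"
    by (rule Gamma_legendre_duplication)
       (use x in \<open>auto elim!: nonpos_Ints_cases simp: complex_eq_iff\<close>)
  also have "of_real x + 1 / 2 = complex_of_real (x + 1 / 2)" by simp
  also have "2 * of_real x = complex_of_real (2 * x)" by simp
  also have "(1 - complex_of_real (2 * x)) * of_real (ln 2) = of_real ((1 - 2 * x) * ln 2)" by simp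
  finally have "complex_of_real (Gamma x * Gamma (x + 1 / 2)) = of_real (exp ((1 - 2 * x) * ln 2) * sqrt pi * Gamma (2 * x))"
    unfolding Gamma_complex_of_real exp_of_real of_real_mult[symmetric] .
  hence eq: "Gamma x * Gamma (x + 1 / 2) = exp ((1 - 2 * x) * ln 2) * sqrt pi * Gamma (2 * x)"
    by (simp only: of_real_eq_iff)
  have "Gamma x > 0" "Gamma (x + 1 / 2) > 0" "Gamma (2 * x) > 0" using x by auto
  hence "ln (Gamma x) + ln (Gamma (x + 1 / 2)) = (1 - 2 * x) * ln 2 + ln (sqrt pi) + ln (Gamma (2 * x))"
    using arg_cong[OF eq, of ln] by (simp add: ln_mult)
  thus ?thesis using x by (simp add: ln_Gamma_real_pos ln_sqrt)
qed

text \<open>The duplication formula eliminates all values of \<open>ln_Gamma\<close> and contributes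
  \<open>ln pi / 2\<close>; the elementary rest tends to \<open>ln 2 / 2\<close>.\<close>

lemma tendsto_ln_lambda_real_dupl:
  "((\<lambda>x. ln_lambda_real x + ln_lambda_real (x + 1 / 2) - ln_lambda_real (2 * x)) \<longlongrightarrow> ln (sqrt (2 * pi))) at_top"
proof (rule Lim_transform_eventually)
  have "((\<lambda>x::real. (1 - 2 * x) * ln 2 + (1 / 2 - x) * ln x + (1 / 2 - (x + 1 / 2)) * ln (x + 1 / 2)
          - (1 / 2 - 2 * x) * ln (2 * x) + 1 / 2) \<longlongrightarrow> ln 2 / 2) at_top"
    by real_asymp
  hence "((\<lambda>x::real. ((1 - 2 * x) * ln 2 + (1 / 2 - x) * ln x + (1 / 2 - (x + 1 / 2)) * ln (x + 1 / 2)
          - (1 / 2 - 2 * x) * ln (2 * x) + 1 / 2) + ln pi / 2) \<longlongrightarrow> ln 2 / 2 + ln pi / 2) at_top"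
    by (intro tendsto_intros)
  also have "ln 2 / 2 + ln pi / 2 = ln (sqrt (2 * pi))"
    by (simp add: ln_sqrt ln_mult field_simps)
  finally show "((\<lambda>x::real. ((1 - 2 * x) * ln 2 + (1 / 2 - x) * ln x + (1 / 2 - (x + 1 / 2)) * ln (x + 1 / 2)
          - (1 / 2 - 2 * x) * ln (2 * x) + 1 / 2) + ln pi / 2) \<longlongrightarrow> ln (sqrt (2 * pi))) at_top" .
  show "eventually (\<lambda>x. ((1 - 2 * x) * ln 2 + (1 / 2 - x) * ln x + (1 / 2 - (x + 1 / 2)) * ln (x + 1 / 2)
          - (1 / 2 - 2 * x) * ln (2 * x) + 1 / 2) + ln pi / 2 =
        ln_lambda_real x + ln_lambda_real (x + 1 / 2) - ln_lambda_real (2 * x)) at_top"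
    using eventually_gt_at_top[of 0]
  proof eventually_elim
    case (elim x)
    show ?case using ln_Gamma_legendre_duplication[OF elim] by (simp add: ln_lambda_real_def)
  qed
qed

text \<open>
  The recurrence and the duplication formula of the Gamma function, both taken at \<open>+\<infinity>\<close>, determine
  the two coefficients of the affine function.
\<close>

theorem ln_lambda_eq_binet:
  assumes z: "Re z > 0"
  shows   "ln_lambda z = ln (sqrt (2 * pi)) + binet z"
proof -
  obtain a b where ab: "\<And>z. Re z > 0 \<Longrightarrow> ln_lambda z - binet z = a * z + b"
    using ln_lambda_minus_binet_affine by blast
  let ?l = "\<lambda>x. complex_of_real (ln_lambda_real x)" and ?b = "\<lambda>x. binet (complex_of_real x)"
  have l: "?l x - ?b x = a * of_real x + b" if "x > 0" for x
    using ab[of "of_real x"] ln_lambda_of_real that by simp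
  have b1: "((\<lambda>x. ?b (x + c)) \<longlongrightarrow> 0) at_top" for c
    by (rule filterlim_compose[OF tendsto_binet]) real_asymp
  have b2: "((\<lambda>x. ?b (2 * x)) \<longlongrightarrow> 0) at_top"
    by (rule filterlim_compose[OF tendsto_binet]) real_asymp
  have "((\<lambda>x. of_real (ln_lambda_real (x + 1) - ln_lambda_real x) - ?b (x + 1) + ?b x) \<longlongrightarrow> of_real 0 - 0 + 0) at_top"
    by (intro tendsto_intros tendsto_ln_lambda_real_diff b1 tendsto_binet)
  moreover have "eventually (\<lambda>x. of_real (ln_lambda_real (x + 1) - ln_lambda_real x) - ?b (x + 1) + ?b x = a) at_top"
    using eventually_gt_at_top[of 0]
  proof eventually_elim
    case (elim x)
    have "of_real (ln_lambda_real (x + 1) - ln_lambda_real x) - ?b (x + 1) + ?b x = (?l (x + 1) - ?b (x + 1)) - (?l x - ?b x)"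
      by simp
    also have "\<dots> = a" using elim by (subst (1 2) l) (auto simp: algebra_simps)
    finally show ?case .
  qed
  ultimately have "((\<lambda>x::real. a) \<longlongrightarrow> 0) at_top"
    using Lim_transform_eventually by fastforce
  hence a: "a = 0" by (simp add: tendsto_const_iff)
  have "((\<lambda>x. of_real (ln_lambda_real x + ln_lambda_real (x + 1 / 2) - ln_lambda_real (2 * x)) - ?b x - ?b (x + 1 / 2) + ?b (2 * x))
      \<longlongrightarrow> of_real (ln (sqrt (2 * pi))) - 0 - 0 + 0) at_top"
    by (intro tendsto_intros tendsto_ln_lambda_real_dupl b1 b2 tendsto_binet)
  moreover have "eventually (\<lambda>x. of_real (ln_lambda_real x + ln_lambda_real (x + 1 / 2) - ln_lambda_real (2 * x)) - ?b x - ?b (x + 1 / 2) + ?b (2 * x) = b) at_top"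
    using eventually_gt_at_top[of 0]
  proof eventually_elim
    case (elim x)
    have "of_real (ln_lambda_real x + ln_lambda_real (x + 1 / 2) - ln_lambda_real (2 * x)) - ?b x - ?b (x + 1 / 2) + ?b (2 * x)
       = (?l x - ?b x) + (?l (x + 1 / 2) - ?b (x + 1 / 2)) - (?l (2 * x) - ?b (2 * x))"
      by simp
    also have "\<dots> = b" using elim a by (subst (1 2 3) l) auto
    finally show ?case .
  qed
  ultimately have "((\<lambda>x::real. b) \<longlongrightarrow> of_real (ln (sqrt (2 * pi)))) at_top"
    using Lim_transform_eventually by fastforce
  hence "b = of_real (ln (sqrt (2 * pi)))" by (simp add: tendsto_const_iff)
  with ab[OF z] a show ?thesis by (simp add: algebra_simps)
qed

theorem lambda_fun_eq_exp_binet: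
  assumes z: "Re z > 0"
  shows   "lambda_fun z = exp (binet z)"
proof -
  have nz: "z \<notin> \<real>\<^sub>\<le>\<^sub>0" "z \<notin> \<int>\<^sub>\<le>\<^sub>0" "z \<noteq> 0"
    using z by (auto simp: complex_nonpos_Reals_iff elim!: nonpos_Ints_cases)
  have "exp (ln_lambda z) = Gamma z * z powr (1 / 2 - z) * exp z"
    using nz by (simp add: ln_lambda_def exp_add Gamma_complex_altdef powr_def)
  moreover have "exp (ln_lambda z) = of_real (sqrt (2 * pi)) * exp (binet z)"
    unfolding ln_lambda_eq_binet[OF z] exp_add by (simp add: exp_of_real)
  ultimately have "of_real (sqrt (2 * pi)) * exp (binet z) = Gamma z * z powr (1 / 2 - z) * exp z"
    by simp
  moreover have "complex_of_real (sqrt (2 * pi)) \<noteq> 0" by simp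
  ultimately show ?thesis
    unfolding lambda_fun_def by (simp add: field_simps)
qed

subsection \<open>The Borel sum\<close>

definition lambda_minor :: "complex \<Rightarrow> complex" where
  "lambda_minor = conv_exp stirling_minor"

context
  fixes K :: real assumes K: "K > 0"
begin

lemma stirling_minor_sector:
  "stirling_minor holomorphic_on sector_dom K" "open (sector_dom K)" "starlike0 (sector_dom K)"
  "\<And>z. z \<in> sector_dom K \<Longrightarrow> norm (stirling_minor z) \<le> stirling_bound + K"
  using K by (auto intro: holomorphic_on_stirling_minor_sector open_sector_dom starlike0_sector_dom norm_stirling_minor_le)

lemma holomorphic_on_lambda_minor: "lambda_minor holomorphic_on sector_dom K"
  unfolding lambda_minor_def by (rule holomorphic_on_conv_exp[OF stirling_minor_sector])

lemma norm_lambda_minor_le: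
  "z \<in> sector_dom K \<Longrightarrow> norm (lambda_minor z) \<le> (stirling_bound + K) * exp ((stirling_bound + K) * norm z)"
  unfolding lambda_minor_def by (rule norm_conv_exp_le[OF stirling_minor_sector])

end

lemma has_fps_expansion_lambda_minor: "lambda_minor has_fps_expansion borel_minor lambda_series"
  unfolding lambda_minor_def lambda_series_def
  by (rule has_fps_expansion_conv_exp[OF stirling_minor_sector[of 1]])
     (auto simp: has_fps_expansion_stirling_minor sector_dom_def)

lemma laplace_lambda_minor:
  assumes z: "Re z > stirling_bound + 2"
  shows   "1 + laplace (\<lambda>x. lambda_minor (of_real x)) z = lambda_fun z"
proof -
  have "Re z > 0" using z stirling_bound_nonneg by linarith
  thus ?thesis
    using laplace_conv_exp[OF stirling_minor_sector[of 2] of_real_in_sector_dom z]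
    by (simp add: lambda_minor_def lambda_fun_eq_exp_binet binet_def)
qed

lemma cos_pos_of_abs_less: "\<bar>\<theta>\<bar> < pi / 2 \<Longrightarrow> cos \<theta> > 0"
  by (rule cos_gt_zero_pi) auto

text \<open>On the ray \<open>norm z = Re z / cos \<theta>\<close>, so every \<open>K\<close> above
  \<open>1 / cos \<theta>\<close> would be admissible; the factor \<open>2\<close> leaves a
  margin.\<close>

lemma ray_in_sector_dom:
  assumes "x > 0" "\<bar>\<theta>\<bar> < pi / 2"
  shows   "of_real x * cis \<theta> \<in> sector_dom (2 / cos \<theta>)"
  using assms cos_pos_of_abs_less[of \<theta>] by (simp add: sector_dom_def norm_mult)

section \<open>Rotation of the direction of integration\<close>

lemma contour_integral_ray:
  assumes g: "continuous_on (closed_segment 0 (of_real R * u)) g" and R: "R > 0"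
  shows   "contour_integral (linepath 0 (of_real R * u)) g = (LBINT x:{0<..<R}. g (of_real x * u) * u)"
proof -
  let ?h = "\<lambda>t. g (of_real (R * t) * u) * u"
  have seg: "of_real (R * t) * u \<in> closed_segment 0 (of_real R * u)" if "t \<in> {0..1}" for t
    using that by (auto simp: closed_segment_def scaleR_conv_of_real mult_ac)
  have c: "continuous_on {0..1} ?h"
    by (intro continuous_intros continuous_on_compose2[OF g]) (use seg in auto)
  have si: "set_integrable lborel {0..1} ?h"
    by (rule borel_integrable_atLeastAtMost') (rule c)
  have "integral {0..1} ?h = integral {0<..<1} ?h"
    using integral_open_interval_real[of 0 1 ?h] by simp
  also have "\<dots> = (LBINT t:{0<..<1}. ?h t)"
    by (rule set_borel_integral_eq_integral(2)[symmetric], rule set_integrable_subset[OF si]) auto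
  finally have 1: "integral {0..1} ?h = (LBINT t:{0<..<1}. ?h t)" .
  have "(LBINT x:{0<..<R}. g (of_real x * u) * u) = R *\<^sub>R (LINT t|lborel. indicator {0<..<R} (R * t) *\<^sub>R ?h t)"
    unfolding set_lebesgue_integral_def
    using lborel_integral_real_affine[of R "\<lambda>x. indicator {0<..<R} x *\<^sub>R (g (of_real x * u) * u)" 0] R
    by simp
  also have "(LINT t|lborel. indicator {0<..<R} (R * t) *\<^sub>R ?h t) = (LBINT t:{0<..<1}. ?h t)"
    unfolding set_lebesgue_integral_def using R
    by (intro Bochner_Integration.integral_cong) (auto simp: indicator_def zero_less_mult_iff)
  finally have 2: "(LBINT x:{0<..<R}. g (of_real x * u) * u) = of_real R * integral {0..1} ?h"
    unfolding 1 scaleR_conv_of_real .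
  have "contour_integral (linepath 0 (of_real R * u)) g = integral {0..1} (\<lambda>t. of_real R * ?h t)"
    unfolding contour_integral_integral
    by (intro integral_cong) (simp add: linepath_def scaleR_conv_of_real mult_ac)
  also have "\<dots> = of_real R * integral {0..1} ?h" by (rule integral_mult_right)
  finally show ?thesis unfolding 2 .
qed

lemma tendsto_ray_integral:
  assumes "set_integrable lborel {0<..} (h :: real \<Rightarrow> complex)"
  shows   "(\<lambda>n. LBINT x:{0<..<real (Suc n)}. h x) \<longlonglongrightarrow> (LBINT x:{0<..}. h x)"
proof -
  have U: "(\<Union>n. {0<..<real (Suc n)}) = {0<..}"
  proof (intro equalityI subsetI)
    fix x :: real assume "x \<in> {0<..}"
    moreover obtain n where "x < real n" using reals_Archimedean2 by blast
    ultimately show "x \<in> (\<Union>n. {0<..<real (Suc n)})" by (auto intro!: exI[of _ n])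
  qed auto
  have "(\<lambda>n. LBINT x:{0<..<real (Suc n)}. h x) \<longlonglongrightarrow> (LBINT x:(\<Union>n. {0<..<real (Suc n)}). h x)"
  proof (rule set_integral_cont_up)
    show "set_integrable lborel (\<Union>n. {0<..<real (Suc n)}) h" unfolding U by (rule assms)
  qed (auto simp: incseq_def)
  thus ?thesis unfolding U .
qed

text \<open>Cauchy's theorem for the triangle with vertices \<open>0\<close>, \<open>R\<close>, \<open>R e\<^sup>i\<^sup>\<theta>\<close>, with \<open>R \<rightarrow> \<infinity>\<close>.\<close>

lemma laplace_rotate:
  assumes th: "\<bar>\<theta>\<bar> < pi / 2" and K: "K = 2 / cos \<theta>"
  assumes F: "F holomorphic_on sector_dom K" "\<And>z. z \<in> sector_dom K \<Longrightarrow> norm (F z) \<le> A * exp (c * norm z)"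
  assumes c: "c \<ge> 0" and w: "Re w > c" "Re (w * cis \<theta>) > c"
  shows   "laplace (\<lambda>x. F (of_real x)) w = laplace (\<lambda>x. F (of_real x * cis \<theta>) * cis \<theta>) (w * cis \<theta>)"
proof -
  let ?u = "cis \<theta>"
  define g where "g = (\<lambda>z. exp (- w * z) * F z)"
  define m where "m = min (Re w) (Re (w * ?u))"
  have cos: "cos \<theta> > 0" using cos_pos_of_abs_less[OF th] .
  have A: "A \<ge> 0" 
    using F(2)[of 0] norm_ge_zero[of "F 0"] by (simp add: sector_dom_def del: norm_ge_zero)
  \<comment> \<open>The modulus is at most \<open>(s + t) * R\<close>, while the real part is at
    least \<open>(s + t) * R * cos \<theta>\<close>; the factor \<open>2\<close> in \<open>K\<close>
    makes the inequality strict. Hence the whole triangle lies in the domain.\<close>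
  have hull: "of_real s * of_real R + of_real t * (of_real R * ?u) \<in> sector_dom K"
    if "s \<ge> 0" "t \<ge> 0" "R > 0" for s t R :: real
  proof (cases "s + t = 0")
    case True
    hence "s = 0" "t = 0" using that by auto
    thus ?thesis by (simp add: sector_dom_def)
  next
    case False
    let ?z = "of_real s * of_real R + of_real t * (of_real R * ?u)"
    have "norm ?z \<le> s * R + t * R"
      using norm_triangle_ineq[of "of_real s * of_real R" "of_real t * (of_real R * ?u)"] that by (simp add: norm_mult)
    also have "\<dots> < 2 * (s + t) * R"
    proof -
      have "(s + t) * R > 0" using that False by (intro mult_pos_pos) auto
      thus ?thesis by (simp add: algebra_simps)
    qed
    also have "\<dots> \<le> K * Re ?z"
    proof -
      have "s * R * cos \<theta> \<le> s * R * 1" using that by (intro mult_left_mono) auto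
      hence "(s + t) * R * cos \<theta> \<le> Re ?z" by (simp add: algebra_simps)
      hence "K * ((s + t) * R * cos \<theta>) \<le> K * Re ?z" using cos K by (intro mult_left_mono) auto
      moreover have "K * ((s + t) * R * cos \<theta>) = 2 * (s + t) * R" using cos by (simp add: K)
      ultimately show ?thesis by linarith
    qed
    finally show ?thesis by (simp add: sector_dom_def)
  qed
  have sub: "convex hull {0, of_real R, of_real R * ?u} \<subseteq> sector_dom K" if R: "R > 0" for R
  proof
    fix z assume "z \<in> convex hull {0, of_real R, of_real R * ?u}"
    then obtain r s t where "r \<ge> 0" "s \<ge> 0" "t \<ge> 0" "z = r *\<^sub>R 0 + s *\<^sub>R of_real R + t *\<^sub>R (of_real R * ?u)"
      unfolding convex_hull_3 by blast
    thus "z \<in> sector_dom K" using hull[of s t R] R by (simp add: scaleR_conv_of_real)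
  qed
  have holg: "g holomorphic_on sector_dom K"
    unfolding g_def by (intro holomorphic_intros F)
  have contg: "continuous_on (closed_segment a b) g" if "a \<in> {0, of_real R, of_real R * ?u}" "b \<in> {0, of_real R, of_real R * ?u}" "R > 0" for a b R
    by (rule continuous_on_subset[OF holomorphic_on_imp_continuous_on[OF holg]])
       (use sub[OF that(3)] that(1,2) in \<open>auto simp: segment_convex_hull intro!: order_trans[OF hull_mono sub[OF that(3)]]\<close>)
  have eb: "exp_bounded (\<lambda>x. F (of_real x * v) * v) A c" if v: "v \<in> {1, ?u}" for v
  proof (rule exp_bounded_continuous)
    have mem: "of_real x * v \<in> sector_dom K" if "x > 0" for x
      using hull[of 1 0 x] hull[of 0 1 x] that v by auto
    show "continuous_on {0<..} (\<lambda>x. F (complex_of_real x * v) * v)"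
      by (intro continuous_intros continuous_on_compose2[OF holomorphic_on_imp_continuous_on[OF F(1)]])
         (use mem in auto)
    fix x :: real assume x: "x > 0"
    thus "norm (F (of_real x * v) * v) \<le> A * exp (c * x)"
      using F(2)[OF mem[OF x]] v by (auto simp: norm_mult)
  qed
  define I where "I = (\<lambda>v n. LBINT x:{0<..<real (Suc n)}. g (of_real x * v) * v)"
  have lim: "I v \<longlonglongrightarrow> laplace (\<lambda>x. F (of_real x * v) * v) (w * v)" if v: "v \<in> {1, ?u}" for v
  proof -
    have eq: "g (of_real x * v) * v = exp (- (w * v) * of_real x) * (F (of_real x * v) * v)" for x
      by (simp add: g_def mult_ac)
    have "Re (w * v) > c" using v w by auto
    from set_integrable_laplace[OF eb[OF v] this] show ?thesis
      unfolding I_def laplace_def eq by (rule tendsto_ray_integral)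
  qed
  \<comment> \<open>The difference is the integral over the third side. There
    \<open>Re (w * z) \<ge> m * R\<close>, since it interpolates linearly between the end points,
    and \<open>norm z \<le> R\<close>; the length is at most \<open>2 * R\<close>.\<close>
  have bd: "norm (I ?u n - I 1 n) \<le> A * exp (- ((m - c) * real (Suc n))) * (2 * real (Suc n))" for n
  proof -
    define R where "R = real (Suc n)"
    have R: "R > 0" by (simp add: R_def)
    have "(g has_contour_integral 0) (linepath 0 (of_real R) +++ linepath (of_real R) (of_real R * ?u) +++ linepath (of_real R * ?u) 0)"
      by (rule Cauchy_theorem_triangle) (rule holomorphic_on_subset[OF holg sub[OF R]])
    hence "contour_integral (linepath 0 (of_real R)) g + contour_integral (linepath (of_real R) (of_real R * ?u)) g
         + contour_integral (linepath (of_real R * ?u) 0) g = 0"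
      by (rule has_chain_integral_chain_integral3)
    moreover have "contour_integral (linepath (of_real R * ?u) 0) g = - contour_integral (linepath 0 (of_real R * ?u)) g"
      by (rule contour_integral_reverse_linepath) (use contg R in auto)
    moreover have "contour_integral (linepath 0 (of_real R * ?u)) g = I ?u n"
      unfolding I_def R_def[symmetric] by (rule contour_integral_ray) (use contg R in auto)
    moreover have "contour_integral (linepath 0 (of_real R)) g = I 1 n"
      using contour_integral_ray[of R 1 g] contg[of 0 R "of_real R"] R unfolding I_def R_def[symmetric] by simp
    ultimately have "I ?u n - I 1 n = contour_integral (linepath (of_real R) (of_real R * ?u)) g"
      by (simp add: algebra_simps)
    also have "norm \<dots> \<le> A * exp (- ((m - c) * R)) * norm (of_real R * ?u - of_real R)"
    proof (rule contour_integral_bound_linepath)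
      show "g contour_integrable_on linepath (of_real R) (of_real R * ?u)"
        by (rule contour_integrable_continuous_linepath) (use contg R in auto)
      fix z assume "z \<in> closed_segment (of_real R) (of_real R * ?u)"
      then obtain t where t: "0 \<le> t" "t \<le> 1" "z = (1 - t) *\<^sub>R of_real R + t *\<^sub>R (of_real R * ?u)"
        by (auto simp: closed_segment_def)
      have z: "z = of_real (1 - t) * of_real R + of_real t * (of_real R * ?u)"
        using t by (simp add: scaleR_conv_of_real)
      have zD: "z \<in> sector_dom K" unfolding z by (rule hull) (use t R in auto)
      have "norm z \<le> (1 - t) * R + t * R"
        using norm_triangle_ineq[of "of_real (1 - t) * of_real R" "of_real t * (of_real R * ?u)"] t R
        unfolding z by (simp add: norm_mult del: of_real_diff)
      hence nz: "norm z \<le> R" by (simp add: algebra_simps)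
      have "m * R = (1 - t) * R * m + t * R * m" by (simp add: algebra_simps)
      also have "\<dots> \<le> (1 - t) * R * Re w + t * R * Re (w * ?u)"
        using t R by (intro add_mono mult_left_mono) (auto simp: m_def)
      also have "\<dots> = Re (w * z)"
        unfolding z by (simp add: algebra_simps)
      finally have "m * R \<le> Re (w * z)" .
      hence "norm (g z) \<le> exp (- (m * R)) * (A * exp (c * R))"
        unfolding g_def norm_mult
        using F(2)[OF zD] nz c A
        by (intro mult_mono) (auto intro!: order_trans[OF F(2)[OF zD]] mult_left_mono)
      also have "\<dots> = A * exp (- ((m - c) * R))" by (simp add: algebra_simps flip: exp_add)
      finally show "norm (g z) \<le> A * exp (- ((m - c) * R))" .
    qed (use A in auto)
    also have "\<dots> \<le> A * exp (- ((m - c) * R)) * (2 * R)"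
    proof (intro mult_left_mono)
      have "norm (of_real R * ?u - of_real R) \<le> norm (of_real R * ?u) + norm (complex_of_real R)"
        by (rule norm_triangle_ineq4)
      thus "norm (of_real R * ?u - of_real R) \<le> 2 * R" using R by (simp add: norm_mult)
    qed (use A in auto)
    finally show ?thesis by (simp add: R_def)
  qed
  have mc: "m - c > 0" using w by (simp add: m_def)
  have "((\<lambda>n. A * exp (- ((m - c) * real (Suc n))) * (2 * real (Suc n))) \<longlonglongrightarrow> 0)"
    using mc by real_asymp
  hence "(\<lambda>n. I ?u n - I 1 n) \<longlonglongrightarrow> 0"
    by (intro Lim_null_comparison[OF always_eventually[OF allI[OF bd]]])
  moreover have "(\<lambda>n. I ?u n - I 1 n) \<longlonglongrightarrow> laplace (\<lambda>x. F (of_real x * ?u) * ?u) (w * ?u) - laplace (\<lambda>x. F (of_real x * 1) * 1) (w * 1)"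
    by (intro tendsto_diff lim) auto
  ultimately show ?thesis using LIMSEQ_unique by fastforce
qed

lemma open_sector_right: "open_sector {-pi/2<..<pi/2} = {z. Re z > 0}"
proof (intro equalityI subsetI)
  fix z assume "z \<in> open_sector {-pi/2<..<pi/2}"
  thus "z \<in> {z. Re z > 0}"
    by (auto simp: open_sector_def intro!: mult_pos_pos cos_gt_zero_pi)
next
  fix z assume z: "z \<in> {z. Re z > 0}"
  hence "z \<noteq> 0" by auto
  hence "\<bar>Arg z\<bar> < pi / 2" using z Re_Ln_pos_lt[of z] by (simp add: Arg_eq_Im_Ln)
  moreover have "z = of_real (norm z) * cis (Arg z)" using rcis_cmod_Arg[of z] by (simp add: rcis_def)
  moreover have "norm z > 0" using z by auto
  ultimately show "z \<in> open_sector {-pi/2<..<pi/2}"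
    unfolding open_sector_def by (intro CollectI exI[of _ "norm z"] exI[of _ "Arg z"]) auto
qed

lemma lambda_minor_analytic: "lambda_minor analytic_on {z. Re z > 0}"
proof -
  have "lambda_minor analytic_on {z}" if z: "Re z > 0" for z
  proof -
    \<comment> \<open>Any \<open>K\<close> above \<open>norm z / Re z\<close> puts \<open>z\<close>
      into the cone, so the cones exhaust the half-plane.\<close>
    define K where "K = norm z / Re z + 1"
    have K: "K > 0" "z \<in> sector_dom K"
      using z by (auto simp: K_def sector_dom_def field_simps add_nonneg_pos add_pos_nonneg)
    have "lambda_minor analytic_on sector_dom K"
      using holomorphic_on_lambda_minor[OF K(1)] open_sector_dom by (simp add: analytic_on_open)
    thus ?thesis using K(2) analytic_on_subset by blast
  qed
  thus ?thesis using analytic_on_analytic_at by blast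
qed

lemma locally_bounded_on_continuous:
  assumes "open I" "continuous_on I f"
  shows   "locally_bounded_on I f"
  unfolding locally_bounded_on_def
proof
  fix x assume "x \<in> I"
  then obtain e where e: "e > 0" "cball x e \<subseteq> I"
    using assms(1) open_contains_cball by blast
  have "compact (f ` cball x e)"
    using e assms by (intro compact_continuous_image continuous_on_subset[OF assms(2)]) auto
  hence "bounded (f ` (I \<inter> ball x e))"
    by (rule bounded_subset[OF compact_imp_bounded]) auto
  thus "\<exists>e>0. bounded (f ` (I \<inter> ball x e))" using e by blast
qed

text \<open>Each direction uses the bound of its own sector
  \<open>sector_dom (2 / cos \<theta>)\<close>. The resulting type is unbounded towards the ends of
  the interval but continuous inside, hence locally bounded.\<close>

lemma one_summable_with_lambda_minor:
  "one_summable_with {-pi/2<..<pi/2} lambda_series lambda_minor (\<lambda>\<theta>. stirling_bound + 2 / cos \<theta>)"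
proof -
  let ?I = "{-pi/2<..<pi/2}" and ?A = "\<lambda>\<theta>. stirling_bound + 2 / cos \<theta>"
  have cos: "cos \<theta> > 0" if "\<theta> \<in> ?I" for \<theta> using that by (intro cos_gt_zero_pi) auto
  have lb: "locally_bounded_on ?I ?A"
    by (intro locally_bounded_on_continuous continuous_intros) (use cos in \<open>force+\<close>)
  moreover have "?A \<theta> \<ge> 0" if "\<theta> \<in> ?I" for \<theta>
    using cos[OF that] stirling_bound_nonneg by simp
  moreover have "norm (lambda_minor (of_real \<xi> * cis \<theta>)) \<le> ?A \<theta> * exp (?A \<theta> * \<xi>)" if "\<theta> \<in> ?I" "\<xi> > 0" for \<theta> \<xi>
  proof -
    have "\<bar>\<theta>\<bar> < pi / 2" using that(1) by auto
    from norm_lambda_minor_le[OF _ ray_in_sector_dom[OF that(2) this]] show ?thesis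
      using cos[OF that(1)] that(2) by (simp add: norm_mult)
  qed
  ultimately show ?thesis
    unfolding one_summable_with_def open_sector_right
    using has_fps_expansion_lambda_minor lambda_minor_analytic by blast
qed

text \<open>A common Taylor series gives equality near \<open>0\<close>, and the identity theorem
  carries it through the half-plane. Thus statements about an arbitrary admissible \<open>F\<close>
  reduce to \<open>lambda_minor\<close>.\<close>

lemma one_summable_with_unique:
  assumes "one_summable_with {-pi/2<..<pi/2} \<phi> F c" "one_summable_with {-pi/2<..<pi/2} \<phi> G d" "Re z > 0"
  shows   "F z = G z"
proof -
  have "eventually (\<lambda>z. eval_fps (borel_minor \<phi>) z = F z) (nhds 0)" "eventually (\<lambda>z. eval_fps (borel_minor \<phi>) z = G z) (nhds 0)"
    using assms by (auto simp: one_summable_with_def has_fps_expansion_def)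
  hence "eventually (\<lambda>z. F z = G z) (nhds 0)" by eventually_elim simp
  then obtain e where e: "e > 0" "\<And>z. z \<in> ball 0 e \<Longrightarrow> F z = G z"
    by (auto simp: eventually_nhds_metric dist_commute)
  have hol: "F holomorphic_on {z. Re z > 0}" "G holomorphic_on {z. Re z > 0}"
    using assms unfolding one_summable_with_def open_sector_right by (auto intro: analytic_imp_holomorphic)
  show ?thesis
  proof (rule analytic_continuation_open[of "ball 0 e \<inter> {z. Re z > 0}" "{z. Re z > 0}" F G z])
    have "of_real (e / 2) \<in> ball 0 e \<inter> {z. Re z > 0}" using e by simp
    thus "ball 0 e \<inter> {z. Re z > 0} \<noteq> {}" by blast
    show "connected {z. 0 < Re z}" by (intro convex_connected convex_halfspace_Re_gt)
  qed (use e hol assms(3) in \<open>auto simp: open_halfspace_Re_gt\<close>)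
qed

lemma laplace_integrand_eq:
  "laplace_integrand \<theta> F z \<xi> = exp (- (z * cis \<theta>) * of_real \<xi>) * (F (of_real \<xi> * cis \<theta>) * cis \<theta>)"
  by (simp add: laplace_integrand_def mult_ac)

section \<open>Directional Laplace integrals and the values of the function\<close>

lemma holomorphic_on_lambda_fun: "lambda_fun holomorphic_on - \<real>\<^sub>\<le>\<^sub>0"
proof -
  have "z \<notin> \<int>\<^sub>\<le>\<^sub>0" if "z \<notin> \<real>\<^sub>\<le>\<^sub>0" for z :: complex
    using that by (auto elim!: nonpos_Ints_cases simp: complex_nonpos_Reals_iff)
  thus ?thesis unfolding lambda_fun_def
    by (intro holomorphic_intros) auto
qed

lemma Re_mult_cis_pos_imp:
  assumes "\<bar>\<theta>\<bar> < pi / 2" "Re (z * cis \<theta>) > 0"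
  shows   "z \<notin> \<real>\<^sub>\<le>\<^sub>0"
proof
  assume "z \<in> \<real>\<^sub>\<le>\<^sub>0"
  hence "Re z \<le> 0" "Im z = 0" by (auto simp: complex_nonpos_Reals_iff)
  moreover have "cos \<theta> > 0" using cos_pos_of_abs_less[OF assms(1)] .
  ultimately have "Re (z * cis \<theta>) \<le> 0" by (simp add: mult_nonpos_nonneg)
  thus False using assms by simp
qed

lemma halfplane_rotated:
  "open {z. Re (z * cis \<theta>) > c}" "convex {z. Re (z * cis \<theta>) > c}"
proof -
  have "{z. Re (z * cis \<theta>) > c} = {z. inner (cis (- \<theta>)) z > c}"
    by (simp add: inner_complex_def algebra_simps)
  thus "open {z. Re (z * cis \<theta>) > c}" "convex {z. Re (z * cis \<theta>) > c}"
    by (simp_all add: open_halfspace_gt convex_halfspace_gt)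
qed

text \<open>Rotation from the positive axis works on \<open>U\<close>, where both real parts are
  large, and the identity theorem extends the result to \<open>H\<close>. The pair \<open>A\<close>,
  \<open>c\<close> is arbitrary because it comes from an arbitrary admissible growth bound;
  positivity of \<open>Re (z * cis \<theta>)\<close> keeps \<open>z\<close> off the cut.\<close>

lemma lambda_fun_eq_directional_laplace:
  assumes th: "\<bar>\<theta>\<bar> < pi / 2" and f: "exp_bounded (\<lambda>x. lambda_minor (of_real x * cis \<theta>) * cis \<theta>) A c"
  assumes z: "Re (z * cis \<theta>) > c" "Re (z * cis \<theta>) > 0"
  shows   "lambda_fun z = 1 + laplace (\<lambda>x. lambda_minor (of_real x * cis \<theta>) * cis \<theta>) (z * cis \<theta>)"
proof -
  let ?f = "\<lambda>x. lambda_minor (of_real x * cis \<theta>) * cis \<theta>"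
  define d where "d = stirling_bound + 2 / cos \<theta>"
  have cos: "cos \<theta> > 0" using cos_pos_of_abs_less[OF th] .
  have d: "d \<ge> 0" "d \<ge> stirling_bound + 2" using cos stirling_bound_nonneg by (auto simp: d_def field_simps)
  define H where "H = {z. Re (z * cis \<theta>) > max c 0}"
  define U where "U = {z. Re (z * cis \<theta>) > max c d} \<inter> {z. Re z > d}"
  show ?thesis
  proof (rule analytic_continuation_open[of U H lambda_fun])
    show "open U" unfolding U_def by (intro open_Int halfplane_rotated open_halfspace_Re_gt)
    show "open H" "connected H" unfolding H_def by (intro convex_connected halfplane_rotated)+
    show "U \<noteq> {}"
    proof -
      \<comment> \<open>The witness has argument \<open>- \<theta> / 2\<close>, halfway between the
        two directions: it and its rotation by \<open>\<theta>\<close> have the same real part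
        \<open>r * cos (\<theta> / 2)\<close>.\<close>
      define r where "r = (max c d + 1) / cos (\<theta> / 2)"
      have c2: "cos (\<theta> / 2) > 0" using th by (intro cos_gt_zero_pi) auto
      have "of_real r * cis (- (\<theta> / 2)) * cis \<theta> = of_real r * cis (\<theta> / 2)"
        by (simp only: mult.assoc cis_mult) simp
      hence "Re (of_real r * cis (- (\<theta> / 2)) * cis \<theta>) = Re (of_real r * cis (\<theta> / 2))"
        by (simp only:)
      also have "\<dots> = max c d + 1" using c2 by (simp add: r_def)
      finally have "Re (of_real r * cis (- (\<theta> / 2)) * cis \<theta>) = max c d + 1" .
      moreover have "Re (of_real r * cis (- (\<theta> / 2))) = max c d + 1"
        using c2 by (simp add: r_def)
      ultimately have "of_real r * cis (- (\<theta> / 2)) \<in> U"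
        unfolding U_def Int_iff mem_Collect_eq by (simp only:) auto
      thus ?thesis by blast
    qed
    show "U \<subseteq> H" using d by (auto simp: U_def H_def)
    show "lambda_fun holomorphic_on H"
      by (rule holomorphic_on_subset[OF holomorphic_on_lambda_fun])
         (use Re_mult_cis_pos_imp[OF th] in \<open>auto simp: H_def\<close>)
    have "(laplace ?f \<circ> (\<lambda>z. z * cis \<theta>)) holomorphic_on H"
      by (rule holomorphic_on_compose_gen[OF _ holomorphic_on_laplace[OF f]])
         (auto simp: H_def intro!: holomorphic_intros)
    thus "(\<lambda>z. 1 + laplace ?f (z * cis \<theta>)) holomorphic_on H"
      by (intro holomorphic_intros) (simp add: o_def)
    fix w assume w: "w \<in> U"
    have "laplace (\<lambda>x. lambda_minor (of_real x)) w = laplace ?f (w * cis \<theta>)"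
    proof (rule laplace_rotate[OF th refl])
      show "lambda_minor holomorphic_on sector_dom (2 / cos \<theta>)"
        using cos by (intro holomorphic_on_lambda_minor) auto
      show "norm (lambda_minor z) \<le> d * exp (d * norm z)" if "z \<in> sector_dom (2 / cos \<theta>)" for z
        using norm_lambda_minor_le[OF _ that] cos by (simp add: d_def)
    qed (use w d in \<open>auto simp: U_def\<close>)
    moreover have "1 + laplace (\<lambda>x. lambda_minor (of_real x)) w = lambda_fun w"
      by (rule laplace_lambda_minor) (use w d in \<open>auto simp: U_def\<close>)
    ultimately show "lambda_fun w = 1 + laplace ?f (w * cis \<theta>)" by simp
  qed (use z in \<open>auto simp: H_def\<close>)
qed

text \<open>
  The function behaves like \<open>z\<^sup>-\<^sup>1\<^sup>/\<^sup>2\<close> at \<open>0\<close>, so no exponential type of \<open>lambda_minor\<close> is negative.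
\<close>

lemma exp_type_lambda_minor_nonneg:
  assumes th: "\<bar>\<theta>\<bar> < pi / 2" and f: "exp_bounded (\<lambda>x. lambda_minor (of_real x * cis \<theta>) * cis \<theta>) A c"
  shows   "c \<ge> 0"
proof (rule ccontr)
  assume "\<not> c \<ge> 0"
  hence c: "c < 0" by simp
  let ?f = "\<lambda>x. lambda_minor (of_real x * cis \<theta>) * cis \<theta>"
  \<comment> \<open>The point tends to \<open>0\<close> along the ray on which
    \<open>z * cis \<theta>\<close> is the positive number \<open>t\<close>, so the Laplace formula
    is available all the way.\<close>
  let ?z = "\<lambda>t. of_real t * cis (- \<theta>)"
  let ?F = "at_right (0::real)"
  have zt: "?z t * cis \<theta> = of_real t" for t
    by (simp add: cis_mult mult.assoc)
  have z0: "(?z \<longlongrightarrow> 0) ?F" by (auto intro!: tendsto_eq_intros)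
  have "isCont (laplace ?f) 0"
    using has_field_derivative_laplace[OF f, of 0] c by (auto intro: DERIV_isCont)
  moreover have "((\<lambda>t. complex_of_real t) \<longlongrightarrow> 0) ?F" by (auto intro!: tendsto_eq_intros)
  ultimately have L: "((\<lambda>t. 1 + laplace ?f (of_real t)) \<longlongrightarrow> 1 + laplace ?f 0) ?F"
    by (intro tendsto_intros isCont_tendsto_compose[of 0 "laplace ?f"])
  \<comment> \<open>This factor turns \<open>lambda_fun z\<close> into
    \<open>exp z * Gamma (z + 1) / sqrt (2 * pi)\<close>, which has a nonzero limit at
    \<open>0\<close>. A negative type would make the Laplace transform continuous at
    \<open>0\<close>, and the product with a factor tending to \<open>0\<close> would vanish in the
    limit.\<close>
  have P: "((\<lambda>t. ?z t powr (1 / 2 + ?z t)) \<longlongrightarrow> 0) ?F"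
  proof (rule Lim_null_comparison)
    show "eventually (\<lambda>t. norm (?z t powr (1 / 2 + ?z t)) \<le> exp (ln t / 2 + t * (\<bar>sin \<theta>\<bar> * \<bar>\<theta>\<bar>))) ?F"
      using eventually_at_right_real[of 0 1, simplified]
    proof eventually_elim
      case (elim t)
      have t: "0 < t" "t < 1" using elim by auto
      have Ln: "Ln (?z t) = of_real (ln t) - \<i> * of_real \<theta>"
      proof (rule Ln_unique)
        show "exp (of_real (ln t) - \<i> * of_real \<theta>) = ?z t"
          using t by (simp add: exp_diff exp_of_real cis_conv_exp exp_minus divide_inverse)
      qed (use th in auto)
      have "Re ((1 / 2 + ?z t) * Ln (?z t)) = (1 / 2 + t * cos \<theta>) * ln t - t * (sin \<theta> * \<theta>)"
        unfolding Ln by (simp add: algebra_simps)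
      also have "\<dots> \<le> (1 / 2) * ln t + t * (\<bar>sin \<theta>\<bar> * \<bar>\<theta>\<bar>)"
      proof -
        have "t * cos \<theta> * ln t \<le> 0"
          using t cos_pos_of_abs_less[OF th] by (intro mult_nonneg_nonpos) auto
        moreover have "t * (- (sin \<theta> * \<theta>)) \<le> t * (\<bar>sin \<theta>\<bar> * \<bar>\<theta>\<bar>)"
          using t abs_ge_minus_self[of "sin \<theta> * \<theta>"] by (intro mult_left_mono) (auto simp: abs_mult)
        ultimately show ?thesis by (simp add: algebra_simps)
      qed
      finally show ?case using t by (simp add: powr_def)
    qed
    show "((\<lambda>t. exp (ln t / 2 + t * (\<bar>sin \<theta>\<bar> * \<bar>\<theta>\<bar>))) \<longlongrightarrow> 0) ?F"
      by real_asymp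
  qed
  have "((\<lambda>t. 1 / of_real (sqrt (2 * pi)) * exp (?z t) * Gamma (?z t + 1)) \<longlongrightarrow> 1 / of_real (sqrt (2 * pi)) * exp 0 * Gamma (0 + 1)) ?F"
    by (intro tendsto_intros z0) (auto elim!: nonpos_Ints_cases)
  moreover have "eventually (\<lambda>t. 1 / of_real (sqrt (2 * pi)) * exp (?z t) * Gamma (?z t + 1) =
      (1 + laplace ?f (of_real t)) * ?z t powr (1 / 2 + ?z t)) ?F"
    using eventually_at_right_less[of 0]
  proof eventually_elim
    case (elim t)
    have nz: "?z t \<notin> \<real>\<^sub>\<le>\<^sub>0" using elim by (intro Re_mult_cis_pos_imp[OF th]) (simp add: zt)
    have nz': "?z t \<notin> \<int>\<^sub>\<le>\<^sub>0" "?z t \<noteq> 0" using nz nonpos_Ints_subset_nonpos_Reals by auto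
    have "lambda_fun (?z t) = 1 + laplace ?f (?z t * cis \<theta>)"
      by (rule lambda_fun_eq_directional_laplace[OF th f]) (use elim c in \<open>auto simp: zt\<close>)
    hence l: "1 + laplace ?f (of_real t) = lambda_fun (?z t)" by (simp add: zt)
    have "?z t powr (1 / 2 - ?z t) * ?z t powr (1 / 2 + ?z t) = ?z t"
      using nz'(2) by (simp add: powr_add[symmetric] del: powr_add)
    hence "lambda_fun (?z t) * ?z t powr (1 / 2 + ?z t) = 1 / of_real (sqrt (2 * pi)) * exp (?z t) * (?z t * Gamma (?z t))"
      unfolding lambda_fun_def by (simp only: mult_ac)
    thus ?case unfolding l using Gamma_plus1[OF nz'(1)] by simp
  qed
  ultimately have "((\<lambda>t. (1 + laplace ?f (of_real t)) * ?z t powr (1 / 2 + ?z t)) \<longlongrightarrow> 1 / of_real (sqrt (2 * pi))) ?F"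
    using Lim_transform_eventually by fastforce
  moreover have "((\<lambda>t. (1 + laplace ?f (of_real t)) * ?z t powr (1 / 2 + ?z t)) \<longlongrightarrow> (1 + laplace ?f 0) * 0) ?F"
    by (intro tendsto_mult L P)
  ultimately have "1 / complex_of_real (sqrt (2 * pi)) = 0"
    using tendsto_unique[of ?F] by fastforce
  thus False by simp
qed

theorem has_borel_sum_lambda: "has_borel_sum {-pi/2<..<pi/2} lambda_series lambda_fun"
  unfolding has_borel_sum_def
proof (intro conjI allI impI ballI)
  show "one_summable {-pi/2<..<pi/2} lambda_series"
    using one_summable_with_lambda_minor unfolding one_summable_def by blast
next
  fix F c \<theta> z
  assume F: "one_summable_with {-pi/2<..<pi/2} lambda_series F c" and th': "\<theta> \<in> {-pi/2<..<pi/2}"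
    and z: "Re (z * cis \<theta>) > c \<theta>"
  have th: "\<bar>\<theta>\<bar> < pi / 2" using th' by (auto simp: abs_less_iff)
  let ?f = "\<lambda>x. lambda_minor (of_real x * cis \<theta>) * cis \<theta>"
  have Re: "Re (of_real x * cis \<theta>) > 0" if "x > 0" for x
    using cos_pos_of_abs_less[OF th] that by simp
  have eq: "F (of_real x * cis \<theta>) = lambda_minor (of_real x * cis \<theta>)" if "x > 0" for x
    using one_summable_with_unique[OF F one_summable_with_lambda_minor Re[OF that]] .
  from F th' obtain A where A: "\<And>x. x > 0 \<Longrightarrow> norm (F (of_real x * cis \<theta>)) \<le> A * exp (c \<theta> * x)"
    unfolding one_summable_with_def by blast
  have f: "exp_bounded ?f A (c \<theta>)"
  proof (rule exp_bounded_continuous)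
    show "continuous_on {0<..} ?f"
      by (intro continuous_intros continuous_on_compose2[OF holomorphic_on_imp_continuous_on[OF analytic_imp_holomorphic[OF lambda_minor_analytic]]])
         (use Re in auto)
    fix x :: real assume "x > 0"
    thus "norm (?f x) \<le> A * exp (c \<theta> * x)"
      using A[of x] eq[of x] by (simp add: norm_mult)
  qed
  \<comment> \<open>This turns \<open>Re (z * cis \<theta>) > c \<theta>\<close> into the positivity
    required by the directional formula.\<close>
  have "c \<theta> \<ge> 0" by (rule exp_type_lambda_minor_nonneg[OF th f])
  hence val: "lambda_fun z = 1 + laplace ?f (z * cis \<theta>)"
    using z by (intro lambda_fun_eq_directional_laplace[OF th f]) auto
  have ig: "laplace_integrand \<theta> F z x = exp (- (z * cis \<theta>) * of_real x) * ?f x" if "x \<in> {0<..}" for x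
    using eq[of x] that by (simp add: laplace_integrand_eq)
  show "set_integrable lborel {0<..} (laplace_integrand \<theta> F z)"
    using set_integrable_laplace[OF f z] ig by (subst set_integrable_cong[OF refl refl ig]) auto
  have "(LBINT x:{0<..}. laplace_integrand \<theta> F z x) = laplace ?f (z * cis \<theta>)"
    unfolding laplace_def by (rule set_lebesgue_integral_cong) (use ig in auto)
  thus "lambda_fun z = fps_nth lambda_series 0 + (LBINT x:{0<..}. laplace_integrand \<theta> F z x)"
    using val by simp
qed

subsection \<open>Gevrey estimates\<close>

lemma
  assumes a: "a > 0"
  shows integrable_power_exp: "set_integrable lborel {0<..} (\<lambda>x::real. x ^ m * exp (- (a * x)))"
    and integral_power_exp: "(LBINT x:{0<..}. x ^ m * exp (- (a * x))) = fact m / a ^ Suc m"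
proof -
  define d where "d = a / (2 * real (Suc m))"
  have d: "d > 0" using a by (simp add: d_def)
  have md: "real m * d < Re (of_real a)" using a by (simp add: d_def field_simps add_nonneg_pos)
  have eq: "exp (- complex_of_real a * of_real x) * of_real x ^ m = of_real (x ^ m * exp (- (a * x)))" for x
    by (simp add: mult_ac flip: exp_of_real)
  have 1: "complex_set_integrable lborel {0<..} (\<lambda>x. of_real (x ^ m * exp (- (a * x))))"
    using set_integrable_laplace[OF exp_bounded_power[OF d] md] unfolding eq .
  hence "set_integrable lborel {0<..} (\<lambda>x. Re (of_real (x ^ m * exp (- (a * x)))))"
    unfolding set_integrable_def using integrable_Re[OF 1[unfolded set_integrable_def]] by simp
  thus "set_integrable lborel {0<..} (\<lambda>x::real. x ^ m * exp (- (a * x)))"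
    by simp
  have "complex_of_real (LBINT x:{0<..}. x ^ m * exp (- (a * x))) = laplace (\<lambda>x. of_real x ^ m) (of_real a)"
    unfolding laplace_def eq by (rule set_integral_complex_of_real[symmetric])
  also have "\<dots> = of_real (fact m / a ^ Suc m)"
    using a by (subst laplace_power) auto
  finally show "(LBINT x:{0<..}. x ^ m * exp (- (a * x))) = fact m / a ^ Suc m"
    by (simp only: of_real_eq_iff)
qed

text \<open>The crude bound with \<open>B\<close> and \<open>d\<close> secures integrability, the
  bound with \<open>x ^ m\<close> gives the size. The integral of
  \<open>x ^ m * exp (- (a * x))\<close> is the source of the factorial in the Gevrey
  estimates.\<close>

lemma norm_laplace_le_power:
  assumes f: "exp_bounded f B d" and zd: "Re z > d"
  assumes le: "\<And>x. x > 0 \<Longrightarrow> norm (f x) \<le> A * x ^ m * exp (c * x)" and z: "Re z > c"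
  shows   "norm (laplace f z) \<le> A * fact m / (Re z - c) ^ Suc m"
proof -
  have int2: "set_integrable lborel {0<..} (\<lambda>x. exp (-z * of_real x) * f x)"
    by (rule set_integrable_laplace[OF f zd])
  have int: "set_integrable lborel {0<..} (\<lambda>x. A * (x ^ m * exp (- ((Re z - c) * x))))"
    using z by (intro set_integrable_mult_right integrable_power_exp) auto
  have le': "norm (exp (-z * of_real x) * f x) \<le> A * (x ^ m * exp (- ((Re z - c) * x)))" if "x > 0" for x
  proof -
    have "norm (exp (-z * of_real x) * f x) \<le> exp (- Re z * x) * (A * x ^ m * exp (c * x))"
      using le[OF that] by (simp add: norm_mult)
    also have "\<dots> = A * (x ^ m * exp (- ((Re z - c) * x)))"
      by (simp add: algebra_simps flip: exp_add)
    finally show ?thesis .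
  qed
  have "norm (laplace f z) \<le> (LBINT x:{0<..}. norm (exp (-z * of_real x) * f x))"
    unfolding laplace_def using int2 set_integral_norm_bound by blast
  also have "\<dots> \<le> (LBINT x:{0<..}. A * (x ^ m * exp (- ((Re z - c) * x))))"
    by (rule set_integral_mono[OF set_integrable_norm[OF int2] int]) (use le' in auto)
  also have "\<dots> = A * (fact m / (Re z - c) ^ Suc m)"
    using z by (simp only: set_integral_mult_right integral_power_exp)
  finally show ?thesis by simp
qed

text \<open>Since \<open>y \<ge> 1\<close>, the powers \<open>y ^ n\<close> are replaced by
  \<open>y ^ N\<close> and only a geometric series of ratio \<open>1 / 2\<close> remains. Doubling a
  constant in advance is the price for bounding partial sums by their last power.\<close>

lemma sum_half_powers_le:
  fixes y :: real
  assumes "y \<ge> 1"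
  shows   "(\<Sum>n<N. (y / 2) ^ n) \<le> 2 * y ^ N"
proof -
  have "(\<Sum>n<N. (y / 2) ^ n) \<le> (\<Sum>n<N. y ^ N * (1 / 2) ^ n)"
    using assms by (intro sum_mono) (auto simp: power_divide intro!: divide_right_mono power_increasing)
  also have "\<dots> = y ^ N * (\<Sum>n<N. (1 / 2) ^ n)" by (simp add: sum_distrib_left)
  also have "\<dots> \<le> y ^ N * 2"
  proof (rule mult_left_mono)
    have "(\<Sum>n<N. (1 / 2 :: real) ^ n) \<le> (\<Sum>n. (1 / 2) ^ n)"
      by (intro sum_le_suminf summable_geometric) auto
    also have "\<dots> = 2" by (subst suminf_geometric) auto
    finally show "(\<Sum>n<N. (1 / 2 :: real) ^ n) \<le> 2" .
  qed (use assms in auto)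
  finally show ?thesis by (simp add: mult.commute)
qed

text \<open>Boundedness of the terms at \<open>r / 2\<close> gives \<open>B = 2 / r\<close>. The
  condition \<open>2 * B * norm z \<le> 1\<close> then keeps \<open>z\<close> inside the disc of
  convergence and makes the majorant geometric of ratio at most \<open>1 / 2\<close>.\<close>

lemma lambda_minor_local_bound:
  obtains A B where "A > 0" "B > 0" "\<And>n. norm (fps_nth (borel_minor lambda_series) n) \<le> A * B ^ n"
    "\<And>z. 2 * B * norm z \<le> 1 \<Longrightarrow> (\<lambda>n. fps_nth (borel_minor lambda_series) n * z ^ n) sums lambda_minor z"
proof -
  let ?a = "fps_nth (borel_minor lambda_series)"
  obtain r where r: "r > 0"
    "\<And>z. norm z < r \<Longrightarrow> (\<lambda>n. ?a n * z ^ n) sums lambda_minor z"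
    "\<And>z. norm z < r \<Longrightarrow> summable (\<lambda>n. norm (?a n * z ^ n))"
    using has_fps_expansion_imp_abs_sums[OF has_fps_expansion_lambda_minor] by metis
  have "norm (complex_of_real (r / 2)) < r" using r(1) by simp
  from summable_imp_bounded[OF r(3)[OF this]]
  obtain A where A: "\<And>n. norm (norm (?a n * of_real (r / 2) ^ n)) \<le> A"
    unfolding bounded_iff by blast
  have A0: "A \<ge> 0" using A[of 0] norm_ge_zero order_trans by blast
  show ?thesis
  proof (rule that[of "A + 1" "2 / r"])
    fix n
    have "norm (?a n) * (r / 2) ^ n \<le> A + 1"
      using A[of n] r(1) by (simp add: norm_mult norm_power)
    thus "norm (?a n) \<le> (A + 1) * (2 / r) ^ n"
      using r(1) by (simp add: power_divide field_simps)
  next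
    fix z :: complex assume "2 * (2 / r) * norm z \<le> 1"
    hence "norm z < r" using r(1) by (simp add: field_simps) 
    thus "(\<lambda>n. ?a n * z ^ n) sums lambda_minor z" by (rule r(2))
  qed (use A0 r(1) in auto)
qed

text \<open>Near \<open>0\<close> the remainder is a geometrically bounded tail. Elsewhere
  \<open>2 * B * norm z > 1\<close>, so its \<open>m\<close>-th power absorbs both the global
  exponential bound on \<open>lambda_minor\<close> and the partial sum; no cancellation between the
  two is used.\<close>

lemma lambda_minor_remainder_bound:
  assumes AB: "A > 0" "B > 0" "\<And>n. norm (fps_nth (borel_minor lambda_series) n) \<le> A * B ^ n"
    "\<And>z. 2 * B * norm z \<le> 1 \<Longrightarrow> (\<lambda>n. fps_nth (borel_minor lambda_series) n * z ^ n) sums lambda_minor z"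
  assumes K: "K > 0" and z: "z \<in> sector_dom K"
  defines "C \<equiv> stirling_bound + K"
  shows "norm (lambda_minor z - (\<Sum>n<m. fps_nth (borel_minor lambda_series) n * z ^ n))
           \<le> (C + 2 * A) * (2 * B * norm z) ^ m * exp (C * norm z)"
proof -
  let ?a = "fps_nth (borel_minor lambda_series)"
  have C: "C \<ge> 0" using K stirling_bound_nonneg by (simp add: C_def)
  have e: "exp (C * norm z) \<ge> 1" using C by simp
  have an: "norm (?a n * z ^ n) \<le> A * (B * norm z) ^ n" for n
    using mult_right_mono[OF AB(3)[of n], of "norm z ^ n"] by (simp add: norm_mult norm_power power_mult_distrib mult_ac)
  show ?thesis
  proof (cases "2 * B * norm z \<le> 1")
    case True
    have s: "(\<lambda>n. ?a n * z ^ n) sums lambda_minor z" by (rule AB(4)[OF True])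
    have g: "(\<lambda>n. A * (B * norm z) ^ m * (1 / 2) ^ n) sums (A * (B * norm z) ^ m * 2)"
      using geometric_sums[of "1 / 2 :: real"] by (intro sums_mult) simp
    have "lambda_minor z - (\<Sum>n<m. ?a n * z ^ n) = (\<Sum>n. ?a (n + m) * z ^ (n + m))"
      using suminf_minus_initial_segment[of "\<lambda>n. ?a n * z ^ n" m] s by (simp add: sums_iff)
    also have "norm \<dots> \<le> (\<Sum>n. A * (B * norm z) ^ m * (1 / 2) ^ n)"
    proof (rule norm_suminf_le)
      fix n
      have "norm (?a (n + m) * z ^ (n + m)) \<le> A * (B * norm z) ^ (n + m)" by (rule an)
      also have "\<dots> = A * (B * norm z) ^ m * (B * norm z) ^ n" by (simp add: power_add mult_ac)
      also have "\<dots> \<le> A * (B * norm z) ^ m * (1 / 2) ^ n"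
        using True AB(1,2) by (intro mult_left_mono power_mono) auto
      finally show "norm (?a (n + m) * z ^ (n + m)) \<le> A * (B * norm z) ^ m * (1 / 2) ^ n" .
    qed (use g in \<open>auto simp: sums_iff\<close>)
    also have "\<dots> = 2 * A * (B * norm z) ^ m" using g by (simp add: sums_iff)
    also have "\<dots> \<le> (C + 2 * A) * (2 * B * norm z) ^ m"
      using AB(1,2) C by (intro mult_mono power_mono mult_right_mono) auto
    also have "\<dots> \<le> (C + 2 * A) * (2 * B * norm z) ^ m * exp (C * norm z)"
      using mult_left_mono[OF e, of "(C + 2 * A) * (2 * B * norm z) ^ m"] AB(1,2) C by simp
    finally show ?thesis .
  next
    case False
    define y where "y = 2 * B * norm z"
    have y: "y \<ge> 1" using False by (simp add: y_def)
    have ym: "y ^ m \<ge> 1" using y by simp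
    have "norm (\<Sum>n<m. ?a n * z ^ n) \<le> (\<Sum>n<m. A * (y / 2) ^ n)"
      using an by (intro sum_norm_le) (simp add: y_def)
    also have "\<dots> = A * (\<Sum>n<m. (y / 2) ^ n)" by (simp add: sum_distrib_left)
    also have "\<dots> \<le> A * (2 * y ^ m)"
      using sum_half_powers_le[OF y] AB(1) by (intro mult_left_mono) auto
    finally have 1: "norm (\<Sum>n<m. ?a n * z ^ n) \<le> 2 * A * y ^ m" by simp
    have 2: "norm (lambda_minor z) \<le> C * exp (C * norm z)"
      unfolding C_def by (rule norm_lambda_minor_le[OF K z])
    have "norm (lambda_minor z - (\<Sum>n<m. ?a n * z ^ n)) \<le> C * exp (C * norm z) + 2 * A * y ^ m"
      using norm_triangle_ineq4[of "lambda_minor z" "\<Sum>n<m. ?a n * z ^ n"] 1 2 by linarith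
    also have "\<dots> \<le> C * exp (C * norm z) * y ^ m + 2 * A * y ^ m * exp (C * norm z)"
    proof (rule add_mono)
      show "C * exp (C * norm z) \<le> C * exp (C * norm z) * y ^ m"
        using mult_left_mono[OF ym, of "C * exp (C * norm z)"] C by simp
      show "2 * A * y ^ m \<le> 2 * A * y ^ m * exp (C * norm z)"
        using mult_left_mono[OF e, of "2 * A * y ^ m"] AB(1) y by simp
    qed
    also have "\<dots> = (C + 2 * A) * y ^ m * exp (C * norm z)" by (simp add: algebra_simps)
    finally show ?thesis by (simp add: y_def)
  qed
qed

text \<open>For \<open>arg z = 2 \<phi>\<close> the Laplace integral is taken in the direction \<open>- \<phi>\<close>.\<close>

lemma lambda_gevrey_large:
  assumes \<beta>: "0 < \<beta>" "\<beta> < pi"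
  obtains L M R where "L > 0" "M > 0" "R > 0"
    "\<And>z m. norm z \<ge> R \<Longrightarrow> \<bar>Arg z\<bar> < \<beta> \<Longrightarrow>
       norm (lambda_fun z - (\<Sum>n<Suc m. fps_nth lambda_series n / z ^ n)) \<le> L * M ^ Suc m * fact m / norm z ^ Suc m"
proof -
  let ?a = "fps_nth (borel_minor lambda_series)"
  obtain A B where AB: "A > 0" "B > 0" "\<And>n. norm (?a n) \<le> A * B ^ n"
    "\<And>z. 2 * B * norm z \<le> 1 \<Longrightarrow> (\<lambda>n. ?a n * z ^ n) sums lambda_minor z"
    using lambda_minor_local_bound by metis
  \<comment> \<open>A lower bound for \<open>cos \<theta>\<close> over all directions that occur, so
    that a single \<open>sector_dom K\<close> and a single type \<open>C\<close> serve every
    \<open>z\<close>.\<close>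
  define \<kappa> where "\<kappa> = cos (\<beta> / 2)"
  define K where "K = 2 / \<kappa>"
  define C where "C = stirling_bound + K"
  have \<kappa>: "\<kappa> > 0" unfolding \<kappa>_def using \<beta> by (intro cos_gt_zero_pi) auto
  have K: "K > 0" using \<kappa> by (simp add: K_def)
  have C: "C > 0" using K stirling_bound_nonneg by (simp add: C_def)
  define M where "M = (2 * B + 1) * (2 / \<kappa>)"
  show ?thesis
  \<comment> \<open>For such \<open>z\<close> at least half of
    \<open>Re w \<ge> \<kappa> * norm z\<close> survives the subtraction of \<open>C\<close>; this
    is the origin of the factor \<open>2 / \<kappa>\<close> in \<open>M\<close>.\<close>
  proof (rule that[of "C + 2 * A" M "2 * C / \<kappa>"])
    show "C + 2 * A > 0" using C AB by simp
    show "M > 0" using AB \<kappa> by (simp add: M_def)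
    show "2 * C / \<kappa> > 0" using C \<kappa> by simp
    fix z :: complex and m :: nat
    assume zR: "norm z \<ge> 2 * C / \<kappa>" and Arg: "\<bar>Arg z\<bar> < \<beta>"
    define \<theta> where "\<theta> = - Arg z / 2"
    define w where "w = z * cis \<theta>"
    have z0: "norm z > 0" using zR C \<kappa> by (smt (verit) divide_pos_pos mult_pos_pos)
    have th: "\<bar>\<theta>\<bar> < \<beta> / 2" "\<bar>\<theta>\<bar> < pi / 2" using Arg \<beta> by (auto simp: \<theta>_def)
    have cos: "cos \<theta> \<ge> \<kappa>"
    proof -
      have "cos (\<beta> / 2) \<le> cos \<bar>\<theta>\<bar>" using th \<beta> by (intro cos_monotone_0_pi_le) auto
      thus ?thesis by (simp add: \<kappa>_def)
    qed
    have "z = of_real (norm z) * cis (Arg z)" using rcis_cmod_Arg[of z] by (simp add: rcis_def)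
    hence "w = of_real (norm z) * (cis (Arg z) * cis \<theta>)"
      unfolding w_def by (metis mult.assoc)
    also have "cis (Arg z) * cis \<theta> = cis (- \<theta>)" by (simp add: cis_mult \<theta>_def)
    finally have w: "w = of_real (norm z) * cis (- \<theta>)" .
    have "\<kappa> * norm z \<le> Re w" using cos z0 by (simp add: w mult.commute)
    moreover have "C \<le> \<kappa> * norm z / 2" using zR \<kappa> by (simp add: field_simps)
    ultimately have Re: "Re w - C \<ge> \<kappa> * norm z / 2" by linarith
    have Re': "Re w > C" "Re w > 0" using Re C z0 \<kappa> mult_pos_pos[OF \<kappa> z0] by linarith+
    have ray: "of_real x * cis \<theta> \<in> sector_dom K" if "x > 0" for x
    proof -
      have "x * 1 < x * (K * cos \<theta>)"
      proof (intro mult_strict_left_mono that)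
        have "K * \<kappa> \<le> K * cos \<theta>" using cos K by (intro mult_left_mono) auto
        moreover have "K * \<kappa> = 2" using \<kappa> by (simp add: K_def)
        ultimately show "1 < K * cos \<theta>" by linarith
      qed
      thus ?thesis using that by (simp add: sector_dom_def norm_mult mult_ac)
    qed
    let ?f = "\<lambda>x. lambda_minor (of_real x * cis \<theta>) * cis \<theta>"
    let ?p = "\<lambda>n x. of_real x ^ n * (?a n * cis \<theta> ^ Suc n)"
    have cont: "continuous_on {0<..} ?f"
      by (intro continuous_intros continuous_on_compose2[OF holomorphic_on_imp_continuous_on[OF holomorphic_on_lambda_minor[OF K]]])
         (use ray in auto)
    have f: "exp_bounded ?f C C"
    proof (rule exp_bounded_continuous[OF cont])
      fix x :: real assume x: "x > 0"
      show "norm (?f x) \<le> C * exp (C * x)"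
        using norm_lambda_minor_le[OF K ray[OF x]] x by (simp add: norm_mult C_def)
    qed
    define d where "d = Re w / (2 * real (Suc m))"
    have d: "d > 0" using Re' by (simp add: d_def)
    have nd: "real n * d < Re w" if "n < m" for n
    proof -
      have "real n * d \<le> real m * d" using that d by (intro mult_right_mono) auto
      also have "\<dots> < Re w" using Re' by (simp add: d_def field_simps add_nonneg_pos)
      finally show ?thesis .
    qed
    have p: "exp_bounded (?p n) (1 / d ^ n * norm (?a n * cis \<theta> ^ Suc n)) (real n * d)" for n
      by (rule exp_bounded_cmult[OF exp_bounded_power[OF d]])
    have rem: "norm (?f x - (\<Sum>n<m. ?p n x)) \<le> (C + 2 * A) * (2 * B) ^ m * x ^ m * exp (C * x)" if x: "x > 0" for x
    proof -
      have "?f x - (\<Sum>n<m. ?p n x) = (lambda_minor (of_real x * cis \<theta>) - (\<Sum>n<m. ?a n * (of_real x * cis \<theta>) ^ n)) * cis \<theta>"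
        by (simp add: algebra_simps sum_distrib_left power_mult_distrib)
      also have "norm \<dots> = norm (lambda_minor (of_real x * cis \<theta>) - (\<Sum>n<m. ?a n * (of_real x * cis \<theta>) ^ n))"
        by (simp add: norm_mult)
      also have "\<dots> \<le> (C + 2 * A) * (2 * B * norm (of_real x * cis \<theta>)) ^ m * exp (C * norm (of_real x * cis \<theta>))"
        unfolding C_def by (rule lambda_minor_remainder_bound[OF AB K ray[OF x]])
      also have "norm (of_real x * cis \<theta>) = x" using x by (simp add: norm_mult)
      finally show ?thesis by (simp add: power_mult_distrib mult_ac)
    qed
    have sum_eb: "exp_bounded (\<lambda>x. \<Sum>n<m. ?p n x) (\<Sum>n<m. 1 / d ^ n * norm (?a n * cis \<theta> ^ Suc n)) (real m * d)"
    proof (rule exp_bounded_continuous)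
      fix x :: real assume x: "x > 0"
      have "norm (\<Sum>n<m. ?p n x) \<le> (\<Sum>n<m. (1 / d ^ n * norm (?a n * cis \<theta> ^ Suc n)) * exp (real m * d * x))"
      proof (rule sum_norm_le)
        fix n assume n: "n \<in> {..<m}"
        have "norm (?p n x) \<le> (1 / d ^ n * norm (?a n * cis \<theta> ^ Suc n)) * exp (real n * d * x)"
          using p[of n] x unfolding exp_bounded_def by blast
        also have "\<dots> \<le> (1 / d ^ n * norm (?a n * cis \<theta> ^ Suc n)) * exp (real m * d * x)"
          using n d x by (intro mult_left_mono) (auto intro!: mult_right_mono)
        finally show "norm (?p n x) \<le> (1 / d ^ n * norm (?a n * cis \<theta> ^ Suc n)) * exp (real m * d * x)" .
      qed
      thus "norm (\<Sum>n<m. ?p n x) \<le> (\<Sum>n<m. 1 / d ^ n * norm (?a n * cis \<theta> ^ Suc n)) * exp (real m * d * x)"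
        by (simp only: sum_distrib_right)
    qed (intro continuous_intros)
    have md: "real m * d < Re w" using Re' by (simp add: d_def field_simps add_nonneg_pos)
    have reb: "exp_bounded (\<lambda>x. ?f x - (\<Sum>n<m. ?p n x)) (C + (\<Sum>n<m. 1 / d ^ n * norm (?a n * cis \<theta> ^ Suc n))) (max C (real m * d))"
    proof (rule exp_bounded_continuous)
      show "continuous_on {0<..} (\<lambda>x. ?f x - (\<Sum>n<m. ?p n x))"
        by (intro continuous_intros cont)
      fix x :: real assume x: "x > 0"
      let ?S = "\<Sum>n<m. 1 / d ^ n * norm (?a n * cis \<theta> ^ Suc n)"
      have "norm (?f x - (\<Sum>n<m. ?p n x)) \<le> C * exp (C * x) + ?S * exp (real m * d * x)"
        using f sum_eb x unfolding exp_bounded_def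
        by (intro order_trans[OF norm_triangle_ineq4] add_mono) blast+
      also have "\<dots> \<le> C * exp (max C (real m * d) * x) + ?S * exp (max C (real m * d) * x)"
        using x C d by (intro add_mono mult_left_mono sum_nonneg) (auto intro!: mult_right_mono)
      finally show "norm (?f x - (\<Sum>n<m. ?p n x)) \<le> (C + ?S) * exp (max C (real m * d) * x)"
        by (simp only: distrib_right)
    qed
    have "laplace (\<lambda>x. ?f x - (\<Sum>n<m. ?p n x)) w = laplace ?f w - (\<Sum>n<m. laplace (?p n) w)"
      using laplace_sum[OF p, where K = "{..<m}" and z = w] nd
      by (subst laplace_diff[OF f sum_eb Re'(1) md]) auto
    also have "laplace ?f w = lambda_fun z - 1"
      using lambda_fun_eq_directional_laplace[OF th(2) f, of z] Re' by (simp add: w_def)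
    \<comment> \<open>The rotation leaves no trace: \<open>cis \<theta> ^ Suc n\<close> enters both
      through the integrand and through \<open>w ^ Suc n\<close>.\<close>
    also have "(\<Sum>n<m. laplace (?p n) w) = (\<Sum>n<m. fps_nth lambda_series (Suc n) / z ^ Suc n)"
    proof (rule sum.cong[OF refl])
      fix n
      have wn: "w ^ Suc n = z ^ Suc n * cis \<theta> ^ Suc n" by (simp only: w_def power_mult_distrib)
      have cancel: "p / (Z * U) * (q * U) = p * q / Z" if "U \<noteq> 0" for p q Z U :: complex
        using that by simp
      have "fact n / w ^ Suc n * (?a n * cis \<theta> ^ Suc n) = fact n * ?a n / z ^ Suc n"
        unfolding wn by (rule cancel) simp
      also have "fact n * ?a n = fps_nth lambda_series (Suc n)" by (simp add: borel_minor_nth)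
      finally show "laplace (?p n) w = fps_nth lambda_series (Suc n) / z ^ Suc n"
        unfolding laplace_cmult laplace_power[OF Re'(2)] .
    qed
    finally have eq: "laplace (\<lambda>x. ?f x - (\<Sum>n<m. ?p n x)) w = lambda_fun z - (\<Sum>n<Suc m. fps_nth lambda_series n / z ^ n)"
      by (subst sum.lessThan_Suc_shift) simp
    have "norm (lambda_fun z - (\<Sum>n<Suc m. fps_nth lambda_series n / z ^ n)) \<le>
        (C + 2 * A) * (2 * B) ^ m * fact m / (Re w - C) ^ Suc m"
      unfolding eq[symmetric] using Re' md
      by (intro norm_laplace_le_power[OF reb _ rem]) auto
    \<comment> \<open>A base at least \<open>1\<close> permits raising the exponent from
      \<open>m\<close> to \<open>Suc m\<close>, to match the denominator.\<close>
    also have "\<dots> \<le> (C + 2 * A) * (2 * B + 1) ^ Suc m * fact m / (\<kappa> * norm z / 2) ^ Suc m"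
    proof (intro frac_le mult_right_mono mult_left_mono power_mono)
      have "(2 * B) ^ m \<le> (2 * B + 1) ^ m" using AB by (intro power_mono) auto
      also have "\<dots> \<le> (2 * B + 1) ^ Suc m" using AB by (intro power_increasing) auto
      finally show "(2 * B) ^ m \<le> (2 * B + 1) ^ Suc m" .
    qed (use Re \<kappa> z0 C AB in auto)
    also have "\<dots> = (C + 2 * A) * M ^ Suc m * fact m / norm z ^ Suc m"
      using \<kappa> z0 by (simp only: M_def power_mult_distrib power_divide) (simp add: field_simps)
    finally show "norm (lambda_fun z - (\<Sum>n<Suc m. fps_nth lambda_series n / z ^ n)) \<le>
      (C + 2 * A) * M ^ Suc m * fact m / norm z ^ Suc m" .
  qed
qed

lemma lambda_fun_bounded_annular_sector:
  assumes "0 < c" "0 < \<beta>" "\<beta> < pi"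
  obtains L where "L > 0" "\<And>z. c \<le> norm z \<Longrightarrow> norm z \<le> R \<Longrightarrow> \<bar>Arg z\<bar> < \<beta> \<Longrightarrow> norm (lambda_fun z) \<le> L"
proof -
  \<comment> \<open>The condition on \<open>Arg\<close> is relaxed to one on \<open>Re z\<close>,
    which visibly defines a closed set; \<open>cos \<beta> > -1\<close> keeps it away from the
    cut.\<close>
  define T where "T = cball 0 R \<inter> ({z. c \<le> norm z} \<inter> {z. cos \<beta> * norm z \<le> Re z})"
  have cb: "cos \<beta> > -1" using assms cos_monotone_0_pi[of \<beta> pi] by simp
  have "compact T" unfolding T_def
    by (intro compact_Int_closed compact_cball closed_Int closed_Collect_le continuous_intros)
  moreover have "T \<subseteq> - \<real>\<^sub>\<le>\<^sub>0"
  proof safe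
    fix z :: complex assume z: "z \<in> T" "z \<in> \<real>\<^sub>\<le>\<^sub>0"
    hence "Im z = 0" "Re z \<le> 0" by (auto simp: complex_nonpos_Reals_iff)
    hence "norm z = - Re z" by (simp add: cmod_eq_Re)
    hence "(cos \<beta> + 1) * norm z \<le> 0" using z by (simp add: T_def algebra_simps)
    moreover have "norm z > 0" using z assms by (auto simp: T_def)
    ultimately show False using cb by (simp add: mult_le_0_iff)
  qed
  ultimately have "compact (lambda_fun ` T)"
    by (intro compact_continuous_image continuous_on_subset[OF holomorphic_on_imp_continuous_on[OF holomorphic_on_lambda_fun]])
  then obtain L where L: "L > 0" "\<And>z. z \<in> T \<Longrightarrow> norm (lambda_fun z) \<le> L"
    using compact_imp_bounded bounded_pos by (metis imageI)
  show ?thesis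
  proof (rule that[OF L(1)])
    fix z assume z: "c \<le> norm z" "norm z \<le> R" "\<bar>Arg z\<bar> < \<beta>"
    have "cos \<beta> \<le> cos \<bar>Arg z\<bar>" using z assms by (intro cos_monotone_0_pi_le) auto
    hence "cos \<beta> * norm z \<le> cos (Arg z) * norm z" by (intro mult_right_mono) auto
    also have "\<dots> = Re z" using rcis_cmod_Arg[of z] by (metis Re_rcis mult.commute)
    finally show "norm (lambda_fun z) \<le> L" using z by (intro L(2)) (auto simp: T_def)
  qed
qed

theorem gevrey1_asymp_lambda:
  assumes c: "c > 0" and \<beta>: "0 < \<beta>" "\<beta> < pi"
  shows   "gevrey1_asymp lambda_fun lambda_series {z. norm z > c \<and> Arg z \<in> {-\<beta><..<\<beta>}}"
proof -
  let ?l = "fps_nth lambda_series"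
  obtain L1 M1 R where L1: "L1 > 0" "M1 > 0" "R > 0"
    "\<And>z m. norm z \<ge> R \<Longrightarrow> \<bar>Arg z\<bar> < \<beta> \<Longrightarrow>
       norm (lambda_fun z - (\<Sum>n<Suc m. ?l n / z ^ n)) \<le> L1 * M1 ^ Suc m * fact m / norm z ^ Suc m"
    using lambda_gevrey_large[OF \<beta>] by metis
  obtain L2 where L2: "L2 > 0" "\<And>z. c \<le> norm z \<Longrightarrow> norm z \<le> R \<Longrightarrow> \<bar>Arg z\<bar> < \<beta> \<Longrightarrow> norm (lambda_fun z) \<le> L2"
    using lambda_fun_bounded_annular_sector[OF c \<beta>] by metis
  obtain A B where AB: "A > 0" "B > 0" "\<And>n. norm (fps_nth (borel_minor lambda_series) n) \<le> A * B ^ n"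
    using lambda_minor_local_bound by metis
  have ln: "norm (?l n) \<le> (A + 1) * (B + 1) ^ n * fact n" for n
  proof (cases n)
    case (Suc k)
    have "norm (?l (Suc k)) = fact k * norm (fps_nth (borel_minor lambda_series) k)"
      by (simp add: borel_minor_nth norm_divide)
    also have "\<dots> \<le> fact k * (A * B ^ k)" by (intro mult_left_mono AB) auto
    also have "\<dots> \<le> fact (Suc k) * ((A + 1) * (B + 1) ^ Suc k)"
    proof (intro mult_mono)
      have "B ^ k \<le> (B + 1) ^ k" using AB by (intro power_mono) auto
      also have "\<dots> \<le> (B + 1) ^ Suc k" using AB by (intro power_increasing) auto
      finally show "B ^ k \<le> (B + 1) ^ Suc k" .
    qed (use AB in \<open>auto simp: fact_mono simp del: fact_Suc\<close>)
    finally show ?thesis using Suc by (simp only: mult_ac)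
  qed (use AB in auto)
  \<comment> \<open>For \<open>norm z < R\<close> the summand with \<open>R\<close> gives
    \<open>M / norm z \<ge> 1\<close>, and the one with \<open>B + 1\<close> leaves the factor
    \<open>2\<close> needed for summing half powers.\<close>
  define M where "M = M1 + 2 * (B + 1 + R)"
  define L where "L = (1 + L1 * M1 / c + L1) + (L2 + 2 * (A + 1))"
  have M: "M > 0" "M \<ge> M1" using L1 AB by (auto simp: M_def)
  have L1c: "L1 * M1 / c \<ge> 0" using L1 c by simp
  have L: "L > 0" using L1 L2 AB L1c by (simp add: L_def add_nonneg_pos add_pos_nonneg)
  have "norm (lambda_fun z - (\<Sum>n<N. ?l n / z ^ n)) \<le> L * M ^ N * fact N / norm z ^ N"
    if z: "norm z > c" "\<bar>Arg z\<bar> < \<beta>" for z N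
  proof (cases "norm z \<ge> R")
    case True
    show ?thesis
    proof (cases N)
      case 0
      \<comment> \<open>The estimate for large \<open>norm z\<close> always subtracts at least the
        constant term, so the empty sum is recovered from its case \<open>m = 0\<close>.\<close>
      have "norm (lambda_fun z) \<le> norm (lambda_fun z - 1) + 1"
        using norm_triangle_sub[of "lambda_fun z" 1] by simp
      also have "norm (lambda_fun z - 1) \<le> L1 * M1 / norm z"
        using L1(4)[OF True z(2), of 0] by simp
      also have "\<dots> \<le> L1 * M1 / c"
        using L1 z c by (intro divide_left_mono mult_pos_pos) auto
      finally show ?thesis using 0 L1 L2 AB by (simp add: L_def)
    next
      case (Suc m)
      have "norm (lambda_fun z - (\<Sum>n<Suc m. ?l n / z ^ n)) \<le> L1 * M1 ^ Suc m * fact m / norm z ^ Suc m"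
        by (rule L1(4)[OF True z(2)])
      also have "\<dots> \<le> L * M ^ Suc m * fact (Suc m) / norm z ^ Suc m"
        using L1 L2 AB M L1c L
        by (intro divide_right_mono mult_mono power_mono fact_mono) (auto simp: L_def simp del: fact_Suc)
      finally show ?thesis using Suc by simp
    qed
  next
    case False
    define y where "y = M / norm z"
    have z0: "norm z > 0" using z c by linarith
    have y: "y \<ge> 1" "(B + 1) / norm z \<le> y / 2"
      using False z0 L1 AB unfolding y_def M_def by (auto simp: field_simps)
    \<comment> \<open>In the bounded region the function and the partial sum are estimated
      separately, since \<open>y ^ N \<ge> 1\<close>.\<close>
    have "norm (\<Sum>n<N. ?l n / z ^ n) \<le> (\<Sum>n<N. (A + 1) * fact N * (y / 2) ^ n)"
    proof (rule sum_norm_le)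
      fix n assume n: "n \<in> {..<N}"
      have "norm (?l n / z ^ n) \<le> (A + 1) * (B + 1) ^ n * fact n / norm z ^ n"
        unfolding norm_divide norm_power by (intro divide_right_mono ln) auto
      also have "\<dots> = (A + 1) * fact n * ((B + 1) / norm z) ^ n" by (simp add: power_divide)
      also have "\<dots> \<le> (A + 1) * fact N * (y / 2) ^ n"
        using n y AB z0 by (intro mult_mono power_mono fact_mono) auto
      finally show "norm (?l n / z ^ n) \<le> (A + 1) * fact N * (y / 2) ^ n" .
    qed
    also have "\<dots> = (A + 1) * fact N * (\<Sum>n<N. (y / 2) ^ n)" by (simp add: sum_distrib_left)
    also have "\<dots> \<le> (A + 1) * fact N * (2 * y ^ N)"
      using AB by (intro mult_left_mono sum_half_powers_le y) auto
    finally have 1: "norm (\<Sum>n<N. ?l n / z ^ n) \<le> 2 * (A + 1) * (fact N * y ^ N)" by (simp only: mult_ac)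
    have "norm (lambda_fun z) \<le> L2" using L2(2) False z by simp
    also have "\<dots> \<le> L2 * (fact N * y ^ N)"
    proof -
      have "1 * 1 \<le> fact N * y ^ N" using y by (intro mult_mono) (auto simp: fact_ge_1)
      thus ?thesis using mult_left_mono[of 1 "fact N * y ^ N" L2] L2(1) by simp
    qed
    finally have "norm (lambda_fun z - (\<Sum>n<N. ?l n / z ^ n)) \<le> (L2 + 2 * (A + 1)) * (fact N * y ^ N)"
      using norm_triangle_ineq4[of "lambda_fun z" "\<Sum>n<N. ?l n / z ^ n"] 1 by (simp only: distrib_right)
    also have "\<dots> \<le> L * (fact N * y ^ N)"
      using y L1 L1c by (intro mult_right_mono) (auto simp: L_def)
    finally show ?thesis by (simp add: y_def power_divide mult_ac)
  qed
  thus ?thesis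
    unfolding gevrey1_asymp_def using L M by (intro exI[of _ L] conjI exI[of _ M]) auto
qed

theorem corollary11p3:
  shows "one_summable {-pi/2<..<pi/2} lambda_series \<and>
    has_borel_sum {-pi/2<..<pi/2} lambda_series lambda_fun \<and>
    (\<exists>g :: nat \<Rightarrow> complex.
       lambda_series = 1 + fps_X * Abs_fps g \<and>
       (\<forall>c \<beta>. c > 0 \<longrightarrow> 0 < \<beta> \<longrightarrow> \<beta> < pi \<longrightarrow>
          gevrey1_asymp lambda_fun (1 + fps_X * Abs_fps g)
            {z. norm z > c \<and> Arg z \<in> {-\<beta><..<\<beta>}}) \<and>
       (\<forall>n. g n \<in> \<rat>) \<and>
       g 0 = 1/2 * bernoulli 2 \<and>
       g 1 = 1/8 * bernoulli 2 ^ 2 \<and>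
       g 2 = 1/48 * bernoulli 2 ^ 3 + 1/12 * bernoulli 4 \<and>
       g 3 = 1/384 * bernoulli 2 ^ 4 + 1/24 * bernoulli 2 * bernoulli 4 \<and>
       g 4 = 1/3840 * bernoulli 2 ^ 5 + 1/96 * bernoulli 2 ^ 2 * bernoulli 4 + 1/30 * bernoulli 6)"
proof (intro conjI exI[of _ "\<lambda>n. fps_nth lambda_series (n + 1)"] allI impI)
  let ?g = "\<lambda>n. fps_nth lambda_series (n + 1)"
  show eq: "lambda_series = 1 + fps_X * Abs_fps ?g"
  proof (rule fps_ext)
    show "fps_nth lambda_series n = fps_nth (1 + fps_X * Abs_fps ?g) n" for n
      by (cases n) auto
  qed
  show "gevrey1_asymp lambda_fun (1 + fps_X * Abs_fps ?g) {z. norm z > c \<and> Arg z \<in> {-\<beta><..<\<beta>}}"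
    if "c > 0" "0 < \<beta>" "\<beta> < pi" for c \<beta>
    using gevrey1_asymp_lambda[OF that] unfolding eq[symmetric] .
  show "has_borel_sum {-pi/2<..<pi/2} lambda_series lambda_fun" by (rule has_borel_sum_lambda)
  thus "one_summable {-pi/2<..<pi/2} lambda_series" by (simp add: has_borel_sum_def)
qed (use lambda_series_coeffs lambda_series_Rats in \<open>simp_all add: numeral_eq_Suc\<close>)

end
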